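(* Let $G$ be a simple connected plane graph all of whose faces are bounded by simple cycles. Then $\mathrm{AT}(\overline{G}_{vef})\leqslant 8$.
   Context: Let $V,E,F$ be the vertex, edge and face sets of $G$. Two edges of $G$ are facially adjacent if they share a vertex and lie on the boundary of a common face of $G$. The facial entire graph $\overline{G}_{vef}$ is the simple graph with vertex set $V\cup E\cup F$ in which: two vertices of $G$ are adjacent iff adjacent in $G$; two edges of $G$ are adjacent iff facially adjacent; two faces are adjacent iff they share an edge of $G$; a vertex $v$ and an edge $e$ are adjacent iff $v$ is an endpoint of $e$; a vertex $v$ and a face $f$ are adjacent iff $v$ lies on the boundary of $f$; an edge $e$ and a face $f$ are adjacent iff $e$ lies on the boundary of $f$. For a finite simple graph $H$ with vertex set $\{v_1,\dots,v_N\}$, the graph polynomial is $P_H=\prod_{v_iv_j\in E(H)}(v_i-v_j)\in\mathbb{R}[v_1,\dots,v_N]$ (one factor per edge, with a fixed choice of sign). The Alon–Tarsi number $\mathrm{AT}(H)$ is the least integer $k$ such that $P_H$ contains a monomial with nonzero coefficient in which every variable has degree at most $k-1$. *)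

theory Defs
  imports "HOL-Analysis.Analysis" "HOL-Library.Poly_Mapping"
begin

section \<open>Plane graphs\<close>

text \<open>
  A plane graph is a finite set \<open>V\<close> of points of the plane (type \<^typ>\<open>complex\<close>) together with a
  finite set \<open>E\<close> of arcs, each arc given by its point set. The interior of an edge contains no
  vertex and no point of another edge. As the endpoints of an edge are precisely the vertices lying
  on it, the set of endpoints of \<open>e\<close> is \<open>V \<inter> e\<close>. The two endpoints of an arc are distinct, so there
  are no loops.
\<close>

definition plane_graph :: "complex set \<Rightarrow> complex set set \<Rightarrow> bool" where
  "plane_graph V E \<longleftrightarrow>
     finite V \<and> finite E \<and>
     (\<forall>e\<in>E. \<exists>g. arc g \<and> path_image g = e \<and> V \<inter> e = {pathstart g, pathfinish g}) \<and>
     (\<forall>e\<in>E. \<forall>e'\<in>E. e \<noteq> e' \<longrightarrow> e \<inter> e' \<subseteq> V)"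

definition ends :: "complex set \<Rightarrow> complex set \<Rightarrow> complex set" where
  "ends V e = V \<inter> e"

definition no_parallel_edges :: "complex set \<Rightarrow> complex set set \<Rightarrow> bool" where
  "no_parallel_edges V E \<longleftrightarrow> inj_on (ends V) E"

definition simple_plane_graph :: "complex set \<Rightarrow> complex set set \<Rightarrow> bool" where
  "simple_plane_graph V E \<longleftrightarrow> plane_graph V E \<and> no_parallel_edges V E"

definition adjacent :: "complex set \<Rightarrow> complex set set \<Rightarrow> complex \<Rightarrow> complex \<Rightarrow> bool" where
  "adjacent V E u v \<longleftrightarrow> (\<exists>e\<in>E. ends V e = {u, v})"

definition graph_connected :: "complex set \<Rightarrow> complex set set \<Rightarrow> bool" where
  "graph_connected V E \<longleftrightarrow> V \<noteq> {} \<and> (\<forall>u\<in>V. \<forall>v\<in>V. (adjacent V E)\<^sup>*\<^sup>* u v)"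

definition faces :: "complex set \<Rightarrow> complex set set \<Rightarrow> complex set set" where
  "faces V E = components (- (V \<union> \<Union>E))"

definition simple_cycle ::
    "complex set \<Rightarrow> complex set set \<Rightarrow> complex list \<Rightarrow> complex set list \<Rightarrow> bool" where
  "simple_cycle V E vs es \<longleftrightarrow>
     3 \<le> length vs \<and> distinct vs \<and> length es = length vs \<and> set es \<subseteq> E \<and>
     (\<forall>i<length vs. ends V (es ! i) = {vs ! i, vs ! (Suc i mod length vs)})"

definition bounded_by_simple_cycle ::
    "complex set \<Rightarrow> complex set set \<Rightarrow> complex set \<Rightarrow> bool" where
  "bounded_by_simple_cycle V E f \<longleftrightarrow>
     (\<exists>vs es. simple_cycle V E vs es \<and> frontier f = \<Union>(set es))"


section \<open>The facial entire graph\<close>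

text \<open>An abstract finite simple graph is a set of vertices together with a set of two-element
  sets of vertices.\<close>

datatype entity = Vertex complex | Edge "complex set" | Face "complex set"

definition facially_adjacent ::
    "complex set \<Rightarrow> complex set set \<Rightarrow> complex set \<Rightarrow> complex set \<Rightarrow> bool" where
  "facially_adjacent V E e e' \<longleftrightarrow>
     e \<noteq> e' \<and> ends V e \<inter> ends V e' \<noteq> {} \<and>
     (\<exists>f\<in>faces V E. e \<subseteq> frontier f \<and> e' \<subseteq> frontier f)"

definition facial_entire_verts :: "complex set \<Rightarrow> complex set set \<Rightarrow> entity set" where
  "facial_entire_verts V E = Vertex ` V \<union> Edge ` E \<union> Face ` faces V E"

definition facial_entire_edges :: "complex set \<Rightarrow> complex set set \<Rightarrow> entity set set" where
  "facial_entire_edges V E =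
     {{Vertex u, Vertex v} | u v. u \<in> V \<and> v \<in> V \<and> u \<noteq> v \<and> adjacent V E u v} \<union>
     {{Edge e, Edge e'} | e e'. e \<in> E \<and> e' \<in> E \<and> facially_adjacent V E e e'} \<union>
     {{Face f, Face f'} | f f'. f \<in> faces V E \<and> f' \<in> faces V E \<and> f \<noteq> f' \<and>
        (\<exists>e\<in>E. e \<subseteq> frontier f \<and> e \<subseteq> frontier f')} \<union>
     {{Vertex v, Edge e} | v e. v \<in> V \<and> e \<in> E \<and> v \<in> ends V e} \<union>
     {{Vertex v, Face f} | v f. v \<in> V \<and> f \<in> faces V E \<and> v \<in> frontier f} \<union>
     {{Edge e, Face f} | e f. e \<in> E \<and> f \<in> faces V E \<and> e \<subseteq> frontier f}"


section \<open>Graph polynomial and Alon--Tarsi number\<close>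

text \<open>Real polynomials in variables indexed by \<open>'a\<close> are finitely supported functions from monomials
  to coefficients, a monomial being a finitely supported exponent function.\<close>

type_synonym 'a real_mpoly = "('a \<Rightarrow>\<^sub>0 nat) \<Rightarrow>\<^sub>0 real"

definition var :: "'a \<Rightarrow> 'a real_mpoly" where
  "var x = Poly_Mapping.single (Poly_Mapping.single x 1) 1"

text \<open>The sign of each factor is fixed by a choice of an order of the two ends of the edge.\<close>

definition edge_factor :: "'a set \<Rightarrow> 'a real_mpoly" where
  "edge_factor h = (let p = (SOME p. h = {fst p, snd p}) in var (fst p) - var (snd p))"

definition graph_poly :: "'a set set \<Rightarrow> 'a real_mpoly" where
  "graph_poly H = (\<Prod>h\<in>H. edge_factor h)"

text \<open>The condition that the exponents are at most \<open>k - 1\<close> is written with \<open><\<close>, since subtraction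
  on \<^typ>\<open>nat\<close> is truncated.\<close>

definition alon_tarsi_number :: "'a set \<Rightarrow> 'a set set \<Rightarrow> nat" where
  "alon_tarsi_number W H =
     (LEAST k. \<exists>m. Poly_Mapping.lookup (graph_poly H) m \<noteq> 0 \<and>
                   (\<forall>x\<in>W. Poly_Mapping.lookup m x < k))"

end

theory Submission
  imports Defs "HOL-Complex_Analysis.Winding_Numbers" "HOL-Library.Z2"
begin

text \<open>
  It suffices to find a monomial that has an odd coefficient and all exponents at most 7, so we work
  over the field with two elements. The monomial is built by adding the elements of the facial entire
  graph one at a time, letting every edge from a new element \<open>x\<close> to an older one pick the variable of
  the older one; the exponent of \<open>x\<close> then counts its neighbours that are added after it, and the
  step is harmless as long as there are at most 7 of them.

  An edge of \<open>G\<close> has degree at most 8 in the facial entire graph, and edges of \<open>G\<close> are connected by facial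
  adjacency. So, once a starting set is found, all edges can be added. The starting set is
  an edge of degree at most 7 or else an induced theta graph among the edges: the edges
  around a vertex contain a chordless cycle, and a part of a face boundary is an ear of it. In a theta
  graph, contracting the interior vertices of the three paths reduces the coefficient to that of
  \<open>a\<^sup>2 b\<close> in \<open>(a + b)\<^sup>3\<close>, which is odd.

  The vertices and faces come last. Every nonempty set of them contains an element with at most 7
  neighbours inside the set, because the vertex-face graph is 1-planar; the count rests on Euler's
  inequality for \<open>G\<close>. This inequality, and the fact that each edge lies on exactly two faces, are obtained
  from winding numbers: a sum of the winding numbers of the edge arcs, weighted by a flow on \<open>G\<close>,
  is constant on faces and jumps across an edge by the flow through it.
\<close>

section \<open>Orientations and the Alon--Tarsi number\<close>

text \<open>The obstacle is the very first element. If every edge of \<open>G\<close> has degree 8,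
  an edge cannot be added first, as all eight of its neighbours would come later; vertices and faces
  have unbounded degree. So the start has to be a set whose orientation is not acyclic. A cycle does
  not serve: the product of its variables has coefficient 2, which vanishes modulo 2. A theta graph
  does, with exponent 2 at one branch vertex and 1 elsewhere. These exponents are smaller than the
  degrees inside the theta graph, and this gains the unit that turns 8 into 7. Afterwards
  connectivity gains it: each further edge has a neighbour added before it. The 8 is 4 + 2 + 2: an
  edge has at most two facially adjacent edges at either end, two ends and two faces. The 7 for
  vertices and faces is the 1-planar bound of 4 n - 8 edges, which makes the average degree smaller
  than 8.\<close>

definition var2 :: "'a \<Rightarrow> ('a \<Rightarrow>\<^sub>0 nat) \<Rightarrow>\<^sub>0 bit" where
  "var2 x = Poly_Mapping.single (Poly_Mapping.single x 1) 1"

definition graph_poly2 :: "'a set set \<Rightarrow> ('a \<Rightarrow>\<^sub>0 nat) \<Rightarrow>\<^sub>0 bit" where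
  "graph_poly2 H = (\<Prod>h\<in>H. \<Sum>x\<in>h. var2 x)"

text \<open>Subtraction of exponents on \<open>nat\<close> is truncated, so the monomials not
  divisible by \<open>x\<close> form a case of their own.\<close>

lemma lookup_single_mult:
  fixes p :: "('a \<Rightarrow>\<^sub>0 nat) \<Rightarrow>\<^sub>0 'b::comm_ring_1"
  shows "Poly_Mapping.lookup (Poly_Mapping.single (Poly_Mapping.single x 1) 1 * p) m =
    (if Poly_Mapping.lookup m x = 0 then 0
     else Poly_Mapping.lookup p (m - Poly_Mapping.single x 1))"
proof (induction p arbitrary: m rule: update_induct)
  case const
  then show ?case by simp
next
  case (update p k c)
  have upd: "Poly_Mapping.update k c p = p + Poly_Mapping.single k c"
    using update(1) by (intro poly_mapping_eqI)
      (auto simp: lookup_update lookup_add lookup_single in_keys_iff when_def)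
  have eq: "Poly_Mapping.single x 1 + k = m \<longleftrightarrow>
      Poly_Mapping.lookup m x \<noteq> 0 \<and> k = m - Poly_Mapping.single x 1"
    by (auto simp: poly_mapping_eq_iff fun_eq_iff lookup_add lookup_minus lookup_single when_def
        split: if_splits)
  have IH: "\<And>m. Poly_Mapping.lookup (Poly_Mapping.single (Poly_Mapping.single x 1) 1 * p) m =
    (if Poly_Mapping.lookup m x = 0 then 0
     else Poly_Mapping.lookup p (m - Poly_Mapping.single x 1))"
    using update by simp
  show ?case
    unfolding upd
    unfolding distrib_left lookup_add IH mult_single lookup_single when_def eq
    by auto
qed

lemma lookup_var_mult:
  "Poly_Mapping.lookup (var x * p) m = (if Poly_Mapping.lookup m x = 0 then 0
     else Poly_Mapping.lookup p (m - Poly_Mapping.single x 1))"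
  unfolding var_def by (rule lookup_single_mult)

lemma lookup_var2_mult:
  "Poly_Mapping.lookup (var2 x * p) m = (if Poly_Mapping.lookup m x = 0 then 0
     else Poly_Mapping.lookup p (m - Poly_Mapping.single x 1))"
  unfolding var2_def by (rule lookup_single_mult)

text \<open>Both polynomials are images of one integer polynomial, and modulo 2 the sign chosen for
  a factor disappears. An odd coefficient of \<open>graph_poly2\<close> thus certifies a nonzero
  real one.\<close>

lemma graph_poly_parity:
  assumes "finite H" "\<forall>h\<in>H. card h = 2"
  shows "\<exists>k::int. Poly_Mapping.lookup (graph_poly H) m = of_int k \<and>
      Poly_Mapping.lookup (graph_poly2 H) m = of_int k"
  using assms
proof (induction H arbitrary: m rule: finite_induct)
  case empty
  show ?case
    by (rule exI[of _ "if m = 0 then 1 else 0"])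
      (simp add: graph_poly_def graph_poly2_def lookup_one when_def)
next
  case (insert h H)
  define p where "p = (SOME p. h = {fst p, snd p})"
  have "\<exists>p. h = {fst p, snd p}"
    using insert.prems by (auto simp: card_2_iff)
  hence hp: "h = {fst p, snd p}"
    unfolding p_def by (rule someI_ex)
  obtain x y where p: "p = (x, y)"
    by (cases p)
  have h: "h = {x, y}" and xy: "x \<noteq> y"
    using hp p insert.prems by auto
  have 1: "graph_poly (insert h H) = var x * graph_poly H - var y * graph_poly H"
    using insert.hyps
    by (simp add: graph_poly_def edge_factor_def p_def[symmetric] p left_diff_distrib)
  have 2: "graph_poly2 (insert h H) = var2 x * graph_poly2 H + var2 y * graph_poly2 H"
    using insert.hyps xy by (simp add: graph_poly2_def h distrib_right)
  have IH: "\<And>m. \<exists>k::int. Poly_Mapping.lookup (graph_poly H) m = of_int k \<and>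
      Poly_Mapping.lookup (graph_poly2 H) m = of_int k"
    using insert by blast
  have *: "\<exists>k::int. Poly_Mapping.lookup (var z * graph_poly H) m = of_int k \<and>
      Poly_Mapping.lookup (var2 z * graph_poly2 H) m = of_int k" for z
    using IH[of "m - Poly_Mapping.single z 1"]
    by (cases "Poly_Mapping.lookup m z = 0")
      (auto simp: lookup_var_mult lookup_var2_mult intro: exI[of _ 0])
  obtain k l :: int where k: "Poly_Mapping.lookup (var x * graph_poly H) m = of_int k"
      "Poly_Mapping.lookup (var2 x * graph_poly2 H) m = of_int k"
    and l: "Poly_Mapping.lookup (var y * graph_poly H) m = of_int l"
      "Poly_Mapping.lookup (var2 y * graph_poly2 H) m = of_int l"
    using *[of x] *[of y] by blast
  have "(of_int l :: bit) = - of_int l"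
    by (cases "of_int l :: bit") auto
  hence "Poly_Mapping.lookup (graph_poly2 (insert h H)) m = of_int (k - l)"
    using k l by (simp add: 2 lookup_add)
  moreover have "Poly_Mapping.lookup (graph_poly (insert h H)) m = of_int (k - l)"
    using k l by (simp add: 1 lookup_minus)
  ultimately show ?case
    by blast
qed

text \<open>The edges leaving \<open>U\<close> are reserved: when their other ends are added later, they all pick their
  end in \<open>U\<close>.\<close>

definition orientable_within :: "'a set set \<Rightarrow> nat \<Rightarrow> 'a set \<Rightarrow> bool" where
  "orientable_within H d U \<longleftrightarrow>
     (\<exists>m. Poly_Mapping.lookup (graph_poly2 {h\<in>H. h \<subseteq> U}) m \<noteq> 0 \<and> Poly_Mapping.keys m \<subseteq> U \<and>
          (\<forall>y\<in>U. Poly_Mapping.lookup m y + card {h\<in>H. y \<in> h \<and> \<not> h \<subseteq> U} \<le> d))"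

lemma alon_tarsi_number_le:
  assumes "finite H" "\<forall>h\<in>H. card h = 2 \<and> h \<subseteq> W" "orientable_within H d W"
  shows "alon_tarsi_number W H \<le> Suc d"
proof -
  have "{h\<in>H. h \<subseteq> W} = H"
    using assms(2) by auto
  then obtain m where m: "Poly_Mapping.lookup (graph_poly2 H) m \<noteq> 0"
      "\<forall>y\<in>W. Poly_Mapping.lookup m y + card {h\<in>H. y \<in> h \<and> \<not> h \<subseteq> W} \<le> d"
    using assms(3) unfolding orientable_within_def by auto
  obtain k :: int where "Poly_Mapping.lookup (graph_poly H) m = of_int k"
      "Poly_Mapping.lookup (graph_poly2 H) m = of_int k"
    using graph_poly_parity[of H m] assms by auto
  hence "Poly_Mapping.lookup (graph_poly H) m \<noteq> 0"
    using m(1) by auto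
  moreover have "\<forall>x\<in>W. Poly_Mapping.lookup m x < Suc d"
    using m(2) by (auto simp: less_Suc_eq_le dest: add_leD1)
  ultimately show ?thesis
    unfolding alon_tarsi_number_def by (intro Least_le) blast
qed

text \<open>The extended monomial has exponent 0 in \<open>x\<close>, so each factor of the star
  must contribute the variable \<open>z h\<close>; there is just one such choice.\<close>

lemma lookup_mult_star:
  assumes "finite Q" "\<And>h. h \<in> Q \<Longrightarrow> h = {x, z h} \<and> z h \<noteq> x" "Poly_Mapping.lookup m x = 0"
  shows "Poly_Mapping.lookup (p * (\<Prod>h\<in>Q. \<Sum>y\<in>h. var2 y))
      (m + (\<Sum>h\<in>Q. Poly_Mapping.single (z h) 1)) = Poly_Mapping.lookup p m"
  using assms
proof (induction Q rule: finite_induct)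
  case (insert h Q)
  let ?P = "p * (\<Prod>h\<in>Q. \<Sum>y\<in>h. var2 y)"
  let ?m = "m + (\<Sum>h\<in>Q. Poly_Mapping.single (z h) 1)"
  have h: "h = {x, z h}" "z h \<noteq> x"
    using insert.prems by auto
  have "(\<Sum>y\<in>h. var2 y) = var2 x + var2 (z h)"
    using h(2) by (subst h(1)) simp
  hence eq: "p * (\<Prod>h\<in>insert h Q. \<Sum>y\<in>h. var2 y) = var2 x * ?P + var2 (z h) * ?P"
    using insert.hyps by (simp add: algebra_simps)
  have 0: "Poly_Mapping.lookup (?m + Poly_Mapping.single (z h) 1) x = 0"
    using insert.prems(1,2) h(2) \<open>finite Q\<close>
    by (auto simp: lookup_add lookup_sum lookup_single when_def)
  have m: "m + (\<Sum>h\<in>insert h Q. Poly_Mapping.single (z h) 1) = ?m + Poly_Mapping.single (z h) 1"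
    using insert.hyps by (simp add: algebra_simps)
  show ?case
    unfolding m eq lookup_add[of "var2 x * ?P"] lookup_var2_mult
    using 0 insert.IH insert.prems by (simp add: lookup_add)
qed simp

lemma card_two_eq_insert:
  assumes "card h = 2" "x \<in> h"
  shows "h = {x, the_elem (h - {x})} \<and> the_elem (h - {x}) \<noteq> x"
  using assms by (auto simp: card_2_iff insert_Diff_if the_elem_def)

text \<open>Each pair in \<open>Q\<close> moves one unit at its older end from the reserved count to
  the exponent, so the bound on \<open>U\<close> persists. The new element has exponent 0, and only
  its reserved pairs count against \<open>d\<close>.\<close>

lemma orientable_within_insert:
  assumes H: "finite H" "\<And>h. h \<in> H \<Longrightarrow> card h = 2"
    and U: "orientable_within H d U" "x \<notin> U"
    and x: "card {h\<in>H. x \<in> h \<and> \<not> h \<subseteq> insert x U} \<le> d"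
  shows "orientable_within H d (insert x U)"
proof -
  obtain m where m: "Poly_Mapping.lookup (graph_poly2 {h\<in>H. h \<subseteq> U}) m \<noteq> 0"
      "Poly_Mapping.keys m \<subseteq> U"
      "\<forall>y\<in>U. Poly_Mapping.lookup m y + card {h\<in>H. y \<in> h \<and> \<not> h \<subseteq> U} \<le> d"
    using U(1) unfolding orientable_within_def by (elim exE conjE)
  define Q where "Q = {h\<in>H. x \<in> h \<and> h \<subseteq> insert x U}"
  define z where "z h = the_elem (h - {x})" for h
  define m' where "m' = m + (\<Sum>h\<in>Q. Poly_Mapping.single (z h) 1)"
  have z: "h = {x, z h} \<and> z h \<noteq> x" if "h \<in> Q" for h
    unfolding z_def using that H(2) by (intro card_two_eq_insert) (simp_all add: Q_def)
  have fin: "finite Q"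
    using H(1) by (simp add: Q_def)
  have "{h\<in>H. h \<subseteq> insert x U} = {h\<in>H. h \<subseteq> U} \<union> Q" "{h\<in>H. h \<subseteq> U} \<inter> Q = {}"
    using U(2) by (auto simp: Q_def)
  hence "graph_poly2 {h\<in>H. h \<subseteq> insert x U} =
      graph_poly2 {h\<in>H. h \<subseteq> U} * (\<Prod>h\<in>Q. \<Sum>y\<in>h. var2 y)"
    using H(1) fin by (simp add: graph_poly2_def prod.union_disjoint)
  moreover have mx: "Poly_Mapping.lookup m x = 0"
    using m(2) U(2) by (auto simp: in_keys_iff)
  ultimately have 1: "Poly_Mapping.lookup (graph_poly2 {h\<in>H. h \<subseteq> insert x U}) m' \<noteq> 0"
    using m(1) lookup_mult_star[where Q = Q and x = x and z = z and m = m, OF fin z mx]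
    unfolding m'_def by metis
  have look: "Poly_Mapping.lookup m' y = Poly_Mapping.lookup m y + card {h\<in>Q. z h = y}" for y
  proof -
    have "card {h\<in>Q. z h = y} = (\<Sum>h\<in>Q. if z h = y then 1 else 0)"
      using fin by (simp add: sum.If_cases Int_def)
    thus ?thesis
      by (simp only: m'_def lookup_add lookup_sum lookup_single when_def)
  qed
  have zU: "z h \<in> U" if "h \<in> Q" for h
    using z[OF that] that by (metis (lifting) Q_def insertE insertI1 insertI2 mem_Collect_eq subsetD)
  have zin: "z h \<in> h" if "h \<in> Q" for h
    using z[OF that] by blast
  have "Poly_Mapping.lookup m' x = 0"
    using mx zU U(2) fin by (auto simp: look)
  moreover have "Poly_Mapping.lookup m' y + card {h\<in>H. y \<in> h \<and> \<not> h \<subseteq> insert x U} \<le> d"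
    if y: "y \<in> U" for y
  proof -
    have "card {h\<in>Q. z h = y} + card {h\<in>H. y \<in> h \<and> \<not> h \<subseteq> insert x U} =
        card ({h\<in>Q. z h = y} \<union> {h\<in>H. y \<in> h \<and> \<not> h \<subseteq> insert x U})"
      using fin H(1) by (intro card_Un_disjoint[symmetric]) (auto simp: Q_def)
    also have "\<dots> \<le> card {h\<in>H. y \<in> h \<and> \<not> h \<subseteq> U}"
      using H(1) zin U(2) by (intro card_mono) (auto simp: Q_def)
    finally show ?thesis
      using m(3)[rule_format, OF y] by (simp add: look)
  qed
  moreover have "Poly_Mapping.keys m' \<subseteq> insert x U"
  proof
    fix y assume "y \<in> Poly_Mapping.keys m'"
    hence "y \<in> Poly_Mapping.keys m \<or> {h\<in>Q. z h = y} \<noteq> {}"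
      by (cases "{h\<in>Q. z h = y} = {}") (simp_all only: in_keys_iff look card.empty, simp_all)
    thus "y \<in> insert x U"
      using m(2) zU by blast
  qed
  ultimately have "\<forall>y\<in>insert x U. Poly_Mapping.lookup m' y +
      card {h\<in>H. y \<in> h \<and> \<not> h \<subseteq> insert x U} \<le> d" "Poly_Mapping.keys m' \<subseteq> insert x U"
    using x by simp_all
  thus ?thesis
    unfolding orientable_within_def using 1 by blast
qed

lemma orientable_within_singleton:
  assumes "\<And>h. h \<in> H \<Longrightarrow> card h = 2" "card {h\<in>H. x \<in> h} \<le> d" "finite H"
  shows "orientable_within H d {x}"
proof -
  have "{h\<in>H. h \<subseteq> {x}} = {}"
  proof -
    have "\<not> h \<subseteq> {x}" if "h \<in> H" for h
      using card_mono[of "{x}" h] assms(1)[OF that] by auto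
    thus ?thesis by blast
  qed
  moreover have "card {h\<in>H. x \<in> h \<and> \<not> h \<subseteq> {x}} \<le> d"
    by (rule order_trans[OF card_mono assms(2)]) (use assms(3) in auto)
  ultimately show ?thesis
    unfolding orientable_within_def
    by (intro exI[of _ 0]) (simp only: graph_poly2_def, simp)
qed

section \<open>Path polynomials and theta graphs in characteristic two\<close>

fun path_poly :: "'a \<Rightarrow> 'a list \<Rightarrow> 'a \<Rightarrow> ('a \<Rightarrow>\<^sub>0 nat) \<Rightarrow>\<^sub>0 bit" where
  "path_poly a [] b = var2 a + var2 b"
| "path_poly a (c # cs) b = (var2 a + var2 c) * path_poly c cs b"

text \<open>Membership of \<open>p\<close> in the polynomial ring over the variables outside
  \<open>A\<close>, phrased by coefficients.\<close>

definition free_of :: "'a set \<Rightarrow> (('a \<Rightarrow>\<^sub>0 nat) \<Rightarrow>\<^sub>0 bit) \<Rightarrow> bool" where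
  "free_of A p \<longleftrightarrow> (\<forall>m c. c \<in> A \<longrightarrow> Poly_Mapping.lookup m c \<noteq> 0 \<longrightarrow> Poly_Mapping.lookup p m = 0)"

lemma free_of_var_mult: "free_of A p \<Longrightarrow> a \<notin> A \<Longrightarrow> free_of A (var2 a * p)"
  unfolding free_of_def lookup_var2_mult
  by (metis (no_types, lifting) diff_zero lookup_minus lookup_single_not_eq)

lemma free_of_add: "free_of A p \<Longrightarrow> free_of A q \<Longrightarrow> free_of A (p + q)"
  by (simp add: free_of_def lookup_add)

lemma free_of_mult_path:
  "free_of A p \<Longrightarrow> A \<inter> ({a, b} \<union> set cs) = {} \<Longrightarrow> free_of A (p * path_poly a cs b)"
proof (induction cs arbitrary: a p)
  case Nil
  then show ?case
    by (simp add: distrib_left mult.commute[of p] free_of_add free_of_var_mult)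
next
  case (Cons c cs)
  have "free_of A (p * (var2 a + var2 c))"
    using Cons.prems by (simp add: distrib_left mult.commute[of p] free_of_add free_of_var_mult)
  from Cons.IH[OF this, of c] show ?case
    using Cons.prems by (auto simp: mult.assoc)
qed

text \<open>In characteristic two, extracting the first power of an interior vertex of a path contracts
  the path at this vertex.\<close>

lemma lookup_mult_path:
  "free_of (set cs) p \<Longrightarrow> distinct cs \<Longrightarrow> a \<notin> set cs \<Longrightarrow> b \<notin> set cs \<Longrightarrow>
    Poly_Mapping.keys m \<inter> set cs = {} \<Longrightarrow>
    Poly_Mapping.lookup (p * path_poly a cs b) (m + (\<Sum>c\<in>set cs. Poly_Mapping.single c 1)) =
    Poly_Mapping.lookup (p * (var2 a + var2 b)) m"
proof (induction cs arbitrary: a p m)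
  case (Cons c cs)
  let ?c = "Poly_Mapping.single c 1"
  have f: "free_of {c} p" "free_of (set cs) p"
    using Cons.prems by (auto simp: free_of_def)
  have mc: "Poly_Mapping.lookup m c = 0"
    using Cons.prems by (auto simp: in_keys_iff)
  have "(\<Sum>c\<in>set (c # cs). Poly_Mapping.single c 1) = ?c + (\<Sum>c\<in>set cs. Poly_Mapping.single c (1::nat))"
    using Cons.prems by simp
  hence "Poly_Mapping.lookup (p * path_poly a (c # cs) b) (m + (\<Sum>c\<in>set (c # cs). Poly_Mapping.single c 1))
     = Poly_Mapping.lookup ((p * (var2 a + var2 c)) * path_poly c cs b)
         ((m + ?c) + (\<Sum>c\<in>set cs. Poly_Mapping.single c 1))"
    by (simp add: ac_simps)
  also have "\<dots> = Poly_Mapping.lookup (p * (var2 a + var2 c) * (var2 c + var2 b)) (m + ?c)"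
  proof (rule Cons.IH)
    show "free_of (set cs) (p * (var2 a + var2 c))"
      using f(2) Cons.prems
      by (simp add: distrib_left mult.commute[of p] free_of_add free_of_var_mult)
    show "Poly_Mapping.keys (m + ?c) \<inter> set cs = {}"
      using Cons.prems keys_add[of m ?c] by (auto simp: keys_single split: if_splits)
  qed (use Cons.prems in auto)
  \<comment> \<open>As \<open>p\<close> and \<open>m\<close> do not involve \<open>c\<close>,
    exponent 1 in \<open>c\<close> comes only from the products of \<open>c\<close> with
    \<open>a\<close> and with \<open>b\<close>; the other two have degree 2 and 0 in
    \<open>c\<close>. What remains is \<open>var2 a + var2 b\<close>.\<close>
  also have "p * (var2 a + var2 c) * (var2 c + var2 b) =
      var2 c * (var2 a * p) + var2 c * (var2 c * p) + (var2 b * (var2 a * p) + var2 c * (var2 b * p))"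
    by (simp add: algebra_simps)
  also have "Poly_Mapping.lookup \<dots> (m + ?c) = Poly_Mapping.lookup (p * (var2 a + var2 b)) m"
  proof -
    have "free_of {c} (var2 b * (var2 a * p))"
      using f(1) Cons.prems by (intro free_of_var_mult) auto
    hence "Poly_Mapping.lookup (var2 b * (var2 a * p)) (m + ?c) = 0"
      by (auto simp: free_of_def lookup_add)
    moreover have "Poly_Mapping.lookup (var2 c * q) (m + ?c) = Poly_Mapping.lookup q m" for q
      by (simp add: lookup_var2_mult lookup_add)
    moreover have "Poly_Mapping.lookup (var2 c * p) m = 0"
      using mc by (simp add: lookup_var2_mult)
    ultimately show ?thesis
      by (simp add: lookup_add distrib_left mult.commute[of p])
  qed
  finally show ?case .
qed simp

fun path_edges :: "'a list \<Rightarrow> 'a set set" where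
  "path_edges (x # y # xs) = insert {x, y} (path_edges (y # xs))"
| "path_edges _ = {}"

lemma finite_path_edges [simp]: "finite (path_edges xs)"
  by (induction xs rule: path_edges.induct) auto

lemma path_edges_subset: "h \<in> path_edges xs \<Longrightarrow> h \<subseteq> set xs"
  by (induction xs rule: path_edges.induct) auto

lemma graph_poly2_path:
  "distinct (a # cs @ [b]) \<Longrightarrow> graph_poly2 (path_edges (a # cs @ [b])) = path_poly a cs b"
proof (induction cs arbitrary: a)
  case Nil
  then show ?case by (auto simp: graph_poly2_def)
next
  case (Cons c cs)
  have "{a, c} \<notin> path_edges (c # cs @ [b])"
    using Cons.prems path_edges_subset[of "{a, c}" "c # cs @ [b]"] by auto
  moreover have "graph_poly2 (path_edges (c # cs @ [b])) = path_poly c cs b"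
    using Cons by simp
  moreover have "a \<noteq> c"
    using Cons.prems by auto
  ultimately show ?case
    by (simp add: graph_poly2_def)
qed

text \<open>Three of the eight terms of the cube give this monomial, and 3 is odd. For two paths in
  place of three, the mixed term of the square has the even coefficient 2.\<close>

lemma lookup_var_pair_cubed:
  assumes "a \<noteq> b"
  shows "Poly_Mapping.lookup ((var2 a + var2 b) * (var2 a + var2 b) * (var2 a + var2 b))
     (Poly_Mapping.single a 2 + Poly_Mapping.single b 1) = 1"
proof -
  define m :: "'a \<Rightarrow>\<^sub>0 nat" where "m = Poly_Mapping.single a 2 + Poly_Mapping.single b 1"
  have exp: "(var2 a + var2 b) * (var2 a + var2 b) * (var2 a + var2 b) =
     var2 a * (var2 a * (var2 a * 1)) + (var2 a * (var2 a * (var2 b * 1)) +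
     (var2 a * (var2 b * (var2 a * 1)) + (var2 b * (var2 a * (var2 a * 1)) +
     (var2 b * (var2 b * (var2 a * 1)) + (var2 a * (var2 b * (var2 b * 1)) +
     (var2 b * (var2 a * (var2 b * 1)) + var2 b * (var2 b * (var2 b * 1))))))))"
    by (simp add: algebra_simps)
  have m: "Poly_Mapping.lookup m a = 2" "Poly_Mapping.lookup m b = 1"
    using assms by (auto simp: m_def lookup_add lookup_single when_def)
  have 0: "m - Poly_Mapping.single a 1 - Poly_Mapping.single a 1 - Poly_Mapping.single b 1 = 0"
       "m - Poly_Mapping.single a 1 - Poly_Mapping.single b 1 - Poly_Mapping.single a 1 = 0"
       "m - Poly_Mapping.single b 1 - Poly_Mapping.single a 1 - Poly_Mapping.single a 1 = 0"
    using assms by (auto simp: poly_mapping_eq_iff fun_eq_iff m_def lookup_add lookup_minus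
        lookup_single when_def)
  show ?thesis
    unfolding m_def[symmetric] exp lookup_add lookup_var2_mult
    using assms 0 by (simp add: m lookup_minus lookup_single when_def lookup_one)
qed

lemma card_path_edges_at:
  "distinct (a # cs @ [b]) \<Longrightarrow> card {h \<in> path_edges (a # cs @ [b]). y \<in> h} =
     (if y = a \<or> y = b then 1 else if y \<in> set cs then 2 else 0)"
proof (induction cs arbitrary: a)
  case Nil
  have "{h \<in> path_edges (a # [] @ [b]). y \<in> h} = (if y = a \<or> y = b then {{a, b}} else {})"
    by auto
  then show ?case by simp
next
  case (Cons c cs)
  have n: "{a, c} \<notin> path_edges (c # cs @ [b])"
    using Cons.prems path_edges_subset[of "{a, c}" "c # cs @ [b]"] by auto
  have eq: "{h \<in> path_edges (a # (c # cs) @ [b]). y \<in> h} =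
    (if y = a \<or> y = c then insert {a, c} {h \<in> path_edges (c # cs @ [b]). y \<in> h}
     else {h \<in> path_edges (c # cs @ [b]). y \<in> h})"
    by auto
  have "card {h \<in> path_edges (c # cs @ [b]). y \<in> h} =
     (if y = c \<or> y = b then 1 else if y \<in> set cs then 2 else 0)"
    by (rule Cons.IH) (use Cons.prems in simp)
  moreover have "card (insert {a, c} {h \<in> path_edges (c # cs @ [b]). y \<in> h}) =
      Suc (card {h \<in> path_edges (c # cs @ [b]). y \<in> h})"
    using n by (intro card_insert_disjoint) (simp_all del: path_edges.simps)
  ultimately show ?case
    unfolding eq using Cons.prems by (auto simp del: path_edges.simps)
qed

lemma path_edges_meet_interior:
  "h \<in> path_edges (a # p @ [b]) \<Longrightarrow> p \<noteq> [] \<Longrightarrow> h \<inter> set p \<noteq> {}"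
proof (induction p arbitrary: a)
  case (Cons c cs)
  have "h = {a, c} \<or> h \<in> path_edges (c # cs @ [b])"
    using Cons.prems by simp
  moreover have "c \<in> h" if "h \<in> path_edges (c # cs @ [b])" "cs = []"
    using that by simp
  moreover have "h \<inter> set cs \<noteq> {}" if "h \<in> path_edges (c # cs @ [b])" "cs \<noteq> []"
    using that by (rule Cons.IH)
  ultimately have "c \<in> h \<or> h \<inter> set cs \<noteq> {}"
    by blast
  thus ?case by auto
qed simp

text \<open>Two paths without interior vertices would both consist of the pair
  \<open>{a, b}\<close>. Otherwise a common pair contains an interior vertex of one path, which the
  other path avoids.\<close>

lemma path_edges_disjoint:
  assumes "distinct (a # b # p @ q)" "p \<noteq> [] \<or> q \<noteq> []"
  shows "path_edges (a # p @ [b]) \<inter> path_edges (a # q @ [b]) = {}"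
proof -
  have "False" if h: "h \<in> path_edges (a # p @ [b])" "h \<in> path_edges (a # q @ [b])" for h
  proof -
    have "h \<subseteq> {a, b} \<union> set p" "h \<subseteq> {a, b} \<union> set q"
      using path_edges_subset[OF h(1)] path_edges_subset[OF h(2)] by auto
    moreover have "h \<inter> set p \<noteq> {} \<or> h \<inter> set q \<noteq> {}"
      using assms(2) path_edges_meet_interior[OF h(1)] path_edges_meet_interior[OF h(2)] by argo
    ultimately show False
      using assms(1) by auto
  qed
  thus ?thesis by blast
qed

text \<open>The exponents are 2 at \<open>a\<close> and 1 on the rest of \<open>K\<close>, while the
  degrees inside \<open>K\<close> are 3 at \<open>a\<close> and \<open>b\<close> and 2 elsewhere.
  Every exponent is smaller than the inner degree, which saves one unit of the total degree
  \<open>Suc d\<close>.\<close>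

lemma orientable_within_theta:
  assumes H: "finite H"
    and dist: "distinct (a # b # p @ q @ r)"
    and ne: "p \<noteq> [] \<or> q \<noteq> []" "p \<noteq> [] \<or> r \<noteq> []" "q \<noteq> [] \<or> r \<noteq> []"
    and K: "K = {a, b} \<union> set p \<union> set q \<union> set r"
    and HK: "{h\<in>H. h \<subseteq> K} =
      path_edges (a # p @ [b]) \<union> path_edges (a # q @ [b]) \<union> path_edges (a # r @ [b])"
    and deg: "\<And>y. y \<in> K \<Longrightarrow> card {h\<in>H. y \<in> h} \<le> Suc d"
  shows "orientable_within H d K"
proof -
  let ?E = "\<lambda>p. path_edges (a # p @ [b])" and ?S = "\<lambda>p. \<Sum>c\<in>set p. Poly_Mapping.single c (1::nat)"
  define m0 where "m0 = Poly_Mapping.single a 2 + Poly_Mapping.single b (1::nat)"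
  define m where "m = ((m0 + ?S p) + ?S q) + ?S r"
  let ?v = "var2 a + var2 b"
  have look: "Poly_Mapping.lookup m y =
      (if y = a then 2 else if y \<in> K then 1 else 0)" for y
    using dist by (auto simp: m_def m0_def lookup_add lookup_sum lookup_single when_def K)
  have dj: "?E p \<inter> ?E q = {}" "?E p \<inter> ?E r = {}" "?E q \<inter> ?E r = {}"
    using path_edges_disjoint[of a b p q] path_edges_disjoint[of a b p r]
      path_edges_disjoint[of a b q r] dist ne by auto
  have ds: "distinct (a # p @ [b])" "distinct (a # q @ [b])" "distinct (a # r @ [b])"
    using dist by auto
  have poly: "graph_poly2 {h\<in>H. h \<subseteq> K} = path_poly a p b * path_poly a q b * path_poly a r b"
    unfolding HK using dj ds
    by (simp add: graph_poly2_path[symmetric] graph_poly2_def prod.union_disjoint Int_Un_distrib2)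
  have free1: "free_of A 1" for A :: "'a set"
    by (auto simp: free_of_def lookup_one when_def)
  have key0: "Poly_Mapping.keys m0 \<subseteq> {a, b}"
    unfolding m0_def using keys_add[of "Poly_Mapping.single a 2" "Poly_Mapping.single b (1::nat)"]
    by auto
  have keyS: "Poly_Mapping.keys (?S p) \<subseteq> set p" for p :: "'a list"
    by (auto simp: in_keys_iff lookup_sum lookup_single when_def split: if_splits)
  have kp: "Poly_Mapping.keys (m0 + ?S p) \<subseteq> {a, b} \<union> set p"
    using keys_add[of m0 "?S p"] key0 keyS[of p] by blast
  have kpq: "Poly_Mapping.keys (m0 + ?S p + ?S q) \<subseteq> {a, b} \<union> set p \<union> set q"
    using keys_add[of "m0 + ?S p" "?S q"] kp keyS[of q] by blast
  have sep: "set r \<inter> ({a, b} \<union> set p \<union> set q) = {}" "set q \<inter> ({a, b} \<union> set p) = {}"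
      "set p \<inter> {a, b} = {}" "distinct p" "distinct q" "distinct r"
    using dist by auto
  have k1: "Poly_Mapping.keys (m0 + ?S p + ?S q) \<inter> set r = {}"
    using kpq sep by blast
  have k2: "Poly_Mapping.keys (m0 + ?S p) \<inter> set q = {}"
    using kp sep by blast
  have k3: "Poly_Mapping.keys m0 \<inter> set p = {}"
    using key0 sep by blast
  have fE: "free_of A (path_poly a p b)" if "A \<inter> ({a, b} \<union> set p) = {}" for A p
    using free_of_mult_path[OF free1 that] by simp
  have fv: "free_of A ?v" if "A \<inter> {a, b} = {}" for A
    using fE[of A "[]"] that by simp
  have ns: "a \<notin> set p" "a \<notin> set q" "a \<notin> set r" "b \<notin> set p" "b \<notin> set q" "b \<notin> set r"
    using sep by auto
  have i1: "set r \<inter> ({a, b} \<union> set q) = {}" "set r \<inter> ({a, b} \<union> set p) = {}"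
      "set q \<inter> ({a, b} \<union> set []) = {}"
    using sep by auto
  have "Poly_Mapping.lookup (path_poly a p b * path_poly a q b * path_poly a r b) m =
      Poly_Mapping.lookup (path_poly a p b * path_poly a q b * ?v) ((m0 + ?S p) + ?S q)"
    unfolding m_def
    using free_of_mult_path[OF fE[OF i1(2)] i1(1)] sep(6) ns(3,6) k1 by (rule lookup_mult_path)
  \<comment> \<open>A contracted path is kept as \<open>path_poly a [] b\<close>, so that
    \<open>free_of_mult_path\<close> covers it; the path to be contracted next is moved to the
    end.\<close>
  also have "path_poly a p b * path_poly a q b * ?v = (path_poly a p b * path_poly a [] b) * path_poly a q b"
    by (simp add: ac_simps)
  also have "Poly_Mapping.lookup \<dots> ((m0 + ?S p) + ?S q) =
     Poly_Mapping.lookup ((path_poly a p b * path_poly a [] b) * ?v) (m0 + ?S p)"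
    using free_of_mult_path[OF fE[OF sep(2)] i1(3)] sep(5) ns(2,5) k2 by (rule lookup_mult_path)
  also have "(path_poly a p b * path_poly a [] b) * ?v = (?v * path_poly a [] b) * path_poly a p b"
    by (simp add: ac_simps)
  also have "Poly_Mapping.lookup \<dots> (m0 + ?S p) =
     Poly_Mapping.lookup ((?v * path_poly a [] b) * ?v) m0"
    using free_of_mult_path[OF fv[OF sep(3)], of a b "[]"] sep(3,4) ns(1,4) k3
    by (intro lookup_mult_path) auto
  also have "\<dots> = 1"
    using lookup_var_pair_cubed[of a b] dist by (simp add: m0_def)
  finally have 1: "Poly_Mapping.lookup (graph_poly2 {h\<in>H. h \<subseteq> K}) m \<noteq> 0"
    by (simp add: poly)
  have "Poly_Mapping.lookup m y + card {h\<in>H. y \<in> h \<and> \<not> h \<subseteq> K} \<le> d" if y: "y \<in> K" for y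
  proof -
    have "{h\<in>H. h \<subseteq> K \<and> y \<in> h} = {h\<in>?E p. y \<in> h} \<union> {h\<in>?E q. y \<in> h} \<union> {h\<in>?E r. y \<in> h}"
      using HK by auto
    also have "card \<dots> = card {h\<in>?E p. y \<in> h} + card {h\<in>?E q. y \<in> h} + card {h\<in>?E r. y \<in> h}"
      using dj by (subst card_Un_disjoint; (subst card_Un_disjoint)?) auto
    also have "\<dots> \<ge> Suc (Poly_Mapping.lookup m y)"
      using y dist ds by (auto simp: card_path_edges_at look K)
    finally have "Suc (Poly_Mapping.lookup m y) + card {h\<in>H. y \<in> h \<and> \<not> h \<subseteq> K} \<le>
       card {h\<in>H. h \<subseteq> K \<and> y \<in> h} + card {h\<in>H. y \<in> h \<and> \<not> h \<subseteq> K}"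
      by simp
    also have "\<dots> = card ({h\<in>H. h \<subseteq> K \<and> y \<in> h} \<union> {h\<in>H. y \<in> h \<and> \<not> h \<subseteq> K})"
      using H by (intro card_Un_disjoint[symmetric]) auto
    also have "{h\<in>H. h \<subseteq> K \<and> y \<in> h} \<union> {h\<in>H. y \<in> h \<and> \<not> h \<subseteq> K} = {h\<in>H. y \<in> h}"
      by auto
    finally show ?thesis
      using deg[OF y] by simp
  qed
  moreover have "Poly_Mapping.keys m \<subseteq> K"
    by (auto simp: in_keys_iff look K split: if_splits)
  ultimately show ?thesis
    unfolding orientable_within_def using 1 by blast
qed

section \<open>Chordless cycles and theta graphs\<close>

lemma path_edges_Cons:
  "path_edges (x # xs) = (if xs = [] then {} else insert {x, hd xs} (path_edges xs))"
  by (cases xs) auto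

lemma path_edges_append:
  "path_edges (xs @ z # ys) = path_edges (xs @ [z]) \<union> path_edges (z # ys)"
proof (induction xs)
  case (Cons x xs)
  have "hd (xs @ z # ys) = hd (xs @ [z])"
    by (cases xs) auto
  thus ?case
    using Cons by (simp add: path_edges_Cons[of x])
qed simp

lemma path_edges_snoc: "xs \<noteq> [] \<Longrightarrow> path_edges (xs @ [z]) = insert {last xs, z} (path_edges xs)"
proof (induction xs)
  case (Cons x xs)
  then show ?case
    by (cases xs) (auto simp: path_edges_Cons[of x])
qed simp

lemma path_edges_rev: "path_edges (rev xs) = path_edges xs"
proof (induction xs)
  case (Cons x xs)
  then show ?case
    by (cases "xs = []") (auto simp: path_edges_snoc path_edges_Cons[of x] last_rev insert_commute)
qed simp

lemma path_edges_drop_prefix: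
  "{u, v} \<in> path_edges (xs @ q) \<Longrightarrow> {u, v} \<inter> set xs = {} \<Longrightarrow> {u, v} \<in> path_edges q"
proof (induction xs)
  case (Cons x xs)
  have "{u, v} \<noteq> {x, y}" for y
    using Cons.prems(2) by (auto simp: doubleton_eq_iff)
  hence "{u, v} \<in> path_edges (xs @ q)"
    using Cons.prems(1) by (auto simp: path_edges_Cons[of x] split: if_splits)
  thus ?case
    using Cons by simp
qed simp

text \<open>Together with \<open>path_edges_mono_infix\<close> it shows that a sublist of an induced
  path is induced. The suffix is removed by reversing the list.\<close>

lemma path_edges_infix:
  assumes "{u, v} \<in> path_edges (xs @ q @ ys)" "{u, v} \<inter> (set xs \<union> set ys) = {}"
  shows "{u, v} \<in> path_edges q"
proof -
  have "{u, v} \<in> path_edges (q @ ys)"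
    using path_edges_drop_prefix[OF assms(1)] assms(2) by auto
  hence "{u, v} \<in> path_edges (rev ys @ rev q)"
    by (metis path_edges_rev rev_append)
  hence "{u, v} \<in> path_edges (rev q)"
    using path_edges_drop_prefix assms(2) by (metis Int_Un_distrib set_rev Un_empty)
  thus ?thesis
    by (simp add: path_edges_rev)
qed

lemma path_edges_mono_infix: "path_edges q \<subseteq> path_edges (xs @ q @ ys)"
proof -
  have suffix: "path_edges q \<subseteq> path_edges (xs @ q)" for xs q :: "'a list"
    by (induction xs) (auto simp: path_edges_Cons)
  have "path_edges q = path_edges (rev q)"
    by (simp add: path_edges_rev)
  also have "\<dots> \<subseteq> path_edges (rev ys @ rev q)"
    by (rule suffix)
  also have "\<dots> = path_edges (q @ ys)"
    by (metis path_edges_rev rev_append)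
  finally show ?thesis
    using suffix by blast
qed

definition cycle_edges :: "'a list \<Rightarrow> 'a set set" where
  "cycle_edges c = path_edges (c @ [hd c])"

lemma cycle_edges_rotate: "cycle_edges (xs @ ys) = cycle_edges (ys @ xs)"
proof (cases "xs = [] \<or> ys = []")
  case False
  then obtain x xs' y ys' where "xs = x # xs'" "ys = y # ys'"
    by (auto simp: neq_Nil_conv)
  hence "cycle_edges (xs @ ys) = path_edges (xs @ [y]) \<union> path_edges (ys @ [x])"
      "cycle_edges (ys @ xs) = path_edges (ys @ [x]) \<union> path_edges (xs @ [y])"
    using path_edges_append[of xs y "ys' @ [x]"] path_edges_append[of ys x "xs' @ [y]"]
    by (simp_all add: cycle_edges_def)
  thus ?thesis by blast
qed auto

lemma cycle_edges_Cons: "r \<noteq> [] \<Longrightarrow> cycle_edges (u # r) = {{u, hd r}, {last r, u}} \<union> path_edges r"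
  by (auto simp: cycle_edges_def path_edges_Cons[of u] path_edges_snoc)

lemma cycle_edges_reverse_tail: "cycle_edges (u # rev r) = cycle_edges (u # r)"
proof (cases "r = []")
  case False
  then show ?thesis
    by (auto simp: cycle_edges_Cons path_edges_rev hd_rev last_rev insert_commute)
qed simp

lemma rotate_to_front:
  assumes "u \<in> set c"
  shows "\<exists>r. set (u # r) = set c \<and> (distinct c \<longrightarrow> distinct (u # r)) \<and> length (u # r) = length c \<and>
     cycle_edges (u # r) = cycle_edges c"
proof -
  obtain xs ys where c: "c = xs @ u # ys"
    using assms by (meson split_list)
  have "cycle_edges ((u # ys) @ xs) = cycle_edges c"
    unfolding c by (rule cycle_edges_rotate)
  thus ?thesis
    by (intro exI[of _ "ys @ xs"]) (auto simp: c)
qed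

lemma path_edges_nth: "path_edges xs = {{xs ! i, xs ! Suc i} | i. Suc i < length xs}"
proof (induction xs)
  case (Cons x xs)
  show ?case
  proof (cases "xs = []")
    case False
    have "{{(x # xs) ! i, (x # xs) ! Suc i} | i. Suc i < length (x # xs)} =
        insert {x, xs ! 0} {{xs ! i, xs ! Suc i} | i. Suc i < length xs}" (is "?L = ?R")
    proof
      show "?L \<subseteq> ?R"
      proof
        fix h assume "h \<in> ?L"
        then obtain i where "h = {(x # xs) ! i, (x # xs) ! Suc i}" "Suc i < length (x # xs)"
          by blast
        thus "h \<in> ?R"
          by (cases i) auto
      qed
      show "?R \<subseteq> ?L"
      proof
        fix h assume "h \<in> ?R"
        then consider "h = {x, xs ! 0}" | i where "h = {xs ! i, xs ! Suc i}" "Suc i < length xs"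
          by blast
        thus "h \<in> ?L"
        proof cases
          case 1
          then show ?thesis
            using False by (intro CollectI exI[of _ 0]) auto
        next
          case (2 i)
          then show ?thesis
            by (intro CollectI exI[of _ "Suc i"]) auto
        qed
      qed
    qed
    thus ?thesis
      using Cons False by (simp add: path_edges_Cons hd_conv_nth)
  qed simp
qed simp

lemma cycle_edges_nth:
  assumes "c \<noteq> []"
  shows "cycle_edges c = {{c ! i, c ! (Suc i mod length c)} | i. i < length c}"
proof -
  have "(c @ [hd c]) ! i = c ! i" "(c @ [hd c]) ! Suc i = c ! (Suc i mod length c)" if "i < length c" for i
  proof -
    show "(c @ [hd c]) ! i = c ! i"
      using that by (simp add: nth_append)
    show "(c @ [hd c]) ! Suc i = c ! (Suc i mod length c)"
    proof (cases "Suc i = length c")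
      case True
      then show ?thesis
        using assms by (simp add: nth_append hd_conv_nth)
    next
      case False
      then show ?thesis
        using that by (simp add: nth_append)
    qed
  qed
  note nth = this
  have "h = {(c @ [hd c]) ! i, (c @ [hd c]) ! Suc i} \<and> Suc i < length (c @ [hd c]) \<longleftrightarrow>
      h = {c ! i, c ! (Suc i mod length c)} \<and> i < length c" for h i
    using nth[of i] by (cases "i < length c") simp_all
  thus ?thesis
    unfolding cycle_edges_def path_edges_nth by (simp only:)
qed

lemma path_edges_map: "path_edges (map f xs) = (`) f ` path_edges xs"
proof (induction xs)
  case (Cons x xs)
  then show ?case
    by (auto simp: path_edges_Cons hd_map)
qed simp

section \<open>Chordless cycles and their ears\<close>

definition path_in :: "('a \<Rightarrow> 'a \<Rightarrow> bool) \<Rightarrow> 'a list \<Rightarrow> bool" where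
  "path_in adj xs \<longleftrightarrow> distinct xs \<and> (\<forall>u v. {u, v} \<in> path_edges xs \<longrightarrow> adj u v)"

text \<open>All neighbours of the first vertex of a longest path lie on the path. One of them comes
  after the second vertex and closes a cycle of length at least 3.\<close>

lemma exists_cycle:
  assumes X: "finite X" "X \<noteq> {}"
    and sym: "\<And>x y. adj x y \<Longrightarrow> adj y x" and irr: "\<And>x. \<not> adj x x"
    and deg: "\<And>x. x \<in> X \<Longrightarrow> 2 \<le> card {y\<in>X. adj x y}"
  shows "\<exists>c. distinct c \<and> set c \<subseteq> X \<and> 3 \<le> length c \<and> (\<forall>u v. {u, v} \<in> cycle_edges c \<longrightarrow> adj u v)"
proof -
  define P where "P xs \<longleftrightarrow> xs \<noteq> [] \<and> set xs \<subseteq> X \<and> path_in adj xs" for xs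
  obtain x0 where "x0 \<in> X"
    using X by blast
  hence "P [x0]"
    by (simp add: P_def path_in_def)
  moreover have "\<forall>xs. P xs \<longrightarrow> length xs < Suc (card X)"
    using X(1) card_mono[of X] unfolding P_def path_in_def
    by (metis distinct_card le_imp_less_Suc)
  ultimately obtain xs where xs: "P xs" and max: "\<And>ys. P ys \<Longrightarrow> length ys \<le> length xs"
    using ex_has_greatest_nat[of P "[x0]" length "Suc (card X)"] by auto
  obtain x r where r: "xs = x # r"
    using xs by (cases xs) (auto simp: P_def)
  have x: "x \<in> X" "set r \<subseteq> X" "distinct (x # r)"
    using xs by (auto simp: P_def path_in_def r)
  have edges: "adj u v" if "{u, v} \<in> path_edges (x # r)" for u v
    using xs that unfolding P_def path_in_def r by blast
  have nb: "y \<in> set r" if y: "y \<in> X" "adj x y" for y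
  proof (rule ccontr)
    assume "y \<notin> set r"
    moreover have "y \<noteq> x"
      using y irr by blast
    ultimately have "distinct (y # x # r)"
      using x by auto
    moreover have "adj u v" if "{u, v} \<in> path_edges (y # x # r)" for u v
    proof -
      consider "{u, v} = {y, x}" | "{u, v} \<in> path_edges (x # r)"
        using \<open>{u, v} \<in> path_edges (y # x # r)\<close> by auto
      thus ?thesis
        using edges y sym by cases (auto simp: doubleton_eq_iff)
    qed
    ultimately have "P (y # x # r)"
      using x y by (simp add: P_def path_in_def)
    thus False
      using max r by fastforce
  qed
  \<comment> \<open>Comparing cardinalities covers the case \<open>r = []\<close> as well, in which
    \<open>hd r\<close> is arbitrary.\<close>
  have "\<not> {y\<in>X. adj x y} \<subseteq> {hd r}"
    using deg[OF x(1)] card_mono[of "{hd r}" "{y\<in>X. adj x y}"] by auto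
  then obtain y where y: "y \<in> X" "adj x y" "y \<noteq> hd r"
    by blast
  obtain r1 r2 where r12: "r = r1 @ y # r2"
    using nb[OF y(1,2)] by (meson split_list)
  have "r1 \<noteq> []"
    using y(3) r12 by auto
  define c where "c = x # r1 @ [y]"
  have "adj u v" if uv: "{u, v} \<in> cycle_edges c" for u v
  proof -
    have ce: "cycle_edges c = insert {y, x} (path_edges c)"
      unfolding cycle_edges_def c_def by (subst path_edges_snoc) auto
    from uv have "{u, v} = {y, x} \<or> {u, v} \<in> path_edges c"
      by (simp only: ce insert_iff)
    thus ?thesis
    proof (elim disjE)
      assume "{u, v} = {y, x}"
      then show ?thesis using y(2) sym by (auto simp: doubleton_eq_iff)
    next
      assume "{u, v} \<in> path_edges c"
      then have "{u, v} \<in> path_edges (x # r)"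
        using path_edges_mono_infix[of c "[]" r2] by (auto simp: c_def r12)
      then show ?thesis by (rule edges)
    qed
  qed
  moreover have "distinct c" "set c \<subseteq> X" "3 \<le> length c"
    using x \<open>r1 \<noteq> []\<close> by (auto simp: c_def r12 Suc_le_eq)
  ultimately show ?thesis by blast
qed

lemma cycle_neighbours:
  assumes c: "distinct c" "3 \<le> length c" "u \<in> set c"
  shows "\<exists>x y. x \<in> set c \<and> y \<in> set c \<and> x \<noteq> y \<and> (\<forall>v. {u, v} \<in> cycle_edges c \<longleftrightarrow> v = x \<or> v = y)"
proof -
  obtain r where r: "set (u # r) = set c" "distinct (u # r)" "length (u # r) = length c"
      "cycle_edges (u # r) = cycle_edges c"
    using rotate_to_front[OF c(3)] c(1) by blast
  have ne: "r \<noteq> []"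
    using r(3) c(2) by auto
  have "hd r \<noteq> last r"
  proof
    assume "hd r = last r"
    hence "r ! 0 = r ! (length r - 1)"
      using ne by (simp add: hd_conv_nth last_conv_nth)
    moreover have "0 < length r" "length r - 1 < length r"
      using ne by auto
    ultimately have "0 = length r - 1"
      using r(2) nth_eq_iff_index_eq[of r 0 "length r - 1"] by simp
    thus False
      using r(3) c(2) by simp
  qed
  moreover have "{u, v} \<in> cycle_edges c \<longleftrightarrow> v = hd r \<or> v = last r" for v
  proof -
    have "{u, v} \<notin> path_edges r"
      using path_edges_subset[of "{u, v}" r] r(2) by auto
    thus ?thesis
      unfolding r(4)[symmetric] cycle_edges_Cons[OF ne] by (auto simp: doubleton_eq_iff)
  qed
  moreover have "hd r \<in> set c" "last r \<in> set c"
    unfolding r(1)[symmetric] using ne by simp_all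
  ultimately show ?thesis by blast
qed

text \<open>The cycle already uses both neighbours of each of its vertices, so neither a chord nor
  an adjacency to the rest of \<open>X\<close> is left.\<close>

lemma two_regular_cycle:
  assumes X: "finite X" "X \<noteq> {}"
    and sym: "\<And>x y. adj x y \<Longrightarrow> adj y x" and irr: "\<And>x. \<not> adj x x"
    and deg: "\<And>x. x \<in> X \<Longrightarrow> card {y\<in>X. adj x y} = 2"
  shows "\<exists>c. distinct c \<and> set c \<subseteq> X \<and> 3 \<le> length c \<and>
    (\<forall>u\<in>set c. \<forall>v\<in>X. adj u v \<longleftrightarrow> {u, v} \<in> cycle_edges c)"
proof -
  obtain c where c: "distinct c" "set c \<subseteq> X" "3 \<le> length c"
      "\<And>u v. {u, v} \<in> cycle_edges c \<Longrightarrow> adj u v"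
    using exists_cycle[where adj = adj, OF X sym irr] deg by (metis order_refl)
  have "adj u v \<longleftrightarrow> {u, v} \<in> cycle_edges c" if u: "u \<in> set c" and v: "v \<in> X" for u v
  proof -
    obtain x y where xy: "x \<in> set c" "y \<in> set c" "x \<noteq> y"
        "\<And>v. {u, v} \<in> cycle_edges c \<longleftrightarrow> v = x \<or> v = y"
      using cycle_neighbours[OF c(1,3) u] by blast
    have "{x, y} \<subseteq> {y\<in>X. adj u y}"
      using xy c(2,4) by blast
    hence "{x, y} = {y\<in>X. adj u y}"
      using deg[of u] u c(2) xy(3) X(1) by (intro card_seteq) auto
    thus ?thesis
      using v xy(4) by blast
  qed
  thus ?thesis
    using c by blast
qed

lemma path_edges_ends:
  "q \<noteq> [] \<Longrightarrow> path_edges (a # q @ [b]) = {{a, hd q}, {last q, b}} \<union> path_edges q"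
  by (auto simp: path_edges_Cons[of a] path_edges_snoc)

text \<open>A shortest path off a chordless cycle between neighbours of distinct vertices of the cycle
  closes it to an induced theta graph.\<close>

lemma shortest_ear:
  assumes q: "q \<noteq> []" and nb: "\<forall>x\<in>set q. card {y\<in>C. adj x y} \<le> 2" "finite C"
    and ab: "a \<in> C" "b \<in> C" "a \<noteq> b" "adj (hd q) a" "adj (last q) b"
  shows "\<exists>q1 p q2 a b. q = q1 @ p @ q2 \<and> p \<noteq> [] \<and> a \<in> C \<and> b \<in> C \<and> a \<noteq> b \<and>
    (\<forall>x\<in>set p. \<forall>e\<in>C. adj x e \<longleftrightarrow> (x = hd p \<and> e = a) \<or> (x = last p \<and> e = b))"
proof -
  define good where "good p a b \<longleftrightarrow> (\<exists>q1 q2. q = q1 @ p @ q2) \<and> p \<noteq> [] \<and> a \<in> C \<and> b \<in> C \<and> a \<noteq> b \<and>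
     adj (hd p) a \<and> adj (last p) b" for p a b
  have "good q a b"
    unfolding good_def using q ab by (metis append_Nil append_Nil2)
  hence "\<exists>p. \<exists>a b. good p a b"
    by blast
  then obtain p where ex: "\<exists>a b. good p a b"
      and min: "\<And>p'. (\<exists>a b. good p' a b) \<Longrightarrow> length p \<le> length p'"
    using ex_has_least_nat[of "\<lambda>p. \<exists>a b. good p a b" _ length] by blast
  obtain a b where g: "good p a b"
    using ex by blast
  obtain q1 q2 where q12: "q = q1 @ p @ q2"
    using g by (auto simp: good_def)
  have p: "p \<noteq> []" "a \<in> C" "b \<in> C" "a \<noteq> b" "adj (hd p) a" "adj (last p) b"
    using g by (auto simp: good_def)
  have sub: "length p \<le> length m" if "p = m1 @ m @ m2" "m \<noteq> []" "e \<in> C" "e' \<in> C" "e \<noteq> e'"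
      "adj (hd m) e" "adj (last m) e'" for m1 m m2 e e'
  proof -
    have "q = (q1 @ m1) @ m @ (m2 @ q2)"
      using q12 that(1) by simp
    hence "good m e e'"
      unfolding good_def using that by blast
    thus ?thesis
      using min by blast
  qed
  have split: "(x = hd p \<and> e = a) \<or> (x = last p \<and> e = b)"
    if x: "x \<in> set p" and e: "e \<in> C" "adj x e" for x e
  \<comment> \<open>A single vertex is both first and last, and \<open>a\<close> and
    \<open>b\<close> exhaust the at most two neighbours that it has in \<open>C\<close>.\<close>
  proof (cases "length p = 1")
    case True
    then have p1: "p = [x]"
      using x by (cases p) auto
    have "{a, b} \<subseteq> {y\<in>C. adj x y}"
      using p p1 by simp
    moreover have "x \<in> set q"
      unfolding q12 using x by simp
    ultimately have "{a, b} = {y\<in>C. adj x y}"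
      using bspec[OF nb(1) \<open>x \<in> set q\<close>] p(4) nb(2) by (intro card_seteq) (simp_all add: numeral_2_eq_2)
    then show ?thesis
      using e p1 by auto
  next
    case False
    obtain m1 m2 where m: "p = m1 @ x # m2"
      using x by (meson split_list)
    \<comment> \<open>If \<open>e\<close> differs from \<open>a\<close>, the part of
      \<open>p\<close> up to \<open>x\<close> already joins \<open>a\<close> to \<open>e\<close>; by
      minimality it is all of \<open>p\<close>, so \<open>x\<close> is last. The other end is
      symmetric.\<close>
    have "m2 = []" if "e \<noteq> a"
    proof (rule ccontr)
      assume ne: "m2 \<noteq> []"
      have "hd (m1 @ [x]) = hd p"
        unfolding m by (cases m1) auto
      hence "length p \<le> length (m1 @ [x])"
        using p(2,5) e that by (intro sub[of "[]" _ m2 a e]) (auto simp: m)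
      thus False
        using ne m by simp
    qed
    moreover have "m1 = []" if "e \<noteq> b"
    proof (rule ccontr)
      assume ne: "m1 \<noteq> []"
      have "last (x # m2) = last p"
        unfolding m by auto
      hence "length p \<le> length (x # m2)"
        using p(3,6) e that by (intro sub[of m1 _ "[]" e b]) (auto simp: m)
      thus False
        using ne m by simp
    qed
    moreover have "\<not> (m1 = [] \<and> m2 = [])"
      using False m by auto
    ultimately have "(e = a \<and> m1 = []) \<or> (e = b \<and> m2 = [])"
      using p(4) by blast
    then show ?thesis
      using m by auto
  qed
  have "\<forall>x\<in>set p. \<forall>e\<in>C. adj x e \<longleftrightarrow> (x = hd p \<and> e = a) \<or> (x = last p \<and> e = b)"
    using split p by blast
  thus ?thesis
    using q12 p by blast
qed

text \<open>The vertices \<open>a\<close> and \<open>b\<close> cut the cycle into two arcs, the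
  second one reversed so that it also runs from \<open>a\<close> to \<open>b\<close>. The third path
  is the ear of \<open>shortest_ear\<close>, a sublist of \<open>q\<close>. As the cycle has no
  chords and the ear is adjacent to it only at its two ends, the theta graph is induced.\<close>

lemma induced_theta:
  assumes sym: "\<And>x y. adj x y \<Longrightarrow> adj y x"
    and c: "distinct c" "3 \<le> length c"
      "\<And>u v. u \<in> set c \<Longrightarrow> v \<in> set c \<Longrightarrow> adj u v \<longleftrightarrow> {u, v} \<in> cycle_edges c"
    and q: "distinct q" "q \<noteq> []" "set q \<inter> set c = {}"
      "\<And>u v. u \<in> set q \<Longrightarrow> v \<in> set q \<Longrightarrow> adj u v \<longleftrightarrow> {u, v} \<in> path_edges q"
    and nb: "\<forall>x\<in>set q. card {y\<in>set c. adj x y} \<le> 2"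
    and ab: "a \<in> set c" "b \<in> set c" "a \<noteq> b" "adj (hd q) a" "adj (last q) b"
  shows "\<exists>a b p1 p2 p3 K. distinct (a # b # p1 @ p2 @ p3) \<and> (p1 \<noteq> [] \<or> p2 \<noteq> []) \<and> p3 \<noteq> [] \<and>
    K = {a, b} \<union> set p1 \<union> set p2 \<union> set p3 \<and> K \<subseteq> set c \<union> set q \<and>
    (\<forall>u\<in>K. \<forall>v\<in>K. adj u v \<longleftrightarrow>
      {u, v} \<in> path_edges (a # p1 @ [b]) \<union> path_edges (a # p2 @ [b]) \<union> path_edges (a # p3 @ [b]))"
proof -
  obtain q1 p q2 a b where p: "q = q1 @ p @ q2" "p \<noteq> []" "a \<in> set c" "b \<in> set c" "a \<noteq> b"
      "\<forall>x\<in>set p. \<forall>e\<in>set c. adj x e \<longleftrightarrow> (x = hd p \<and> e = a) \<or> (x = last p \<and> e = b)"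
    using shortest_ear[OF q(2) nb finite_set ab] by (elim exE conjE)
  obtain r where r: "set (a # r) = set c" "distinct (a # r)" "length (a # r) = length c"
      "cycle_edges (a # r) = cycle_edges c"
    using rotate_to_front[OF p(3)] c(1) by (elim exE conjE) simp
  have "b \<in> set r"
    using p(4,5) r(1) by (metis set_ConsD)
  then obtain p1 p2 where r12: "r = p1 @ b # p2"
    by (meson split_list)
  have "cycle_edges (a # r) = path_edges ((a # p1) @ b # (p2 @ [a]))"
    by (simp add: cycle_edges_def r12)
  also have "\<dots> = path_edges (a # p1 @ [b]) \<union> path_edges (b # p2 @ [a])"
    by (subst path_edges_append) simp
  also have "path_edges (b # p2 @ [a]) = path_edges (a # rev p2 @ [b])"
    using path_edges_rev[of "b # p2 @ [a]"] by simp
  finally have cyc: "cycle_edges c = path_edges (a # p1 @ [b]) \<union> path_edges (a # rev p2 @ [b])"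
    unfolding r(4) .
  have setc: "set c = {a, b} \<union> set p1 \<union> set (rev p2)"
    unfolding r(1)[symmetric] r12 by auto
  have pq: "set p \<subseteq> set q"
    unfolding p(1) by auto
  have pc: "set p \<inter> set c = {}"
    using pq q(3) by blast
  have "distinct p"
    using q(1) p(1) by simp
  hence dist: "distinct (a # b # p1 @ rev p2 @ p)"
    using r(2) pc unfolding r12 setc by auto
  define K where "K = {a, b} \<union> set p1 \<union> set (rev p2) \<union> set p"
  have K: "K = set c \<union> set p"
    by (simp add: K_def setc)
  have in_p: "{u, v} \<in> path_edges p \<longleftrightarrow> adj u v" if "u \<in> set p" "v \<in> set p" for u v
  proof -
    have "set q1 \<inter> set p = {}" "set q2 \<inter> set p = {}"
      using q(1) unfolding p(1) by auto
    hence "{u, v} \<inter> (set q1 \<union> set q2) = {}"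
      using that by blast
    hence "{u, v} \<in> path_edges q \<longleftrightarrow> {u, v} \<in> path_edges p"
      using path_edges_infix[of u v q1 p q2] path_edges_mono_infix[of p q1 q2] unfolding p(1) by blast
    thus ?thesis
      using q(4) that pq by blast
  qed
  have ear: "path_edges (a # p @ [b]) = {{a, hd p}, {last p, b}} \<union> path_edges p"
    using p(2) by (rule path_edges_ends)
  have hl: "hd p \<in> set p" "last p \<in> set p"
    using p(2) by simp_all
  have mixed: "adj z e \<longleftrightarrow> {z, e} \<in> cycle_edges c \<union> path_edges (a # p @ [b])"
    if z: "z \<in> set p" and e: "e \<in> set c" for z e
  proof -
    have n1: "{z, e} \<notin> cycle_edges c"
    proof
      assume "{z, e} \<in> cycle_edges c"
      hence "{z, e} \<subseteq> set (c @ [hd c])"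
        unfolding cycle_edges_def by (rule path_edges_subset)
      thus False
        using z pc c(2) by (cases c) auto
    qed
    have n2: "{z, e} \<notin> path_edges p"
      using path_edges_subset[of "{z, e}" p] e pc by blast
    have n3: "{z, e} = {a, hd p} \<longleftrightarrow> z = hd p \<and> e = a"
      using z e p(3) pc hl by (auto simp: doubleton_eq_iff)
    have n4: "{z, e} = {last p, b} \<longleftrightarrow> z = last p \<and> e = b"
      using z e p(4) pc hl by (auto simp: doubleton_eq_iff)
    show ?thesis
      unfolding ear Un_iff insert_iff n3 n4 using bspec[OF bspec[OF p(6) z] e] n1 n2 by simp
  qed
  have "adj u v \<longleftrightarrow> {u, v} \<in> cycle_edges c \<union> path_edges (a # p @ [b])" if uv: "u \<in> K" "v \<in> K" for u v
  proof -
    consider "u \<in> set c" "v \<in> set c" | "u \<in> set p" "v \<in> set p" | "u \<in> set p" "v \<in> set c"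
      | "u \<in> set c" "v \<in> set p"
      using uv unfolding K by blast
    thus ?thesis
    proof cases
      case 1
      have "{u, v} \<notin> path_edges (a # p @ [b])"
        using path_edges_meet_interior[of "{u, v}" a p b] p(2) 1 pc by blast
      then show ?thesis
        using c(3)[OF 1] by blast
    next
      case 2
      have n1: "{u, v} \<notin> cycle_edges c"
      proof
        assume "{u, v} \<in> cycle_edges c"
        hence "{u, v} \<subseteq> set (c @ [hd c])"
          unfolding cycle_edges_def by (rule path_edges_subset)
        thus False
          using 2 pc c(2) by (cases c) auto
      qed
      have n2: "{u, v} \<noteq> {a, hd p}" "{u, v} \<noteq> {last p, b}"
        using 2 p(3,4) pc by (auto simp: doubleton_eq_iff)
      show ?thesis
        unfolding ear Un_iff insert_iff using in_p[OF 2] n1 n2 by simp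
    next
      case 3
      then show ?thesis by (rule mixed)
    next
      case 4
      have "adj u v \<longleftrightarrow> adj v u"
        using sym by blast
      then show ?thesis
        using mixed[OF 4(2,1)] by (simp add: insert_commute)
    qed
  qed
  moreover have "p1 \<noteq> [] \<or> rev p2 \<noteq> []"
    using r(3) c(2) r12 by auto
  moreover have "K \<subseteq> set c \<union> set q"
    using K pq by blast
  ultimately show ?thesis
    using dist p(2) K_def unfolding cyc
    by (intro exI[of _ a] exI[of _ b] exI[of _ p1] exI[of _ "rev p2"] exI[of _ p] exI[of _ K]) simp
qed

section \<open>Sparsity of graphs on a triangulated sphere\<close>

lemma card_le_image_times_fibre:
  assumes "finite A" "\<And>x. x \<in> A \<Longrightarrow> card {y\<in>A. f y = f x} \<le> k"
  shows "card A \<le> card (f ` A) * k"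
proof -
  have "card A = (\<Sum>z\<in>f ` A. card {y\<in>A. f y = z})"
    using sum.image_gen[OF assms(1), of "\<lambda>_. 1::nat" f] by simp
  also have "\<dots> \<le> (\<Sum>z\<in>f ` A. k)"
    by (rule sum_mono) (use assms(2) in auto)
  finally show ?thesis by simp
qed

lemma card_le_two_times_image:
  assumes "finite A" "\<And>x. x \<in> A \<Longrightarrow> card {y\<in>A. f y = f x} \<le> 2"
  shows "card A \<le> 2 * card (f ` A)"
  using card_le_image_times_fibre[OF assms] by simp

text \<open>Every vertex outside \<open>U\<close> can be reached by a new edge.\<close>

lemma card_outside_le:
  assumes "finite W" "finite Q"
    and "\<And>A. A \<subseteq> W \<Longrightarrow> A \<noteq> {} \<Longrightarrow> A \<noteq> W \<Longrightarrow> \<exists>p\<in>Q. p \<inter> A \<noteq> {} \<and> \<not> p \<subseteq> A"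
    and "\<And>p. p \<in> Q \<Longrightarrow> p \<subseteq> W \<and> card p = 2"
    and "U \<subseteq> W" "U \<noteq> {}" "H \<subseteq> Q" "\<Union>H \<subseteq> U"
  shows "card (W - U) \<le> card (Q - H)"
  using assms(5-8)
proof (induction "card (W - U)" arbitrary: U H)
  case (Suc n)
  have "U \<noteq> W"
    using Suc.hyps(2) by auto
  then obtain p where p: "p \<in> Q" "p \<inter> U \<noteq> {}" "\<not> p \<subseteq> U"
    using assms(3)[OF Suc.prems(1,2)] by blast
  then obtain w where w: "w \<in> p" "w \<notin> U"
    by blast
  have pW: "p \<subseteq> W" "card p = 2"
    using assms(4) p by auto
  obtain u where u: "u \<in> p" "u \<in> U"
    using p by blast
  have "p = {u, w}"
    using pW(2) u w by (auto simp: card_2_iff)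
  have pH: "p \<notin> H"
    using w Suc.prems(4) by blast
  have W: "W - U = insert w (W - insert w U)"
    using w pW by auto
  hence "card (W - U) = Suc (card (W - insert w U))"
    using assms(1) by (metis card_insert_disjoint finite_Diff Diff_iff insertI1)
  hence "n = card (W - insert w U)"
    using Suc.hyps(2) by simp
  moreover have "insert w U \<subseteq> W" "insert p H \<subseteq> Q" "\<Union>(insert p H) \<subseteq> insert w U"
    using Suc.prems p pW w u \<open>p = {u, w}\<close> by auto
  ultimately have "card (W - insert w U) \<le> card (Q - insert p H)"
    using Suc.hyps(1)[of "insert w U" "insert p H"] by simp
  moreover have "card (Q - H) = Suc (card (Q - insert p H))"
    using p pH assms(2) by (metis Diff_iff Diff_insert card_Suc_Diff1 finite_Diff)
  ultimately show ?case
    using Suc.hyps(2) \<open>n = card (W - insert w U)\<close> by simp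
qed simp

text \<open>A closed combinatorial surface: each edge lies on two triangles, and both the graph and
  its dual are connected. \<open>euler\<close> says that the Euler characteristic is at least 2; in
  \<open>edge_bound\<close> it takes the place of the Jordan curve theorem.\<close>

locale triangulated_sphere =
  fixes W :: "'w set" and P Tr :: "'w set set"
  assumes finite_W: "finite W"
    and edge: "p \<in> P \<Longrightarrow> p \<subseteq> W \<and> card p = 2"
    and triangle: "t \<in> Tr \<Longrightarrow> t \<subseteq> W \<and> card t = 3"
    and triangle_edge: "t \<in> Tr \<Longrightarrow> p \<subseteq> t \<Longrightarrow> card p = 2 \<Longrightarrow> p \<in> P"
    and two_triangles: "p \<in> P \<Longrightarrow> card {t\<in>Tr. p \<subseteq> t} = 2"
    and connected: "A \<subseteq> W \<Longrightarrow> A \<noteq> {} \<Longrightarrow> A \<noteq> W \<Longrightarrow> \<exists>p\<in>P. p \<inter> A \<noteq> {} \<and> \<not> p \<subseteq> A"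
    and dual_connected: "X \<subseteq> Tr \<Longrightarrow> X \<noteq> {} \<Longrightarrow> X \<noteq> Tr \<Longrightarrow>
      \<exists>p\<in>P. \<exists>t\<in>X. \<exists>t'\<in>Tr - X. p \<subseteq> t \<and> p \<subseteq> t'"
    and euler: "card P + 2 \<le> card W + card Tr"
begin

section \<open>Boundaries and cuts modulo 2\<close>

lemma finite_P: "finite P" and finite_Tr: "finite Tr"
  using finite_W edge triangle by (auto intro!: finite_subset[of _ "Pow W"])

text \<open>As every edge lies on two triangles, this is the boundary of the 2-chain
  \<open>X\<close> modulo 2.\<close>

definition bd :: "'w set set \<Rightarrow> 'w set set" where
  "bd X = {p\<in>P. \<exists>t\<in>X. \<exists>t'\<in>Tr - X. p \<subseteq> t \<and> p \<subseteq> t'}"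

text \<open>The coboundary modulo 2 of the vertex set \<open>A\<close>.\<close>

definition cut :: "'w set \<Rightarrow> 'w set set" where
  "cut A = {p\<in>P. p \<inter> A \<noteq> {} \<and> \<not> p \<subseteq> A}"

lemma bd_subset: "bd X \<subseteq> P"
  by (auto simp: bd_def)

lemma sides:
  assumes "p \<in> P"
  shows "\<exists>t t'. {t\<in>Tr. p \<subseteq> t} = {t, t'} \<and> t \<noteq> t' \<and>
    (\<forall>X\<subseteq>Tr. p \<in> bd X \<longleftrightarrow> (t \<in> X) \<noteq> (t' \<in> X))"
proof -
  obtain t t' where t: "{t\<in>Tr. p \<subseteq> t} = {t, t'}" "t \<noteq> t'"
    using two_triangles[OF assms] unfolding card_2_iff by (elim exE conjE)
  have mem: "s \<in> Tr \<and> p \<subseteq> s \<longleftrightarrow> s = t \<or> s = t'" for s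
  proof -
    have "s \<in> {t\<in>Tr. p \<subseteq> t} \<longleftrightarrow> s \<in> {t, t'}"
      unfolding t(1) ..
    thus ?thesis by simp
  qed
  have "p \<in> bd X \<longleftrightarrow> (t \<in> X) \<noteq> (t' \<in> X)" if X: "X \<subseteq> Tr" for X
  proof -
    have "p \<in> bd X \<longleftrightarrow> (\<exists>s s'. s \<in> X \<and> s' \<notin> X \<and> (s \<in> Tr \<and> p \<subseteq> s) \<and> (s' \<in> Tr \<and> p \<subseteq> s'))"
      unfolding bd_def using assms X by blast
    thus ?thesis
      unfolding mem by blast
  qed
  thus ?thesis
    using t by (intro exI[of _ t] exI[of _ t']) simp
qed

text \<open>Linearity of the boundary map over the field with two elements.\<close>

lemma bd_symdiff:
  assumes "X \<subseteq> Tr" "Y \<subseteq> Tr" "p \<in> P"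
  shows "p \<in> bd ((X - Y) \<union> (Y - X)) \<longleftrightarrow> (p \<in> bd X) \<noteq> (p \<in> bd Y)"
proof -
  obtain t t' where "{t\<in>Tr. p \<subseteq> t} = {t, t'}" "t \<noteq> t'"
      and "\<forall>X\<subseteq>Tr. p \<in> bd X \<longleftrightarrow> (t \<in> X) \<noteq> (t' \<in> X)"
    using sides[OF assms(3)] by (elim exE conjE)
  moreover have "(X - Y) \<union> (Y - X) \<subseteq> Tr"
    using assms by blast
  ultimately show ?thesis
    using assms by auto
qed

text \<open>A walk around the triangle enters \<open>A\<close> as often as it leaves
  \<open>A\<close>.\<close>

lemma even_cut_triangle:
  assumes "t \<in> Tr"
  shows "even (card {p \<in> cut A. p \<subseteq> t})"
proof -
  obtain x y z where t: "t = {x, y, z}" and d: "x \<noteq> y" "x \<noteq> z" "y \<noteq> z"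
    using triangle[OF assms] by (auto simp: card_3_iff)
  have "{x, y} \<in> P" "{x, z} \<in> P" "{y, z} \<in> P"
    using triangle_edge[OF assms] t d by auto
  moreover have "p \<in> {{x, y}, {x, z}, {y, z}}" if pt: "p \<subseteq> t" "p \<in> P" for p
  proof -
    obtain u v where "p = {u, v}" "u \<noteq> v"
      using edge[OF pt(2)] by (auto simp: card_2_iff)
    thus ?thesis
      using pt(1) t by auto
  qed
  ultimately have "{p \<in> cut A. p \<subseteq> t} =
      {p \<in> {{x, y}, {x, z}, {y, z}}. p \<inter> A \<noteq> {} \<and> \<not> p \<subseteq> A}"
    unfolding cut_def t by auto
  also have "\<dots> = (if (x \<in> A) \<noteq> (y \<in> A) then {{x, y}} else {}) \<union>
      (if (x \<in> A) \<noteq> (z \<in> A) then {{x, z}} else {}) \<union> (if (y \<in> A) \<noteq> (z \<in> A) then {{y, z}} else {})"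
    by auto
  also have "even (card \<dots>)"
    using d by (cases "x \<in> A"; cases "y \<in> A"; cases "z \<in> A") (auto simp: doubleton_eq_iff)
  finally show ?thesis .
qed

text \<open>Boundaries and coboundaries are orthogonal modulo 2: count in two ways the pairs of an
  edge of the cut and a triangle of \<open>X\<close> that contains it.\<close>

lemma even_bd_cut:
  assumes X: "X \<subseteq> Tr"
  shows "even (card (bd X \<inter> cut A))"
proof -
  have fin: "finite X" "finite (cut A)"
    using X finite_Tr finite_P by (auto intro: finite_subset simp: cut_def)
  have odd: "odd (card {t\<in>X. p \<subseteq> t}) \<longleftrightarrow> p \<in> bd X" if p: "p \<in> P" for p
  proof -
    obtain t t' where t: "{t\<in>Tr. p \<subseteq> t} = {t, t'}" "t \<noteq> t'"
        "\<forall>X\<subseteq>Tr. p \<in> bd X \<longleftrightarrow> (t \<in> X) \<noteq> (t' \<in> X)"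
      using sides[OF p] by (elim exE conjE)
    have "{t\<in>X. p \<subseteq> t} = {t\<in>Tr. p \<subseteq> t} \<inter> X"
      using X by blast
    hence "card {t\<in>X. p \<subseteq> t} = card ({t, t'} \<inter> X)"
      by (simp only: t(1))
    also have "odd \<dots> \<longleftrightarrow> (t \<in> X) \<noteq> (t' \<in> X)"
      using t(2) by (cases "t \<in> X"; cases "t' \<in> X") auto
    finally show ?thesis
      using t(3)[rule_format, OF X] by blast
  qed
  have "(\<Sum>p\<in>cut A. card {t\<in>X. p \<subseteq> t}) = (\<Sum>p\<in>cut A. \<Sum>t\<in>X. if p \<subseteq> t then 1 else 0)"
    using fin by (simp add: sum.If_cases Int_def)
  also have "\<dots> = (\<Sum>t\<in>X. \<Sum>p\<in>cut A. if p \<subseteq> t then 1 else 0)"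
    by (rule sum.swap)
  also have "\<dots> = (\<Sum>t\<in>X. card {p\<in>cut A. p \<subseteq> t})"
    using fin by (simp add: sum.If_cases Int_def)
  also have "even \<dots>"
    by (rule dvd_sum) (use even_cut_triangle X in auto)
  finally have "even (\<Sum>p\<in>cut A. card {t\<in>X. p \<subseteq> t})" .
  hence "even (card {p\<in>cut A. odd (card {t\<in>X. p \<subseteq> t})})"
    unfolding even_sum_iff[OF fin(2)] .
  also have "{p\<in>cut A. odd (card {t\<in>X. p \<subseteq> t})} = bd X \<inter> cut A"
    using odd by (auto simp: cut_def)
  finally show ?thesis .
qed

lemma even_bd_vertex:
  assumes X: "X \<subseteq> Tr"
  shows "even (card {p\<in>bd X. w \<in> p})"
proof -
  have "w \<in> p \<longleftrightarrow> p \<in> cut {w}" if "p \<in> P" for p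
    using edge[OF that] that by (auto simp: cut_def card_2_iff)
  hence "{p\<in>bd X. w \<in> p} = bd X \<inter> cut {w}"
    using bd_subset by blast
  thus ?thesis
    using even_bd_cut[OF X] by simp
qed

text \<open>A tree-cotree count: a minimal set \<open>D\<close> of dual edges off \<open>H\<close> with the same dual components as
  all of \<open>P - H\<close> contains no cut, because its edges are isolated by boundaries, which meet every cut
  evenly. So \<open>P - D\<close> still connects \<open>W\<close>.\<close>

lemma edge_bound:
  fixes \<omega> :: "'w set \<Rightarrow> nat"
  assumes H: "H \<subseteq> P" and U: "\<Union>H \<subseteq> U" "U \<subseteq> W" "U \<noteq> {}"
    and weight: "\<And>K. K \<subseteq> H \<Longrightarrow> K \<noteq> {} \<Longrightarrow> (\<And>w. even (card {p\<in>K. w \<in> p})) \<Longrightarrow> g \<le> sum \<omega> K"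
  shows "card H + 1 \<le> card U \<or> g * (card H + 2) \<le> 2 * sum \<omega> H + g * card U"
proof -
  define good where "good D \<longleftrightarrow> D \<subseteq> P - H \<and> (\<forall>X\<subseteq>Tr. bd X \<inter> D = {} \<longrightarrow> bd X \<subseteq> H)" for D
  have "good (P - H)"
    unfolding good_def using bd_subset by blast
  then obtain D where D: "good D" and D_min: "\<And>D'. good D' \<Longrightarrow> card D \<le> card D'"
    using ex_has_least_nat[of good "P - H" card] by blast
  have DP: "D \<subseteq> P - H" and DH: "\<And>X. X \<subseteq> Tr \<Longrightarrow> bd X \<inter> D = {} \<Longrightarrow> bd X \<subseteq> H"
    using D by (auto simp: good_def)
  have finD: "finite D"
    using DP finite_P by (auto intro: finite_subset)
  \<comment> \<open>By minimality \<open>D\<close> is a spanning forest of the dual graph off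
    \<open>H\<close>; the witness \<open>X\<close> separates the two triangles at \<open>d\<close>
    without crossing another edge of \<open>D\<close>.\<close>
  have isolate: "\<exists>X\<subseteq>Tr. bd X \<inter> D = {d}" if d: "d \<in> D" for d
  proof -
    have "card (D - {d}) < card D"
      using d finD by (rule card_Diff1_less[rotated])
    hence "\<not> good (D - {d})"
      using D_min[of "D - {d}"] by linarith
    then obtain X where X: "X \<subseteq> Tr" "bd X \<inter> (D - {d}) = {}" "\<not> bd X \<subseteq> H"
      unfolding good_def using DP by auto
    have "bd X \<inter> D = {d}"
      using DH[OF X(1)] X(2,3) by blast
    thus ?thesis
      using X(1) by blast
  qed
  have conn: "\<exists>p\<in>P - D. p \<inter> A \<noteq> {} \<and> \<not> p \<subseteq> A" if A: "A \<subseteq> W" "A \<noteq> {}" "A \<noteq> W" for A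
  proof (rule ccontr)
    assume "\<not> ?thesis"
    hence cD: "cut A \<subseteq> D"
      by (auto simp: cut_def)
    have "cut A \<noteq> {}"
      using connected[OF A] unfolding cut_def by blast
    then obtain d where d: "d \<in> cut A"
      by blast
    have "d \<in> D"
      using d cD by blast
    then obtain X where X: "X \<subseteq> Tr" "bd X \<inter> D = {d}"
      by (elim exE conjE isolate[THEN exE])
    have "bd X \<inter> cut A = (bd X \<inter> D) \<inter> cut A"
      using cD by blast
    also have "\<dots> = {d}"
      using d unfolding X(2) by simp
    finally have "bd X \<inter> cut A = {d}" .
    thus False
      using even_bd_cut[OF X(1), of A] by simp
  qed
  have HD: "H \<subseteq> P - D"
    using H DP by blast
  have "card (W - U) \<le> card (P - D - H)"
    by (rule card_outside_le) (use finite_W finite_P conn edge U HD in auto)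
  moreover have "card (P - D - H) = card P - card D - card H"
    using HD H DP finite_P finD by (metis Diff_subset card_Diff_subset finite_subset subset_Diff_insert subset_trans)
  moreover have "card H + card D \<le> card P"
    using card_Un_disjoint[of H D] card_mono[of P "H \<union> D"] H DP finite_P finD
    by (metis Diff_disjoint Diff_subset Int_commute Un_least disjoint_iff finite_subset subset_iff)
  moreover have "card (W - U) = card W - card U" "card U \<le> card W"
    using U finite_W by (auto simp: card_Diff_subset finite_subset card_mono)
  ultimately have count: "card H + card W + card D \<le> card P + card U"
    by linarith
  \<comment> \<open>The unions of components of the dual graph with edges
    \<open>P - H\<close>.\<close>
  define \<X> where "\<X> = {X. X \<subseteq> Tr \<and> bd X \<subseteq> H}"
  have finX: "finite \<X>"
    unfolding \<X>_def using finite_Tr by (auto intro: finite_subset[of _ "Pow Tr"])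
  \<comment> \<open>The map from \<open>X\<close> to \<open>bd X \<inter> D\<close> is linear modulo
    2 with kernel \<open>\<X>\<close>, so each fibre is a translate of the kernel. The resulting
    inequality of powers of 2 is the rank-nullity theorem.\<close>
  have "card (Pow Tr) \<le> card ((\<lambda>X. bd X \<inter> D) ` Pow Tr) * card \<X>"
  proof (rule card_le_image_times_fibre)
    fix X0 assume X0: "X0 \<in> Pow Tr"
    let ?s = "\<lambda>X. (X - X0) \<union> (X0 - X)"
    show "card {Y \<in> Pow Tr. bd Y \<inter> D = bd X0 \<inter> D} \<le> card \<X>"
    proof (rule card_inj_on_le[of ?s])
      show "inj_on ?s {Y \<in> Pow Tr. bd Y \<inter> D = bd X0 \<inter> D}"
        by (rule inj_onI) blast
      show "?s ` {Y \<in> Pow Tr. bd Y \<inter> D = bd X0 \<inter> D} \<subseteq> \<X>"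
      proof (rule image_subsetI)
        fix Y assume Y: "Y \<in> {Y \<in> Pow Tr. bd Y \<inter> D = bd X0 \<inter> D}"
        have YT: "Y \<subseteq> Tr" "X0 \<subseteq> Tr" "?s Y \<subseteq> Tr"
          using Y X0 by auto
        have "bd (?s Y) \<inter> D = {}"
          using bd_symdiff[OF YT(1,2)] Y DP by blast
        thus "?s Y \<in> \<X>"
          using DH[OF YT(3)] YT(3) by (simp add: \<X>_def)
      qed
    qed (rule finX)
  qed (use finite_Tr in auto)
  also have "\<dots> \<le> card (Pow D) * card \<X>"
    using finD by (intro mult_right_mono card_mono) auto
  finally have pow: "(2::nat) ^ card Tr \<le> 2 ^ card D * card \<X>"
    using finite_Tr finD by (simp add: card_Pow)
  \<comment> \<open>The dual components themselves, recovered as the atoms of \<open>\<X>\<close>.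
    They are the faces of the subgraph \<open>H\<close>.\<close>
  define cls where "cls t = {t'\<in>Tr. \<forall>X\<in>\<X>. t \<in> X \<longleftrightarrow> t' \<in> X}" for t
  define \<C> where "\<C> = cls ` Tr"
  have finC: "finite \<C>"
    using finite_Tr by (simp add: \<C>_def)
  have self: "t \<in> cls t" if "t \<in> Tr" for t
    using that by (simp add: cls_def)
  have "card \<X> \<le> card (Pow \<C>)"
  proof (rule card_inj_on_le[of "\<lambda>X. {C\<in>\<C>. C \<subseteq> X}"])
    have X: "X = \<Union>{C\<in>\<C>. C \<subseteq> X}" if "X \<in> \<X>" for X
    proof -
      have "cls t \<subseteq> X" "t \<in> cls t" "cls t \<in> \<C>" if "t \<in> X" for t
        using that \<open>X \<in> \<X>\<close> self[of t] by (auto simp: cls_def \<X>_def \<C>_def)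
      thus ?thesis by blast
    qed
    show "inj_on (\<lambda>X. {C\<in>\<C>. C \<subseteq> X}) \<X>"
      by (rule inj_onI) (metis X)
  qed (use finC in auto)
  hence "card \<X> \<le> 2 ^ card \<C>"
    using finC by (simp add: card_Pow)
  hence "2 ^ card Tr \<le> 2 ^ card D * (2::nat) ^ card \<C>"
    using pow by (meson le_trans mult_le_mono2)
  hence "(2::nat) ^ card Tr \<le> 2 ^ (card D + card \<C>)"
    by (simp add: power_add)
  hence "card Tr \<le> card D + card \<C>"
    by (simp only: power_increasing_iff)
  \<comment> \<open>Euler's inequality for the graph with vertices \<open>U\<close> and edges
    \<open>H\<close>, whose faces are the classes. With a single face it is the bound for a
    forest.\<close>
  hence C: "card H + 2 \<le> card \<C> + card U"
    using count euler by linarith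
  show ?thesis
  proof (cases "card \<C> \<le> 1")
    case True
    then show ?thesis using C by linarith
  next
    case False
    have bdCH: "bd C \<subseteq> H" if CC: "C \<in> \<C>" for C
    proof
      obtain t where t: "C = cls t"
        using CC by (auto simp: \<C>_def)
      fix p assume p: "p \<in> bd C"
      then obtain s s' where s: "s \<in> C" "s' \<in> Tr - C" "p \<subseteq> s" "p \<subseteq> s'" "p \<in> P"
        by (auto simp: bd_def)
      then obtain X where X: "X \<in> \<X>" "(s \<in> X) \<noteq> (s' \<in> X)"
        unfolding t cls_def by auto
      hence "p \<in> bd X"
        using s by (auto simp: bd_def t cls_def \<X>_def)
      thus "p \<in> H"
        using X(1) by (auto simp: \<X>_def)
    qed
    \<comment> \<open>As there are several classes, none of them is all of \<open>Tr\<close>. The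
      boundary of a class is then a nonempty even subgraph of \<open>H\<close>, to which
      \<open>weight\<close> applies.\<close>
    have bdC: "g \<le> sum \<omega> (bd C)" if CC: "C \<in> \<C>" for C
    proof -
      obtain t where t: "t \<in> Tr" "C = cls t"
        using CC by (auto simp: \<C>_def)
      have CT: "C \<subseteq> Tr"
        by (auto simp: t cls_def)
      have "C \<noteq> Tr"
      proof
        assume CTr: "C = Tr"
        have "cls t' = C" if "t' \<in> Tr" for t'
        proof -
          have "t' \<in> cls t"
            using CTr that t by simp
          thus ?thesis
            unfolding t(2) by (auto simp: cls_def)
        qed
        hence "\<C> \<subseteq> {C}"
          by (auto simp: \<C>_def)
        hence "card \<C> \<le> 1"
          using card_mono[of "{C}" \<C>] by simp
        thus False using False by simp
      qed
      moreover have "C \<noteq> {}"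
        using self[OF t(1)] t(2) by blast
      ultimately have ne: "bd C \<noteq> {}"
        using dual_connected[OF CT] unfolding bd_def by blast
      thus ?thesis
        using weight[OF bdCH[OF CC] ne] even_bd_vertex[OF CT] by blast
    qed
    have "g * card \<C> \<le> (\<Sum>C\<in>\<C>. sum \<omega> (bd C \<inter> H))"
    proof -
      have "sum \<omega> (bd C \<inter> H) = sum \<omega> (bd C)" if "C \<in> \<C>" for C
        using bdCH[OF that] by (simp add: Int_absorb2)
      thus ?thesis
        using sum_mono[of \<C> "\<lambda>_. g" "\<lambda>C. sum \<omega> (bd C)"] bdC by (simp add: mult.commute)
    qed
    also have "\<dots> = (\<Sum>C\<in>\<C>. \<Sum>p\<in>H. if p \<in> bd C then \<omega> p else 0)"
      using finite_subset[OF H finite_P] by (simp add: sum.If_cases Int_def conj_commute)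
    also have "\<dots> = (\<Sum>p\<in>H. \<Sum>C\<in>\<C>. if p \<in> bd C then \<omega> p else 0)"
      by (rule sum.swap)
    also have "\<dots> = (\<Sum>p\<in>H. card {C\<in>\<C>. p \<in> bd C} * \<omega> p)"
      using finC by (simp add: sum.If_cases Int_def)
    \<comment> \<open>Only the classes of the two triangles at \<open>p\<close> can have
      \<open>p\<close> on their boundary.\<close>
    also have "\<dots> \<le> (\<Sum>p\<in>H. 2 * \<omega> p)"
    proof (intro sum_mono mult_right_mono)
      fix p assume "p \<in> H"
      hence p: "p \<in> P" using H by blast
      have "{C\<in>\<C>. p \<in> bd C} \<subseteq> cls ` {t\<in>Tr. p \<subseteq> t}"
      proof
        fix C assume C': "C \<in> {C\<in>\<C>. p \<in> bd C}"
        then obtain t where t: "t \<in> Tr" "C = cls t" by (auto simp: \<C>_def)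
        obtain s where s: "s \<in> C" "p \<subseteq> s"
          using C' by (auto simp: bd_def)
        have "C = cls s"
          using s(1) unfolding t(2) by (auto simp: cls_def)
        thus "C \<in> cls ` {t\<in>Tr. p \<subseteq> t}"
          using s t(2) by (auto simp: cls_def)
      qed
      hence "card {C\<in>\<C>. p \<in> bd C} \<le> card (cls ` {t\<in>Tr. p \<subseteq> t})"
        using finite_Tr by (intro card_mono) simp_all
      also have "\<dots> \<le> card {t\<in>Tr. p \<subseteq> t}"
        using finite_Tr by (intro card_image_le) simp
      finally show "card {C\<in>\<C>. p \<in> bd C} \<le> 2"
        using two_triangles[OF p] by simp
    qed simp
    finally have "g * card \<C> \<le> 2 * sum \<omega> H"
      by (simp add: sum_distrib_left)
    moreover have "g * (card H + 2) \<le> g * card \<C> + g * card U"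
      using C by (metis add_mult_distrib2 mult_le_mono2)
    ultimately show ?thesis by linarith
  qed
qed

end

section \<open>Winding numbers and the faces of a plane graph\<close>

text \<open>Gaussian elimination: equation \<open>i\<close> is solved for an unknown
  \<open>e0\<close>, which is then substituted into the other equations.\<close>

lemma homogeneous_system_nontrivial_solution:
  fixes a :: "'i \<Rightarrow> 'e \<Rightarrow> 'a::field"
  assumes "finite I" "finite E" "card I < card E"
  shows "\<exists>k. (\<exists>e\<in>E. k e \<noteq> 0) \<and> (\<forall>i\<in>I. (\<Sum>e\<in>E. a i e * k e) = 0)"
  using assms
proof (induction I arbitrary: a E rule: finite_induct)
  case empty
  then show ?case
    by (intro exI[of _ "\<lambda>_. 1"]) (auto simp: card_gt_0_iff)
next
  case (insert i I)
  show ?case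
  proof (cases "\<forall>e\<in>E. a i e = 0")
    case True
    have "card I < card E"
      using insert by simp
    then obtain k where "\<exists>e\<in>E. k e \<noteq> 0" "\<forall>i\<in>I. (\<Sum>e\<in>E. a i e * k e) = 0"
      using insert.IH[OF insert.prems(1), of a] by blast
    then show ?thesis
      using True by (intro exI[of _ k]) simp
  next
    case False
    then obtain e0 where e0: "e0 \<in> E" "a i e0 \<noteq> 0"
      by blast
    define E' where "E' = E - {e0}"
    have E: "E = insert e0 E'" "e0 \<notin> E'" "finite E'"
      using e0 insert.prems by (auto simp: E'_def)
    have "card I < card E'"
      using insert E by simp
    then obtain k where k: "\<exists>e\<in>E'. k e \<noteq> 0"
        "\<forall>j\<in>I. (\<Sum>e\<in>E'. (a j e - a j e0 * a i e / a i e0) * k e) = 0"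
      using insert.IH[OF E(3), of "\<lambda>j e. a j e - a j e0 * a i e / a i e0"] by blast
    define k' where "k' e = (if e = e0 then - (\<Sum>e\<in>E'. a i e * k e) / a i e0 else k e)" for e
    have sum: "(\<Sum>e\<in>E. a j e * k' e) =
        (\<Sum>e\<in>E'. a j e * k e) - a j e0 * (\<Sum>e\<in>E'. a i e * k e) / a i e0" for j
    proof -
      have "(\<Sum>e\<in>E'. a j e * k' e) = (\<Sum>e\<in>E'. a j e * k e)"
        using E(2) by (intro sum.cong) (auto simp: k'_def)
      thus ?thesis
        unfolding E(1) using E(2,3) by (simp add: k'_def)
    qed
    have "(\<Sum>e\<in>E. a j e * k' e) = 0" if "j \<in> I" for j
      using k(2)[rule_format, OF that] unfolding sum
      by (simp add: left_diff_distrib sum_subtractf sum_distrib_left sum_divide_distrib mult.assoc)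
    moreover have "(\<Sum>e\<in>E. a i e * k' e) = 0"
      unfolding sum using e0 by simp
    moreover have "\<exists>e\<in>E. k' e \<noteq> 0"
      using k(1) E by (auto simp: k'_def)
    ultimately show ?thesis by blast
  qed
qed

text \<open>Both sides have the same exponential, so their difference takes values in a discrete
  set. It is continuous on the ball and vanishes at \<open>z0\<close>.\<close>

lemma winding_number_diff_Ln:
  assumes p: "path p" and ball: "ball z0 r \<inter> path_image p = {}" and z: "z \<in> ball z0 r"
  shows "2 * of_real pi * \<i> * (winding_number p z - winding_number p z0) =
    Ln ((pathfinish p - z) / (pathfinish p - z0)) - Ln ((pathstart p - z) / (pathstart p - z0))"
proof -
  define L where "L v z = Ln ((v - z) / (v - z0))" for v z
  define D where "D z = 2 * of_real pi * \<i> * (winding_number p z - winding_number p z0)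
      - (L (pathfinish p) z - L (pathstart p) z)" for z
  have r: "0 < r"
    using z by (metis ball_empty empty_iff not_le)
  have endpt: "v \<notin> ball z0 r" if "v \<in> {pathstart p, pathfinish p}" for v
    using that ball pathstart_in_path_image pathfinish_in_path_image by blast
  \<comment> \<open>The quotient has distance less than 1 from the number 1, which keeps it off the
    branch cut of \<open>Ln\<close>.\<close>
  have pos: "0 < Re ((v - z) / (v - z0))"
    if v: "v \<in> {pathstart p, pathfinish p}" and z: "z \<in> ball z0 r" for v z
  proof -
    have "norm (z - z0) < norm (v - z0)"
      using endpt[OF v] z by (simp add: dist_norm norm_minus_commute)
    hence n: "norm ((z - z0) / (v - z0)) < 1" "v - z0 \<noteq> 0"
      by (auto simp: norm_divide divide_simps)
    have "(v - z) / (v - z0) = 1 - (z - z0) / (v - z0)"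
      using n(2) by (simp add: field_simps)
    moreover have "Re ((z - z0) / (v - z0)) < 1"
      using complex_Re_le_cmod[of "(z - z0) / (v - z0)"] n(1) by linarith
    ultimately show ?thesis by simp
  qed
  have notin: "z \<notin> path_image p" if "z \<in> ball z0 r" for z
    using that ball by blast
  have contL: "continuous_on (ball z0 r) (L v)" if v: "v \<in> {pathstart p, pathfinish p}" for v
    unfolding L_def
  proof (rule continuous_on_Ln')
    show "continuous_on (ball z0 r) (\<lambda>z. (v - z) / (v - z0))"
      using endpt[OF v] r by (intro continuous_intros) auto
    show "(v - z) / (v - z0) \<notin> \<real>\<^sub>\<le>\<^sub>0" if "z \<in> ball z0 r" for z
      using pos[OF v that] complex_nonpos_Reals_iff by auto
  qed
  have contD: "continuous_on (ball z0 r) D"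
    unfolding D_def
    by (intro continuous_intros contL continuous_on_subset[OF continuous_on_winding_number[OF p]])
      (use notin in auto)
  have expL: "exp (L v z) = (v - z) / (v - z0)"
    if "v \<in> {pathstart p, pathfinish p}" "z \<in> ball z0 r" for v z
    unfolding L_def using pos[OF that] by (intro exp_Ln) auto
  have expD: "exp (D z) = 1" if z: "z \<in> ball z0 r" for z
  proof -
    have z0: "z0 \<in> ball z0 r"
      using r by simp
    define a b where "a = pathstart p" and "b = pathfinish p"
    have ne: "a - z \<noteq> 0" "b - z \<noteq> 0" "a - z0 \<noteq> 0" "b - z0 \<noteq> 0"
      using endpt[of a] endpt[of b] z z0 by (auto simp: a_def b_def)
    have w: "exp (2 * of_real pi * \<i> * winding_number p y) = (b - y) / (a - y)"
      if "y \<in> ball z0 r" "a - y \<noteq> 0" for y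
      using winding_number_exp_2pi[OF p notin[OF that(1)]] that(2) by (simp add: a_def b_def)
    have eL: "exp (L a z) = (a - z) / (a - z0)" "exp (L b z) = (b - z) / (b - z0)"
      using expL[of a z] expL[of b z] z by (simp_all add: a_def b_def)
    have "exp (D z) = exp (2 * of_real pi * \<i> * winding_number p z) /
        exp (2 * of_real pi * \<i> * winding_number p z0) / (exp (L b z) / exp (L a z))"
      by (simp add: D_def exp_diff right_diff_distrib a_def b_def)
    also have "\<dots> = 1"
      using ne unfolding w[OF z ne(1)] w[OF z0 ne(3)] eL by (simp add: divide_simps)
    finally show ?thesis .
  qed
  have "D constant_on ball z0 r"
  proof (rule continuous_discrete_range_constant[OF _ contD])
    fix x assume x: "x \<in> ball z0 r"
    have "1 \<le> norm (D y - D x)" if y: "y \<in> ball z0 r" "D y \<noteq> D x" for y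
    proof -
      have "exp (D y - D x) = 1"
        using expD x y by (simp add: exp_diff)
      then obtain n :: int where n: "Re (D y - D x) = 0" "Im (D y - D x) = of_int (2 * n) * pi"
        by (auto simp: exp_eq_1)
      have "n \<noteq> 0"
        using n y(2) by (auto simp: complex_eq_iff)
      hence "1 \<le> \<bar>real_of_int (2 * n)\<bar>"
        by linarith
      hence "1 * 1 \<le> \<bar>real_of_int (2 * n)\<bar> * pi"
        using pi_ge_two by (intro mult_mono) auto
      also have "\<dots> = \<bar>Im (D y - D x)\<bar>"
        unfolding n(2) by (simp add: abs_mult)
      also have "\<dots> \<le> norm (D y - D x)"
        by (rule abs_Im_le_cmod)
      finally show ?thesis by simp
    qed
    thus "\<exists>e>0. \<forall>y. y \<in> ball z0 r \<and> D y \<noteq> D x \<longrightarrow> e \<le> cmod (D y - D x)"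
      by (intro exI[of _ 1]) auto
  qed auto
  moreover have "D z0 = 0"
  proof -
    have "pathstart p - z0 \<noteq> 0" "pathfinish p - z0 \<noteq> 0"
      using endpt[of "pathstart p"] endpt[of "pathfinish p"] r by auto
    thus ?thesis
      by (simp add: D_def L_def)
  qed
  ultimately have "D z = 0"
    using z r unfolding constant_on_def by (metis centre_in_ball)
  thus ?thesis
    by (simp add: D_def L_def)
qed

text \<open>Carries the value on a face to a boundary point at which \<open>h\<close> is continuous;
  two faces at one edge are compared in this way.\<close>

lemma constant_near_closure:
  fixes h :: "complex \<Rightarrow> complex"
  assumes "continuous (at p) h" "\<And>z. z \<in> S \<Longrightarrow> h z = c" "p \<in> closure S"
  shows "h p = c"
proof (cases "p \<in> S")
  case False
  hence "p islimpt S"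
    using assms(3) by (simp add: closure_def)
  hence nt: "at p within S \<noteq> bot"
    by (simp add: trivial_limit_within)
  have "(h \<longlongrightarrow> h p) (at p within S)"
    using assms(1) continuous_at_imp_continuous_at_within continuous_within by blast
  moreover have "(h \<longlongrightarrow> c) (at p within S)"
    by (rule tendsto_eventually) (use assms(2) in \<open>auto simp: eventually_at_filter\<close>)
  ultimately show ?thesis
    using tendsto_unique[OF nt] by blast
qed (use assms in auto)

text \<open>The inverse of the parametrization would embed a nonempty open subset of the plane into
  the real line, against invariance of dimension.\<close>

lemma interior_arc_image_empty:
  fixes g :: "real \<Rightarrow> complex"
  assumes "arc g"
  shows "interior (path_image g) = {}"
proof (rule ccontr)
  assume ne: "interior (path_image g) \<noteq> {}"
  obtain h where h: "homeomorphism {0..1} (path_image g) g h"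
    using homeomorphism_arc[OF assms] by blast
  have "DIM(complex) \<le> DIM(real)"
  proof (rule invariance_of_dimension)
    show "continuous_on (interior (path_image g)) h"
      using h interior_subset unfolding homeomorphism_def by (metis continuous_on_subset)
    show "inj_on h (interior (path_image g))"
      using h interior_subset unfolding homeomorphism_def
      by (metis (no_types, lifting) inj_on_def subsetD)
  qed (use ne in auto)
  thus False by simp
qed

section \<open>Topology of a plane graph whose faces are bounded by simple cycles\<close>

locale cycle_faced_plane_graph =
  fixes V :: "complex set" and E :: "complex set set"
  assumes simple_plane: "simple_plane_graph V E"
    and conn: "graph_connected V E"
    and cycle_faced: "f \<in> faces V E \<Longrightarrow> bounded_by_simple_cycle V E f"
begin

abbreviation F :: "complex set set" where "F \<equiv> faces V E"

definition G :: "complex set" where "G = V \<union> \<Union>E"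

text \<open>The choice fixes a reference direction for each edge; flows and the signs of winding
  numbers refer to it.\<close>

definition gp :: "complex set \<Rightarrow> real \<Rightarrow> complex" where
  "gp e = (SOME g. arc g \<and> path_image g = e \<and> V \<inter> e = {pathstart g, pathfinish g})"

lemma finite_V: "finite V" and finite_E: "finite E"
  using simple_plane by (auto simp: simple_plane_graph_def plane_graph_def)

lemma gp:
  assumes "e \<in> E"
  shows "arc (gp e) \<and> path_image (gp e) = e \<and> V \<inter> e = {pathstart (gp e), pathfinish (gp e)}"
proof -
  have "\<exists>g. arc g \<and> path_image g = e \<and> V \<inter> e = {pathstart g, pathfinish g}"
    using assms simple_plane by (simp add: simple_plane_graph_def plane_graph_def)
  from someI_ex[OF this] show ?thesis
    unfolding gp_def .
qed

lemma arc_gp: "e \<in> E \<Longrightarrow> arc (gp e)"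
  and path_gp: "e \<in> E \<Longrightarrow> path (gp e)"
  and image_gp: "e \<in> E \<Longrightarrow> path_image (gp e) = e"
  and ends_gp: "e \<in> E \<Longrightarrow> ends V e = {pathstart (gp e), pathfinish (gp e)}"
  using gp[of e] by (auto simp: arc_imp_path ends_def)

lemma start_neq_finish: "e \<in> E \<Longrightarrow> pathstart (gp e) \<noteq> pathfinish (gp e)"
  using arc_distinct_ends[OF arc_gp[of e]] by simp

lemma card_ends: "e \<in> E \<Longrightarrow> card (ends V e) = 2"
  using ends_gp start_neq_finish by simp

lemma ends_subset_V: "ends V e \<subseteq> V"
  by (simp add: ends_def)

lemma ends_inj: "e \<in> E \<Longrightarrow> e' \<in> E \<Longrightarrow> ends V e = ends V e' \<Longrightarrow> e = e'"
  using simple_plane by (auto simp: simple_plane_graph_def no_parallel_edges_def inj_on_def)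

lemma edges_Int: "e \<in> E \<Longrightarrow> e' \<in> E \<Longrightarrow> e \<noteq> e' \<Longrightarrow> e \<inter> e' \<subseteq> V"
  using simple_plane by (simp add: simple_plane_graph_def plane_graph_def)

lemma compact_edge: "e \<in> E \<Longrightarrow> compact e"
  using compact_path_image[OF path_gp] image_gp by metis

lemma compact_G: "compact G"
  unfolding G_def using finite_V finite_E compact_edge
  by (intro compact_Un compact_Union finite_imp_compact[OF finite_V]) auto

lemma open_complement: "open (- G)"
  using compact_imp_closed[OF compact_G] by auto

lemma faces_eq: "F = components (- G)"
  by (simp add: faces_def G_def)

lemma open_face: "f \<in> F \<Longrightarrow> open f"
  using open_components open_complement faces_eq by metis

lemma connected_face: "f \<in> F \<Longrightarrow> connected f"
  using in_components_connected faces_eq by metis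

lemma face_nonempty: "f \<in> F \<Longrightarrow> f \<noteq> {}"
  using in_components_nonempty faces_eq by metis

lemma face_disjoint_G: "f \<in> F \<Longrightarrow> f \<inter> G = {}"
  using in_components_subset[of f "- G"] faces_eq by blast

lemma faces_disjoint: "f \<in> F \<Longrightarrow> g \<in> F \<Longrightarrow> f \<noteq> g \<Longrightarrow> f \<inter> g = {}"
  using components_nonoverlap faces_eq by metis

lemma Union_faces: "\<Union>F = - G"
  by (simp add: faces_eq)

lemma faces_exist: "F \<noteq> {}"
proof -
  have "G \<noteq> UNIV"
    using compact_G not_compact_UNIV by metis
  thus ?thesis
    using Union_faces by auto
qed

lemma edge_interior_nonempty:
  assumes "e \<in> E"
  shows "e - V \<noteq> {}"
proof -
  have "e - V = path_image (gp e) - {pathstart (gp e), pathfinish (gp e)}"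
    using gp[OF assms] by auto
  thus ?thesis
    using nonempty_simple_path_endless[OF arc_imp_simple_path[OF arc_gp[OF assms]]] by simp
qed

lemma ball_near_edge:
  assumes e: "e \<in> E" and p: "p \<in> e - V"
  shows "\<exists>r>0. ball p r \<inter> G \<subseteq> e"
proof -
  have "closed (V \<union> \<Union>(E - {e}))"
    using finite_V finite_E compact_edge
    by (intro closed_Un closed_Union finite_imp_closed[OF finite_V]) (auto intro: compact_imp_closed)
  moreover have "p \<notin> V \<union> \<Union>(E - {e})"
    using p edges_Int[OF e] by blast
  ultimately obtain r where "r > 0" "ball p r \<subseteq> - (V \<union> \<Union>(E - {e}))"
    by (metis Compl_iff closed_def open_contains_ball_eq)
  thus ?thesis
    by (intro exI[of _ r]) (auto simp: G_def)
qed

lemma face_cycle: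
  assumes "f \<in> F"
  shows "\<exists>vs es. simple_cycle V E vs es \<and> frontier f = \<Union>(set es)"
  using cycle_faced[OF assms] by (simp add: bounded_by_simple_cycle_def)

lemma frontier_edge_iff:
  assumes "simple_cycle V E vs es" "frontier f = \<Union>(set es)" "e \<in> E"
  shows "e \<subseteq> frontier f \<longleftrightarrow> e \<in> set es"
proof
  assume ef: "e \<subseteq> frontier f"
  obtain p where p: "p \<in> e - V"
    using edge_interior_nonempty[OF assms(3)] by blast
  then obtain e' where e': "e' \<in> set es" "p \<in> e'"
    using ef assms(2) by blast
  have "e' \<in> E"
    using e' assms(1) by (auto simp: simple_cycle_def)
  hence "e = e'"
    using edges_Int[OF assms(3)] p e' by blast
  thus "e \<in> set es" using e' by simp
qed (use assms in blast)

text \<open>The frontier of a face is a union of whole edges, and an inner point of \<open>e\<close>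
  lies on no other edge. So one inner point of \<open>e\<close> in the closure is enough.\<close>

lemma closure_face_edge:
  assumes f: "f \<in> F" and e: "e \<in> E" and p: "p \<in> e - V" "p \<in> closure f"
  shows "e \<subseteq> frontier f"
proof -
  obtain vs es where C: "simple_cycle V E vs es" "frontier f = \<Union>(set es)"
    using face_cycle[OF f] by blast
  have "p \<in> G"
    using e p by (auto simp: G_def)
  hence "p \<notin> f"
    using face_disjoint_G[OF f] by blast
  hence "p \<in> frontier f"
    using p open_face[OF f] by (simp add: frontier_def interior_open)
  then obtain e' where e': "e' \<in> set es" "p \<in> e'"
    using C by blast
  hence "e' \<in> E"
    using C by (auto simp: simple_cycle_def)
  hence "e' = e"
    using edges_Int[OF e] p e' by blast
  thus ?thesis
    using e' C by blast
qed

section \<open>Winding numbers of edges and of face boundaries\<close>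

abbreviation w :: "complex set \<Rightarrow> complex \<Rightarrow> complex" where
  "w e z \<equiv> winding_number (gp e) z"

lemma continuous_w: "e \<in> E \<Longrightarrow> z \<notin> e \<Longrightarrow> continuous (at z) (w e)"
  by (rule continuous_at_winding_number[OF path_gp]) (simp_all add: image_gp)

lemma oriented_edge:
  assumes "e \<in> E" "ends V e = {u, v}"
  shows "\<exists>h s. arc h \<and> path_image h = e \<and> pathstart h = u \<and> pathfinish h = v \<and> (s = 1 \<or> s = -1) \<and>
     (\<forall>z. z \<notin> e \<longrightarrow> winding_number h z = s * w e z)"
proof -
  have eq: "{u, v} = {pathstart (gp e), pathfinish (gp e)}"
    using assms ends_gp by metis
  consider "u = pathstart (gp e)" "v = pathfinish (gp e)" | "v = pathstart (gp e)" "u = pathfinish (gp e)"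
    using eq by (auto simp: doubleton_eq_iff)
  thus ?thesis
  proof cases
    case 1
    then show ?thesis
      using arc_gp[OF assms(1)] image_gp[OF assms(1)] by (intro exI[of _ "gp e"] exI[of _ 1]) auto
  next
    case 2
    then show ?thesis
      using arc_gp[OF assms(1)] image_gp[OF assms(1)] path_gp[OF assms(1)]
      by (intro exI[of _ "reversepath (gp e)"] exI[of _ "-1"])
        (auto simp: arc_reversepath winding_number_reversepath)
  qed
qed

lemma cycle_edge:
  assumes "simple_cycle V E vs es" "i < length vs"
  shows "es ! i \<in> E" "ends V (es ! i) = {vs ! i, vs ! (Suc i mod length vs)}"
  using assms by (auto simp: simple_cycle_def)

lemma cycle_edges_Int:
  assumes C: "simple_cycle V E vs es" "i < length vs" "j < length vs" "es ! i \<noteq> es ! j"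
  shows "es ! i \<inter> es ! j \<subseteq> {vs ! i, vs ! (Suc i mod length vs)} \<inter> {vs ! j, vs ! (Suc j mod length vs)}"
  using edges_Int[of "es ! i" "es ! j"] cycle_edge[OF C(1,2)] cycle_edge[OF C(1,3)] C(4)
  by (auto simp: ends_def)

lemma cycle_distinct:
  assumes C: "simple_cycle V E vs es"
  shows "distinct es"
proof -
  let ?n = "length vs"
  have n: "3 \<le> ?n" "distinct vs" "length es = ?n"
    using C by (auto simp: simple_cycle_def)
  have "i = j" if ij: "i < ?n" "j < ?n" "es ! i = es ! j" for i j
  proof (rule ccontr)
    assume "i \<noteq> j"
    have eq: "{vs ! i, vs ! (Suc i mod ?n)} = {vs ! j, vs ! (Suc j mod ?n)}"
      using cycle_edge[OF C] ij by metis
    have lt: "Suc i mod ?n < ?n" "Suc j mod ?n < ?n"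
      using n(1) by (auto intro: mod_less_divisor)
    have "vs ! i \<noteq> vs ! j"
      using \<open>i \<noteq> j\<close> ij n(2) nth_eq_iff_index_eq by blast
    \<comment> \<open>Each of the positions \<open>i\<close> and \<open>j\<close> would be the
      cyclic successor of the other, which happens only in a cycle of length 2.\<close>
    hence "vs ! i = vs ! (Suc j mod ?n)" "vs ! (Suc i mod ?n) = vs ! j"
      using eq by (auto simp: doubleton_eq_iff)
    hence "i = Suc j mod ?n" "Suc i mod ?n = j"
      using lt ij n(2) nth_eq_iff_index_eq by blast+
    thus False
      using n(1) ij by (auto simp: mod_Suc split: if_splits)
  qed
  thus ?thesis
    using n(3) by (simp add: distinct_conv_nth) metis
qed

text \<open>The edges are appended one by one; \<open>s i\<close> tells whether the direction of the
  cycle agrees with that of \<open>gp\<close>. As \<open>k < length vs\<close>, the path does not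
  close up and remains an arc.\<close>

lemma cycle_arc:
  assumes C: "simple_cycle V E vs es" and k: "0 < k" "k < length vs"
  shows "\<exists>\<gamma> s. arc \<gamma> \<and> pathstart \<gamma> = vs ! 0 \<and> pathfinish \<gamma> = vs ! k \<and>
     path_image \<gamma> = (\<Union>i<k. es ! i) \<and> (\<forall>i<k. s i = 1 \<or> s i = -1) \<and>
     (\<forall>z. z \<notin> (\<Union>i<k. es ! i) \<longrightarrow> winding_number \<gamma> z = (\<Sum>i<k. s i * w (es ! i) z))"
  using k
proof (induction k)
  case (Suc k)
  let ?n = "length vs"
  have n: "3 \<le> ?n" "distinct vs" "length es = ?n" and k: "k < ?n" "Suc k mod ?n = Suc k"
    using C Suc.prems by (auto simp: simple_cycle_def)
  obtain h s where h: "arc h" "path_image h = es ! k" "pathstart h = vs ! k" "pathfinish h = vs ! Suc k"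
      "s = 1 \<or> s = -1" "\<And>z. z \<notin> es ! k \<Longrightarrow> winding_number h z = s * w (es ! k) z"
    using oriented_edge[OF cycle_edge[OF C k(1)]] unfolding k(2) by blast
  show ?case
  proof (cases "k = 0")
    case True
    then show ?thesis
      using h by (intro exI[of _ h] exI[of _ "\<lambda>_. s"]) auto
  next
    case False
    then obtain \<gamma> t where \<gamma>: "arc \<gamma>" "pathstart \<gamma> = vs ! 0" "pathfinish \<gamma> = vs ! k"
        "path_image \<gamma> = (\<Union>i<k. es ! i)" "\<forall>i<k. t i = 1 \<or> t i = -1"
        "\<And>z. z \<notin> (\<Union>i<k. es ! i) \<Longrightarrow> winding_number \<gamma> z = (\<Sum>i<k. t i * w (es ! i) z)"
      using Suc.IH k(1) by blast
    have "es ! i \<inter> es ! k \<subseteq> {vs ! k}" if i: "i < k" for i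
    proof -
      have "es ! i \<noteq> es ! k"
        using cycle_distinct[OF C] i k n(3) by (simp add: nth_eq_iff_index_eq)
      hence "es ! i \<inter> es ! k \<subseteq> {vs ! i, vs ! Suc i} \<inter> {vs ! k, vs ! Suc k}"
        using cycle_edges_Int[OF C, of i k] i k by simp
      moreover have "vs ! i \<noteq> vs ! Suc k" "vs ! Suc i \<noteq> vs ! Suc k"
        using i Suc.prems n(2) by (auto simp: nth_eq_iff_index_eq)
      ultimately show ?thesis by blast
    qed
    hence int: "path_image \<gamma> \<inter> path_image h \<subseteq> {pathstart h}"
      unfolding \<gamma>(4) h(2,3) by blast
    define t' where "t' = t(k := s)"
    have "arc (\<gamma> +++ h)"
      using arc_join[OF \<gamma>(1) h(1) _ int] \<gamma>(3) h(3) by simp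
    moreover have "path_image (\<gamma> +++ h) = (\<Union>i<Suc k. es ! i)"
      using \<gamma>(3,4) h(2,3) by (simp add: path_image_join lessThan_Suc Un_commute)
    moreover have "winding_number (\<gamma> +++ h) z = (\<Sum>i<Suc k. t' i * w (es ! i) z)"
      if z: "z \<notin> (\<Union>i<Suc k. es ! i)" for z
    proof -
      have z': "z \<notin> (\<Union>i<k. es ! i)" "z \<notin> es ! k"
        using z by (auto simp: lessThan_Suc)
      have "winding_number (\<gamma> +++ h) z = winding_number \<gamma> z + winding_number h z"
        using \<gamma>(1,3,4) h(1-3) z' by (intro winding_number_join) (auto intro: arc_imp_path)
      also have "\<dots> = (\<Sum>i<k. t' i * w (es ! i) z) + t' k * w (es ! k) z"
        unfolding \<gamma>(6)[OF z'(1)] h(6)[OF z'(2)] by (simp add: t'_def)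
      finally show ?thesis by simp
    qed
    moreover have "\<forall>i<Suc k. t' i = 1 \<or> t' i = -1"
      using \<gamma>(5) h(5) by (auto simp: t'_def less_Suc_eq)
    ultimately show ?thesis
      using \<gamma>(2) h(4) by (intro exI[of _ "\<gamma> +++ h"] exI[of _ t']) auto
  qed
qed simp

lemma cycle_loop:
  assumes C: "simple_cycle V E vs es"
  shows "\<exists>\<gamma> s. simple_path \<gamma> \<and> pathfinish \<gamma> = pathstart \<gamma> \<and> path_image \<gamma> = \<Union>(set es) \<and>
     (\<forall>e\<in>set es. s e = 1 \<or> s e = -1) \<and>
     (\<forall>z. z \<notin> \<Union>(set es) \<longrightarrow> winding_number \<gamma> z = (\<Sum>e\<in>set es. s e * w e z))"
proof -
  obtain k where k: "length vs = Suc k"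
    using C by (cases "length vs") (auto simp: simple_cycle_def)
  have n: "2 \<le> k" "distinct vs" "length es = Suc k"
    using C k by (auto simp: simple_cycle_def)
  have kk: "0 < k" "k < length vs" "Suc k mod length vs = 0"
    using n k by auto
  obtain h s where h: "arc h" "path_image h = es ! k" "pathstart h = vs ! k" "pathfinish h = vs ! 0"
      "s = 1 \<or> s = -1" "\<And>z. z \<notin> es ! k \<Longrightarrow> winding_number h z = s * w (es ! k) z"
    using oriented_edge[OF cycle_edge[OF C kk(2)]] unfolding kk(3) by blast
  obtain \<gamma> t where \<gamma>: "arc \<gamma>" "pathstart \<gamma> = vs ! 0" "pathfinish \<gamma> = vs ! k"
      "path_image \<gamma> = (\<Union>i<k. es ! i)" "\<forall>i<k. t i = 1 \<or> t i = -1"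
      "\<And>z. z \<notin> (\<Union>i<k. es ! i) \<Longrightarrow> winding_number \<gamma> z = (\<Sum>i<k. t i * w (es ! i) z)"
    using cycle_arc[OF C kk(1,2)] by blast
  have "es ! i \<inter> es ! k \<subseteq> {vs ! 0, vs ! k}" if i: "i < k" for i
  proof -
    have "es ! i \<noteq> es ! k"
      using cycle_distinct[OF C] i n(3) by (simp add: nth_eq_iff_index_eq)
    thus ?thesis
      using cycle_edges_Int[OF C, of i k] i kk by auto
  qed
  hence int: "path_image \<gamma> \<inter> path_image h \<subseteq> {pathstart \<gamma>, pathstart h}"
    unfolding \<gamma>(4,2) h(2,3) by blast
  define t' where "t' = t(k := s)"
  \<comment> \<open>The signs are transferred from positions to edges, which is possible because the
    edges of the cycle are distinct.\<close>
  define u where "u e = t' (the_inv_into {..<Suc k} ((!) es) e)" for e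
  have bij: "bij_betw ((!) es) {..<Suc k} (set es)"
    using bij_betw_nth[OF cycle_distinct[OF C] _ refl] n(3) by simp
  have u: "u (es ! i) = t' i" if "i < Suc k" for i
    unfolding u_def using the_inv_into_f_f[OF bij_betw_imp_inj_on[OF bij]] that by simp
  have img: "\<Union>(set es) = (\<Union>i<k. es ! i) \<union> es ! k"
    using bij_betw_imp_surj_on[OF bij] by (auto simp: lessThan_Suc)
  have "simple_path (\<gamma> +++ h)"
    using simple_path_join_loop[OF \<gamma>(1) h(1) _ _ int] \<gamma>(2,3) h(3,4) by simp
  moreover have "path_image (\<gamma> +++ h) = \<Union>(set es)"
    using \<gamma>(3,4) h(2,3) img by (simp add: path_image_join)
  moreover have "winding_number (\<gamma> +++ h) z = (\<Sum>e\<in>set es. u e * w e z)"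
    if z: "z \<notin> \<Union>(set es)" for z
  proof -
    have z': "z \<notin> (\<Union>i<k. es ! i)" "z \<notin> es ! k"
      using z img by auto
    have "winding_number (\<gamma> +++ h) z = winding_number \<gamma> z + winding_number h z"
      using \<gamma>(1,3,4) h(1-3) z' by (intro winding_number_join) (auto intro: arc_imp_path)
    also have "\<dots> = (\<Sum>i<k. t' i * w (es ! i) z) + t' k * w (es ! k) z"
      unfolding \<gamma>(6)[OF z'(1)] h(6)[OF z'(2)] by (simp add: t'_def)
    also have "\<dots> = (\<Sum>i<Suc k. u (es ! i) * w (es ! i) z)"
      by (simp add: u)
    also have "\<dots> = (\<Sum>e\<in>set es. u e * w e z)"
      by (rule sum.reindex_bij_betw[OF bij, of "\<lambda>e. u e * w e z"])
    finally show ?thesis .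
  qed
  moreover have "u e = 1 \<or> u e = -1" if e: "e \<in> set es" for e
  proof -
    obtain i where "i < Suc k" "e = es ! i"
      using e n(3) by (metis in_set_conv_nth)
    thus ?thesis
      using u[of i] \<gamma>(5) h(5) by (auto simp: t'_def less_Suc_eq)
  qed
  ultimately show ?thesis
    using \<gamma>(2) h(4) by (intro exI[of _ "\<gamma> +++ h"] exI[of _ u]) auto
qed

text \<open>A connected set that meets a set but avoids its frontier is contained in it. This
  applies in both directions to \<open>f\<close> and the Jordan side that it meets, as both have the
  same frontier.\<close>

lemma face_side:
  assumes f: "f \<in> F" and \<gamma>: "simple_path \<gamma>" "pathfinish \<gamma> = pathstart \<gamma>" "path_image \<gamma> = frontier f"
  shows "(f = inside (frontier f) \<or> f = outside (frontier f)) \<and>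
     inside (frontier f) \<noteq> {} \<and> outside (frontier f) \<noteq> {} \<and>
     open (inside (frontier f)) \<and> open (outside (frontier f)) \<and>
     connected (inside (frontier f)) \<and> connected (outside (frontier f)) \<and>
     frontier (inside (frontier f)) = frontier f \<and> frontier (outside (frontier f)) = frontier f"
proof -
  note J = Jordan_inside_outside[OF \<gamma>(1,2), unfolded \<gamma>(3)]
  have ff: "f \<inter> frontier f = {}"
    using open_face[OF f] by (auto simp: frontier_def interior_open)
  have side: "f = S" if S: "connected S" "open S" "S \<inter> frontier f = {}" "S \<inter> f \<noteq> {}" "frontier S = frontier f" for S
  proof
    show "S \<subseteq> f"
      using connected_Int_frontier[OF S(1,4)] S(3) by blast
    show "f \<subseteq> S"
      using connected_Int_frontier[OF connected_face[OF f], of S] S(4,5) ff by blast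
  qed
  have "inside (frontier f) \<inter> frontier f = {}" "outside (frontier f) \<inter> frontier f = {}"
    using inside_no_overlap outside_no_overlap by auto
  moreover have "f \<subseteq> inside (frontier f) \<union> outside (frontier f)"
    using ff inside_Un_outside[of "frontier f"] by blast
  hence "inside (frontier f) \<inter> f \<noteq> {} \<or> outside (frontier f) \<inter> f \<noteq> {}"
    using face_nonempty[OF f] by blast
  ultimately have "f = inside (frontier f) \<or> f = outside (frontier f)"
    using side J by metis
  thus ?thesis
    using J by simp
qed

lemma face_loop:
  assumes f: "f \<in> F"
  shows "\<exists>\<gamma>. simple_path \<gamma> \<and> pathfinish \<gamma> = pathstart \<gamma> \<and> path_image \<gamma> = frontier f"
proof -
  obtain vs es where C: "simple_cycle V E vs es" "frontier f = \<Union>(set es)"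
    using face_cycle[OF f] by (elim exE conjE)
  show ?thesis
    using cycle_loop[OF C(1)] unfolding C(2) by blast
qed

text \<open>The Jordan side other than \<open>f\<close> has the same frontier and lies off the
  closure of \<open>f\<close>. It provides the second face at an edge in
  \<open>card_sides\<close>.\<close>

lemma frontier_face_subset_closure_other:
  assumes f: "f \<in> F" and p: "p \<in> frontier f"
  shows "p \<in> closure (- closure f)"
proof -
  obtain \<gamma> where \<gamma>: "simple_path \<gamma>" "pathfinish \<gamma> = pathstart \<gamma>" "path_image \<gamma> = frontier f"
    using face_loop[OF f] by blast
  define A B where "A = inside (frontier f)" and "B = outside (frontier f)"
  note S = face_side[OF f \<gamma>, folded A_def B_def]
  have AB: "A \<inter> B = {}" "A \<inter> frontier f = {}" "B \<inter> frontier f = {}"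
    unfolding A_def B_def using inside_Int_outside inside_no_overlap outside_no_overlap by auto
  have fAB: "f = A \<or> f = B" and fr: "frontier A = frontier f" "frontier B = frontier f"
    using S by blast+
  obtain D where D: "D \<inter> f = {}" "D \<inter> frontier f = {}" "frontier D = frontier f"
  proof (cases "f = A")
    case True
    have "B \<inter> f = {}"
      using AB(1) unfolding True by blast
    then show ?thesis
      using that[of B] AB(3) fr(2) by blast
  next
    case False
    hence "A \<inter> f = {}"
      using AB(1) fAB by blast
    then show ?thesis
      using that[of A] AB(2) fr(1) by blast
  qed
  have "D \<subseteq> - closure f"
    using D(1,2) unfolding closure_Un_frontier by blast
  moreover have "p \<in> closure D"
    using p D(3) unfolding closure_Un_frontier by blast
  ultimately show ?thesis
    using closure_mono by blast
qed

text \<open>The potential is the winding number of the boundary loop of \<open>f\<close>, which is 0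
  outside and 1 or -1 inside, multiplied by the sign of \<open>e\<close> in the loop to make the
  coefficient at \<open>e\<close> equal to 1.\<close>

lemma face_potential:
  assumes f: "f \<in> F" and e: "e \<in> E" "e \<subseteq> frontier f"
  shows "\<exists>c \<alpha> \<beta>. c e = 1 \<and> \<alpha> \<noteq> \<beta> \<and> (\<forall>z\<in>f. (\<Sum>e\<in>E. c e * w e z) = \<alpha>) \<and>
     (\<forall>h\<in>F. h \<noteq> f \<longrightarrow> (\<forall>z\<in>h. (\<Sum>e\<in>E. c e * w e z) = \<beta>))"
proof -
  obtain vs es where C: "simple_cycle V E vs es" "frontier f = \<Union>(set es)"
    using face_cycle[OF f] by (elim exE conjE)
  obtain \<gamma> s where \<gamma>: "simple_path \<gamma>" "pathfinish \<gamma> = pathstart \<gamma>" "path_image \<gamma> = frontier f"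
      "\<forall>e\<in>set es. s e = 1 \<or> s e = -1"
      "\<And>z. z \<notin> frontier f \<Longrightarrow> winding_number \<gamma> z = (\<Sum>e\<in>set es. s e * w e z)"
    using cycle_loop[OF C(1)] unfolding C(2) by blast
  have es: "e \<in> set es" "set es \<subseteq> E"
    using frontier_edge_iff[OF C e(1)] e(2) C(1) by (auto simp: simple_cycle_def)
  have se: "s e * s e = 1" "s e \<noteq> 0"
    using \<gamma>(4) es by auto
  define c where "c e' = (if e' \<in> set es then s e * s e' else 0)" for e'
  have sum: "(\<Sum>e\<in>E. c e * w e z) = s e * winding_number \<gamma> z" if "z \<notin> frontier f" for z
  proof -
    have "(\<Sum>e\<in>E. c e * w e z) = (\<Sum>e'\<in>set es. s e * s e' * w e' z)"
      using es(2) finite_E by (intro sum.mono_neutral_cong_right) (auto simp: c_def)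
    thus ?thesis
      using \<gamma>(5)[OF that] by (simp add: sum_distrib_left mult.assoc)
  qed
  note S = face_side[OF f \<gamma>(1-3)]
  have out: "winding_number \<gamma> z = 0" if "z \<in> outside (frontier f)" for z
    using winding_number_zero_in_outside[of \<gamma> z] \<gamma>(1-3) that simple_path_imp_path by auto
  obtain i :: complex where i: "i \<noteq> 0" "\<And>z. z \<in> inside (frontier f) \<Longrightarrow> winding_number \<gamma> z = i"
    using simple_closed_path_winding_number_inside[OF \<gamma>(1)] unfolding \<gamma>(3)
    by (metis one_neq_neg_one zero_neq_neg_one zero_neq_one)
  have nofr: "h \<inter> frontier f = {}" if "h \<in> F" for h
  proof -
    have "frontier f \<subseteq> G"
      using C es by (auto simp: G_def)
    thus ?thesis
      using face_disjoint_G[OF that] by blast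
  qed
  have other: "h \<subseteq> inside (frontier f) \<union> outside (frontier f) - f" if "h \<in> F" "h \<noteq> f" for h
    using nofr[OF that(1)] faces_disjoint[OF that(1) f that(2)] inside_Un_outside[of "frontier f"]
    by blast
  have ce: "c e = 1"
    using es se by (simp add: c_def)
  show ?thesis
  proof (cases "f = inside (frontier f)")
    case True
    have 1: "(\<Sum>e\<in>E. c e * w e z) = s e * i" if "z \<in> f" for z
      using sum[of z] i(2)[of z] that True nofr[OF f] by auto
    have 2: "(\<Sum>e\<in>E. c e * w e z) = 0" if "h \<in> F" "h \<noteq> f" "z \<in> h" for h z
    proof -
      have "z \<notin> frontier f" "z \<in> outside (frontier f)"
        using nofr[OF that(1)] other[OF that(1,2)] that(3) True by auto
      thus ?thesis
        using sum[of z] out[of z] by simp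
    qed
    show ?thesis
      using ce 1 2 i(1) se(2) by (intro exI[of _ c] exI[of _ "s e * i"] exI[of _ 0]) auto
  next
    case False
    hence fo: "f = outside (frontier f)"
      using S by blast
    have 1: "(\<Sum>e\<in>E. c e * w e z) = 0" if "z \<in> f" for z
      using sum[of z] out[of z] that fo nofr[OF f] by auto
    have 2: "(\<Sum>e\<in>E. c e * w e z) = s e * i" if "h \<in> F" "h \<noteq> f" "z \<in> h" for h z
    proof -
      have "z \<notin> frontier f" "z \<in> inside (frontier f)"
        using nofr[OF that(1)] other[OF that(1,2)] that(3) fo by auto
      thus ?thesis
        using sum[of z] i(2)[of z] by simp
    qed
    show ?thesis
      using ce 1 2 i(1) se(2) by (intro exI[of _ c] exI[of _ 0] exI[of _ "s e * i"]) auto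
  qed
qed

text \<open>The other edges avoid \<open>p\<close>, so only the term of \<open>e\<close> could be
  discontinuous there.\<close>

lemma continuous_sum_w:
  assumes "e \<in> E" "p \<in> e - V" "c e = 0"
  shows "continuous (at p) (\<lambda>z. \<Sum>e\<in>E. c e * w e z)"
proof -
  have "continuous (at p) (\<lambda>z. c e' * w e' z)" if "e' \<in> E" for e'
  proof (cases "e' = e")
    case False
    hence "p \<notin> e'"
      using edges_Int[OF assms(1) that] assms(2) by blast
    thus ?thesis
      using continuous_w[OF that] by (intro continuous_intros)
  qed (use assms(3) in simp)
  thus ?thesis
    by (intro continuous_sum) auto
qed

lemma edge_in_closure:
  assumes "e \<subseteq> frontier f" "p \<in> e"
  shows "p \<in> closure f"
  using assms by (auto simp: frontier_def)

text \<open>The potentials of two faces on \<open>e\<close> both jump across \<open>e\<close>, but their difference is continuous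
  there.\<close>

lemma no_three_faces:
  assumes e: "e \<in> E" and f: "f \<in> F" "g \<in> F" "h \<in> F" "f \<noteq> g" "f \<noteq> h" "g \<noteq> h"
    and fr: "e \<subseteq> frontier f" "e \<subseteq> frontier g" "e \<subseteq> frontier h"
  shows False
proof -
  obtain p where p: "p \<in> e - V"
    using edge_interior_nonempty[OF e] by blast
  obtain c1 a1 b1 where 1: "c1 e = 1" "a1 \<noteq> b1" "\<forall>z\<in>f. (\<Sum>e\<in>E. c1 e * w e z) = a1"
      "\<forall>h\<in>F. h \<noteq> f \<longrightarrow> (\<forall>z\<in>h. (\<Sum>e\<in>E. c1 e * w e z) = b1)"
    using face_potential[OF f(1) e fr(1)] by (elim exE conjE)
  obtain c2 a2 b2 where 2: "c2 e = 1" "a2 \<noteq> b2" "\<forall>z\<in>g. (\<Sum>e\<in>E. c2 e * w e z) = a2"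
      "\<forall>h\<in>F. h \<noteq> g \<longrightarrow> (\<forall>z\<in>h. (\<Sum>e\<in>E. c2 e * w e z) = b2)"
    using face_potential[OF f(2) e fr(2)] by (elim exE conjE)
  define D where "D z = (\<Sum>e\<in>E. (c1 e - c2 e) * w e z)" for z
  have D: "D z = (\<Sum>e\<in>E. c1 e * w e z) - (\<Sum>e\<in>E. c2 e * w e z)" for z
    by (simp add: D_def left_diff_distrib sum_subtractf)
  have cont: "continuous (at p) D"
    unfolding D_def by (rule continuous_sum_w[OF e p]) (use 1 2 in simp)
  have "D p = a1 - b2"
  proof (rule constant_near_closure[OF cont])
    show "D z = a1 - b2" if "z \<in> f" for z
      using 1(3) 2(4) f that unfolding D by simp
    show "p \<in> closure f"
      using edge_in_closure fr(1) p by blast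
  qed
  \<comment> \<open>The third face lies on the far side for both potentials, so it shows a value
    other than the one seen from \<open>f\<close>.\<close>
  moreover have "D p = b1 - b2"
  proof (rule constant_near_closure[OF cont])
    show "D z = b1 - b2" if "z \<in> h" for z
      using 1(4) 2(4) f that unfolding D by simp
    show "p \<in> closure h"
      using edge_in_closure fr(3) p by blast
  qed
  ultimately show False
    using 1(2) by simp
qed

section \<open>The two sides of an edge and the connectedness of the dual graph\<close>

definition sides :: "complex set \<Rightarrow> complex set set" where
  "sides e = {f\<in>F. e \<subseteq> frontier f}"

lemma finite_sides: "e \<in> E \<Longrightarrow> finite (sides e)"
proof (rule ccontr)
  assume e: "e \<in> E" and inf: "infinite (sides e)"
  then obtain S where "S \<subseteq> sides e" "card S = 3"
    using infinite_arbitrarily_large by (metis (no_types))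
  then obtain f g h where "S = {f, g, h}" "f \<noteq> g" "f \<noteq> h" "g \<noteq> h"
    by (auto simp: card_3_iff)
  thus False
    using no_three_faces[OF e, of f g h] \<open>S \<subseteq> sides e\<close> by (auto simp: sides_def)
qed

lemma face_has_edge:
  assumes "f \<in> F"
  shows "\<exists>e\<in>E. e \<subseteq> frontier f"
proof -
  obtain vs es where C: "simple_cycle V E vs es" "frontier f = \<Union>(set es)"
    using face_cycle[OF assms] by (elim exE conjE)
  hence "es \<noteq> []" "set es \<subseteq> E"
    by (auto simp: simple_cycle_def)
  hence "hd es \<in> set es" "set es \<subseteq> E"
    by simp_all
  thus ?thesis
    using C(2) by blast
qed

lemma finite_F: "finite F"
proof (rule finite_subset)
  show "F \<subseteq> (\<Union>e\<in>E. sides e)"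
    using face_has_edge by (auto simp: sides_def)
  show "finite (\<Union>e\<in>E. sides e)"
    using finite_E finite_sides by blast
qed

lemma closure_faces: "S \<subseteq> F \<Longrightarrow> closure (\<Union>S) = (\<Union>f\<in>S. closure f)"
proof -
  assume "S \<subseteq> F"
  hence "finite S"
    using finite_subset[OF _ finite_F] by blast
  thus ?thesis
    by (induction S rule: finite_induct) (auto simp: closure_Un)
qed

lemma edge_has_side:
  assumes e: "e \<in> E" and S: "S \<subseteq> F" and p: "p \<in> e - V" "p \<in> closure (\<Union>S)"
  shows "\<exists>f\<in>S. e \<subseteq> frontier f"
proof -
  obtain f where "f \<in> S" "p \<in> closure f"
    using p closure_faces[OF S] by blast
  thus ?thesis
    using closure_face_edge[OF _ e p(1)] S by blast
qed

lemma near_edge_closure: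
  assumes e: "e \<in> E" and p: "p \<in> e - V" and D: "open D" "p \<in> closure D" "D \<inter> e = {}"
  shows "p \<in> closure (D - G)"
proof -
  obtain r where r: "r > 0" "ball p r \<inter> G \<subseteq> e"
    using ball_near_edge[OF e p] by blast
  have "p \<in> closure (ball p r \<inter> D)"
    using open_Int_closure_subset[of "ball p r" D] r D by auto
  moreover have "ball p r \<inter> D \<subseteq> D - G"
    using r D by blast
  ultimately show ?thesis
    using closure_mono by blast
qed

text \<open>An arc has empty interior, so some face reaches its inner points. The other Jordan side
  of this face leads to a second one, and \<open>no_three_faces\<close> excludes a third.\<close>

lemma card_sides:
  assumes e: "e \<in> E"
  shows "card (sides e) = 2"
proof -
  obtain p where p: "p \<in> e - V"
    using edge_interior_nonempty[OF e] by blast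
  have "interior e = {}"
    using interior_arc_image_empty[OF arc_gp[OF e]] image_gp[OF e] by simp
  hence "p \<in> closure (- e)"
    by (simp add: closure_interior)
  hence "p \<in> closure (- e - G)"
    using near_edge_closure[OF e p, of "- e"] compact_imp_closed[OF compact_edge[OF e]] by auto
  moreover have "- e - G \<subseteq> \<Union>F"
    using Union_faces by blast
  ultimately obtain f where f: "f \<in> F" "e \<subseteq> frontier f"
    using edge_has_side[OF e subset_refl p] closure_mono by blast
  have "p \<in> closure (- closure f)"
    using frontier_face_subset_closure_other[OF f(1)] f(2) p by blast
  moreover have "- closure f \<inter> e = {}"
    using f(2) by (auto simp: frontier_def)
  ultimately have "p \<in> closure (- closure f - G)"
    using near_edge_closure[OF e p, of "- closure f"] by auto
  moreover have "- closure f - G \<subseteq> \<Union>(F - {f})"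
    using Union_faces closure_subset[of f] by blast
  ultimately obtain g where g: "g \<in> F - {f}" "e \<subseteq> frontier g"
    using edge_has_side[OF e _ p, of "F - {f}"] closure_mono by blast
  have "sides e = {f, g}"
    using no_three_faces[OF e f(1), of g] f g by (auto simp: sides_def)
  moreover have "f \<noteq> g"
    using g(1) by blast
  ultimately show ?thesis
    by (simp only: card_2_iff) blast
qed

text \<open>The plane minus the finite set \<open>V\<close> is connected and is covered by the
  closures of the two unions of faces. A common point of these closures off \<open>V\<close> is
  inner to an edge, which then has one side in each class.\<close>

lemma faces_connected:
  assumes X: "X \<subseteq> F" "X \<noteq> {}" "X \<noteq> F"
  shows "\<exists>e\<in>E. sides e \<inter> X \<noteq> {} \<and> \<not> sides e \<subseteq> X"
proof (rule ccontr)
  assume "\<not> ?thesis"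
  hence no: "\<And>e. e \<in> E \<Longrightarrow> sides e \<inter> X = {} \<or> sides e \<subseteq> X"
    by blast
  define A where "A = closure (\<Union>X)"
  define B where "B = closure (\<Union>(F - X))"
  have "connected (UNIV - V)"
    using finite_V by (intro connected_open_diff_countable) (auto intro: countable_finite)
  moreover have "A \<inter> B \<inter> (UNIV - V) = {}"
  proof -
    have "False" if z: "z \<in> A" "z \<in> B" "z \<notin> V" for z
    proof -
      obtain f g where fg: "f \<in> X" "z \<in> closure f" "g \<in> F - X" "z \<in> closure g"
        using z closure_faces[of X] closure_faces[of "F - X"] X unfolding A_def B_def by blast
      have fF: "f \<in> F" "g \<in> F" "f \<noteq> g"
        using fg X by auto
      have "z \<notin> f" "z \<notin> g"
        using fg faces_disjoint[OF fF] open_Int_closure_eq_empty[OF open_face[OF fF(1)], of g]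
          open_Int_closure_eq_empty[OF open_face[OF fF(2)], of f] by blast+
      have "z \<in> frontier f"
        using fg \<open>z \<notin> f\<close> open_face[OF fF(1)] by (simp add: frontier_def interior_open)
      moreover obtain vs es where C: "simple_cycle V E vs es" "frontier f = \<Union>(set es)"
        using face_cycle[OF fF(1)] by (elim exE conjE)
      ultimately obtain e where e: "e \<in> E" "z \<in> e"
        by (auto simp: simple_cycle_def)
      have "f \<in> sides e" "g \<in> sides e"
        using closure_face_edge[OF fF(1) e(1)] closure_face_edge[OF fF(2) e(1)] e fg z fF
        by (auto simp: sides_def)
      thus False
        using no[OF e(1)] fg by blast
    qed
    thus ?thesis by blast
  qed
  moreover have "UNIV - V \<subseteq> A \<union> B"
  proof
    fix z assume z: "z \<in> UNIV - V"
    have "z \<in> closure (\<Union>F)"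
    proof (cases "z \<in> G")
      case False
      then show ?thesis
        using Union_faces closure_subset by blast
    next
      case True
      then obtain e where e: "e \<in> E" "z \<in> e"
        using z by (auto simp: G_def)
      have "sides e \<noteq> {}"
        using card_sides[OF e(1)] by auto
      then obtain f where "f \<in> F" "z \<in> closure f"
        using edge_in_closure e by (auto simp: sides_def)
      thus ?thesis
        using closure_faces by blast
    qed
    moreover have U: "\<Union>F = \<Union>X \<union> \<Union>(F - X)"
      using X by blast
    ultimately have "z \<in> closure (\<Union>X \<union> \<Union>(F - X))"
      by (simp only: U)
    thus "z \<in> A \<union> B"
      unfolding A_def B_def closure_Un .
  qed
  ultimately have AB: "A \<inter> (UNIV - V) = {} \<or> B \<inter> (UNIV - V) = {}"
    unfolding connected_closed A_def B_def by (metis closed_closure)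
  have mem: "\<exists>z. z \<in> f \<and> z \<in> UNIV - V" if "f \<in> F" for f
    using face_disjoint_G[OF that] face_nonempty[OF that] by (auto simp: G_def)
  obtain f g where fg: "f \<in> X" "g \<in> F - X"
    using X by blast
  hence "f \<in> F" "g \<in> F"
    using X(1) by blast+
  then obtain x y where "x \<in> f" "x \<in> UNIV - V" "y \<in> g" "y \<in> UNIV - V"
    using mem by meson
  moreover have "f \<subseteq> A" "g \<subseteq> B"
    unfolding A_def B_def
    by (rule subset_trans[OF Union_upper closure_subset], rule fg)+
  ultimately show False
    using AB by blast
qed

text \<open>On a small ball, each \<open>w e\<close> changes by a difference of logarithms belonging
  to the two ends of \<open>e\<close>. Collected by vertices, the terms cancel by conservation of
  the flow.\<close>

lemma flow_potential_constant:
  assumes flow: "\<And>v. v \<in> V \<Longrightarrow>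
      (\<Sum>e\<in>E. k e * (of_bool (pathfinish (gp e) = v) - of_bool (pathstart (gp e) = v))) = 0"
    and f: "f \<in> F"
  shows "(\<lambda>z. \<Sum>e\<in>E. k e * w e z) constant_on f"
proof (rule locally_constant_imp_constant[OF connected_face[OF f]])
  fix z0 assume z0: "z0 \<in> f"
  have z0G: "z0 \<in> - G"
    using face_disjoint_G[OF f] z0 by blast
  then obtain r where r: "r > 0" "ball z0 r \<subseteq> - G" "ball z0 r \<subseteq> f"
    using open_face[OF f] face_disjoint_G[OF f] z0 openE by (metis disjoint_eq_subset_Compl order_trans)
  have "(\<Sum>e\<in>E. k e * w e z) = (\<Sum>e\<in>E. k e * w e z0)" if z: "z \<in> ball z0 r" for z
  proof -
    define L where "L v = Ln ((v - z) / (v - z0))" for v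
    have "2 * of_real pi * \<i> * (w e z - w e z0) =
        (\<Sum>v\<in>V. (of_bool (pathfinish (gp e) = v) - of_bool (pathstart (gp e) = v)) * L v)"
      if e: "e \<in> E" for e
    proof -
      have "e \<subseteq> G"
        using e by (auto simp: G_def)
      hence "ball z0 r \<inter> path_image (gp e) = {}"
        using r(2) image_gp[OF e] by blast
      hence "2 * of_real pi * \<i> * (w e z - w e z0) = L (pathfinish (gp e)) - L (pathstart (gp e))"
        using winding_number_diff_Ln[OF path_gp[OF e] _ z] by (simp add: L_def)
      moreover have "pathfinish (gp e) \<in> V" "pathstart (gp e) \<in> V"
        using ends_gp[OF e] ends_subset_V[of e] by auto
      moreover have "(\<Sum>v\<in>V. of_bool (u = v) * L v) = L u" if "u \<in> V" for u
        using that finite_V by (simp add: of_bool_def if_distrib[of "\<lambda>x. x * _"] cong: if_cong)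
      ultimately show ?thesis
        by (simp add: left_diff_distrib sum_subtractf)
    qed
    hence "2 * of_real pi * \<i> * (\<Sum>e\<in>E. k e * (w e z - w e z0)) =
       (\<Sum>e\<in>E. k e * (\<Sum>v\<in>V. (of_bool (pathfinish (gp e) = v) - of_bool (pathstart (gp e) = v)) * L v))"
      by (subst sum_distrib_left, intro sum.cong) (simp_all add: mult.left_commute[of _ "k _"])
    also have "\<dots> = (\<Sum>v\<in>V. (\<Sum>e\<in>E. k e * (of_bool (pathfinish (gp e) = v) - of_bool (pathstart (gp e) = v))) * L v)"
      by (subst sum_distrib_right, subst sum.swap) (simp add: sum_distrib_left mult.assoc)
    also have "\<dots> = 0"
      using flow by simp
    finally show ?thesis
      by (simp add: right_diff_distrib sum_subtractf)
  qed
  moreover have "openin (top_of_set f) (ball z0 r)" "z0 \<in> ball z0 r"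
    using open_subset[OF r(3) open_ball] r(1) by simp_all
  ultimately show "\<exists>T. openin (top_of_set f) T \<and> z0 \<in> T \<and>
      (\<forall>x\<in>T. (\<Sum>e\<in>E. k e * w e x) = (\<Sum>e\<in>E. k e * w e z0))"
    by blast
qed

text \<open>A flow whose potential takes the same value on all faces vanishes, because its potential
  jumps across an edge by the flow through this edge. Counting unknowns and equations gives Euler's
  inequality.\<close>

lemma euler_inequality: "card E + 2 \<le> card V + card F"
proof (rule ccontr)
  assume less: "\<not> ?thesis"
  obtain v0 where v0: "v0 \<in> V"
    using conn by (auto simp: graph_connected_def)
  obtain f0 where f0: "f0 \<in> F"
    using faces_exist by blast
  define z where "z f = (SOME x. x \<in> f)" for f :: "complex set"
  have z: "z f \<in> f" if "f \<in> F" for f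
    unfolding z_def using face_nonempty[OF that] by (simp add: some_in_eq)
  define b :: "complex set \<Rightarrow> complex \<Rightarrow> complex" where
    "b e v = of_bool (pathfinish (gp e) = v) - of_bool (pathstart (gp e) = v)" for e v
  \<comment> \<open>The conservation laws add up to zero over all vertices, so the one at
    \<open>v0\<close> follows from the rest; the faces are compared with \<open>f0\<close>. This
    gives (V - 1) + (F - 1) equations for E unknowns.\<close>
  define I where "I = Inl ` (V - {v0}) \<union> Inr ` (F - {f0})"
  define a where "a i e = (case i of Inl v \<Rightarrow> b e v | Inr f \<Rightarrow> w e (z f) - w e (z f0))" for i e
  have finI: "finite I"
    using finite_V finite_F by (simp add: I_def)
  have "card I = card (V - {v0}) + card (F - {f0})"
    unfolding I_def using finite_V finite_F
    by (subst card_Un_disjoint) (auto simp: card_image)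
  also have "\<dots> = (card V - 1) + (card F - 1)"
    using v0 f0 by simp
  also have "\<dots> < card E"
  proof -
    have "0 < card V" "0 < card F"
      using v0 f0 finite_V finite_F by (auto simp: card_gt_0_iff)
    thus ?thesis
      using less by linarith
  qed
  finally obtain k where k: "\<exists>e\<in>E. k e \<noteq> 0" "\<forall>i\<in>I. (\<Sum>e\<in>E. a i e * k e) = 0"
    using homogeneous_system_nontrivial_solution[OF finI finite_E, of a] by blast
  have flow': "(\<Sum>e\<in>E. k e * b e v) = 0" if v: "v \<in> V - {v0}" for v
    using bspec[OF k(2), of "Inl v"] v by (auto simp: I_def a_def mult.commute)
  have "(\<Sum>v\<in>V. \<Sum>e\<in>E. k e * b e v) = (\<Sum>e\<in>E. k e * (\<Sum>v\<in>V. b e v))"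
    by (subst sum.swap) (simp add: sum_distrib_left)
  also have "\<dots> = 0"
  proof -
    have "(\<Sum>v\<in>V. b e v) = 0" if e: "e \<in> E" for e
    proof -
      have "pathfinish (gp e) \<in> V" "pathstart (gp e) \<in> V"
        using ends_gp[OF e] ends_subset_V[of e] by auto
      thus ?thesis
        using finite_V by (simp add: b_def sum_subtractf of_bool_def)
    qed
    thus ?thesis by simp
  qed
  finally have "(\<Sum>e\<in>E. k e * b e v0) + (\<Sum>v\<in>V - {v0}. \<Sum>e\<in>E. k e * b e v) = 0"
    by (simp add: sum.remove[OF finite_V v0])
  hence flow: "(\<Sum>e\<in>E. k e * b e v) = 0" if "v \<in> V" for v
    using flow' that by (cases "v = v0") auto
  define N where "N x = (\<Sum>e\<in>E. k e * w e x)" for x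
  have const: "N constant_on f" if "f \<in> F" for f
    unfolding N_def by (rule flow_potential_constant[OF _ that]) (use flow in \<open>simp add: b_def\<close>)
  have Nz: "N (z f) = N (z f0)" if f: "f \<in> F" for f
  proof (cases "f = f0")
    case False
    hence "(\<Sum>e\<in>E. a (Inr f) e * k e) = 0"
      using k(2) f by (auto simp: I_def)
    thus ?thesis
      by (simp add: a_def N_def algebra_simps sum_subtractf)
  qed simp
  have NF: "N x = N (z f0)" if "f \<in> F" "x \<in> f" for f x
    using const[OF that(1)] z[OF that(1)] that(2) Nz[OF that(1)] unfolding constant_on_def by metis
  have "k e = 0" if e: "e \<in> E" for e
  proof -
    obtain p where p: "p \<in> e - V"
      using edge_interior_nonempty[OF e] by blast
    obtain f g where fg: "sides e = {f, g}" "f \<noteq> g"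
      using card_sides[OF e] unfolding card_2_iff by (elim exE conjE)
    have "f \<in> sides e" "g \<in> sides e"
      unfolding fg by simp_all
    hence f: "f \<in> F" "e \<subseteq> frontier f" and g: "g \<in> F" "e \<subseteq> frontier g"
      by (simp_all add: sides_def)
    obtain c \<alpha> \<beta> where c: "c e = 1" "\<alpha> \<noteq> \<beta>" "\<forall>z\<in>f. (\<Sum>e\<in>E. c e * w e z) = \<alpha>"
        "\<forall>h\<in>F. h \<noteq> f \<longrightarrow> (\<forall>z\<in>h. (\<Sum>e\<in>E. c e * w e z) = \<beta>)"
      using face_potential[OF f(1) e f(2)] by (elim exE conjE)
    \<comment> \<open>The terms with \<open>w e\<close> cancel, so \<open>D\<close> is continuous at
      \<open>p\<close>. Its values seen from \<open>f\<close> and from \<open>g\<close> then agree,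
      although the potential of \<open>f\<close> differs on the two faces; hence
      \<open>k e = 0\<close>.\<close>
    define D where "D x = (\<Sum>e'\<in>E. (k e' - k e * c e') * w e' x)" for x
    have D: "D x = N x - k e * (\<Sum>e\<in>E. c e * w e x)" for x
      by (simp add: D_def N_def left_diff_distrib sum_subtractf sum_distrib_left mult.assoc)
    have cont: "continuous (at p) D"
      unfolding D_def by (rule continuous_sum_w[OF e p]) (use c(1) in simp)
    have "D p = N (z f0) - k e * \<alpha>"
    proof (rule constant_near_closure[OF cont])
      show "D x = N (z f0) - k e * \<alpha>" if "x \<in> f" for x
        using c(3) that NF[OF f(1) that] unfolding D by simp
    qed (use edge_in_closure[OF f(2)] p in blast)
    moreover have "D p = N (z f0) - k e * \<beta>"
    proof (rule constant_near_closure[OF cont])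
      show "D x = N (z f0) - k e * \<beta>" if "x \<in> g" for x
        using c(4) g fg(2) that NF[OF g(1) that] unfolding D by auto
    qed (use edge_in_closure[OF g(2)] p in blast)
    ultimately show ?thesis
      using c(2) by simp
  qed
  thus False
    using k(1) by blast
qed

end

section \<open>The sphere of flags\<close>

lemma cyclic_induct:
  assumes "i < n" "Q i" "\<And>j. j < n \<Longrightarrow> Q j \<Longrightarrow> Q (Suc j mod n)" "k < n"
  shows "Q k"
proof -
  have *: "Q ((i + d) mod n)" for d
  proof (induction d)
    case (Suc d)
    have "Suc ((i + d) mod n) mod n = (i + Suc d) mod n"
      by (simp add: mod_Suc_eq)
    thus ?case
      using assms(3)[of "(i + d) mod n"] Suc assms(1) by simp
  qed (use assms in simp)
  have "(i + (k + n - i)) mod n = k"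
    using assms(1,4) by simp
  thus ?thesis
    using * by metis
qed

context cycle_faced_plane_graph
begin

section \<open>Corners of faces and connectivity of the graph\<close>

lemma sides_subset: "sides e \<subseteq> F"
  by (auto simp: sides_def)

lemma face_cycle_sides:
  assumes "f \<in> F"
  shows "\<exists>vs es. simple_cycle V E vs es \<and> set es = {e\<in>E. f \<in> sides e} \<and> frontier f = \<Union>(set es)"
proof -
  obtain vs es where C: "simple_cycle V E vs es" "frontier f = \<Union>(set es)"
    using face_cycle[OF assms] by (elim exE conjE)
  have "set es = {e\<in>E. f \<in> sides e}"
    using frontier_edge_iff[OF C] C(1) assms by (auto simp: sides_def simple_cycle_def)
  thus ?thesis
    using C by blast
qed

definition corner :: "complex \<Rightarrow> complex set \<Rightarrow> bool" where
  "corner v f \<longleftrightarrow> (\<exists>e\<in>E. v \<in> ends V e \<and> f \<in> sides e)"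

lemma frontier_vertex_iff:
  assumes "f \<in> F" "v \<in> V"
  shows "v \<in> frontier f \<longleftrightarrow> corner v f"
proof -
  obtain vs es where C: "set es = {e\<in>E. f \<in> sides e}" "frontier f = \<Union>(set es)"
    using face_cycle_sides[OF assms(1)] by (elim exE conjE)
  show ?thesis
    unfolding C(2) C(1) corner_def using assms(2) by (auto simp: ends_def)
qed

lemma corner_mem: "corner v f \<Longrightarrow> v \<in> V \<and> f \<in> F"
  using ends_subset_V sides_subset unfolding corner_def by blast

text \<open>The boundary cycle of \<open>f\<close> passes \<open>v\<close> once, at position
  \<open>j\<close>; the two edges are those at \<open>j\<close> and at its cyclic predecessor
  \<open>k\<close>.\<close>

lemma card_corner_edges:
  assumes "corner v f"
  shows "card {e\<in>E. v \<in> ends V e \<and> f \<in> sides e} = 2"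
proof -
  obtain vs es where C: "simple_cycle V E vs es" "set es = {e\<in>E. f \<in> sides e}"
    using face_cycle_sides corner_mem[OF assms] by blast
  let ?n = "length vs"
  have n: "3 \<le> ?n" "distinct vs" "length es = ?n"
    using C(1) by (auto simp: simple_cycle_def)
  obtain e where "e \<in> set es" "v \<in> ends V e"
    using assms C(2) unfolding corner_def by blast
  then obtain i where i: "i < ?n" "v \<in> ends V (es ! i)"
    using n(3) by (metis in_set_conv_nth)
  have lt: "Suc i mod ?n < ?n" for i
    using n(1) by (auto intro: mod_less_divisor)
  obtain j where j: "j < ?n" "v = vs ! j"
    using cycle_edge(2)[OF C(1) i(1)] i lt[of i] by auto
  define k where "k = (if j = 0 then ?n - 1 else j - 1)"
  have k: "k < ?n" "k \<noteq> j" "Suc i mod ?n = j \<longleftrightarrow> i = k" if "i < ?n" for i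
    using n(1) j that by (auto simp: k_def mod_Suc)
  have mem: "v \<in> ends V (es ! i) \<longleftrightarrow> i = j \<or> i = k" if "i < ?n" for i
    unfolding cycle_edge(2)[OF C(1) that] j(2)
    using nth_eq_iff_index_eq[OF n(2) j(1) that] nth_eq_iff_index_eq[OF n(2) j(1) lt[of i]] k(3)[OF that]
    by auto
  have "{e\<in>E. v \<in> ends V e \<and> f \<in> sides e} = {e \<in> set es. v \<in> ends V e}"
    unfolding C(2) by blast
  also have "\<dots> = (!) es ` {i. i < ?n \<and> v \<in> ends V (es ! i)}"
    unfolding n(3)[symmetric] set_conv_nth by blast
  also have "{i. i < ?n \<and> v \<in> ends V (es ! i)} = {j, k}"
    using mem j(1) k(1)[OF j(1)] by blast
  also have "(!) es ` {j, k} = {es ! j, es ! k}"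
    by simp
  finally have eq: "{e\<in>E. v \<in> ends V e \<and> f \<in> sides e} = {es ! j, es ! k}" .
  have "es ! j \<noteq> es ! k"
    using cycle_distinct[OF C(1)] n(3) j(1) k(1,2)[OF j(1)] by (simp add: nth_eq_iff_index_eq)
  thus ?thesis
    unfolding eq by simp
qed

lemma edges_nonempty: "E \<noteq> {}"
  using faces_exist face_has_edge by blast

lemma vertex_has_edge:
  assumes "v \<in> V"
  shows "\<exists>e\<in>E. v \<in> ends V e"
proof -
  obtain e where e: "e \<in> E"
    using edges_nonempty by blast
  then obtain u where u: "u \<in> ends V e"
    using card_ends[OF e] by fastforce
  hence "(adjacent V E)\<^sup>*\<^sup>* v u"
    using conn assms ends_subset_V unfolding graph_connected_def by blast
  thus ?thesis
  proof (cases rule: converse_rtranclpE)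
    case base
    then show ?thesis using e u by blast
  next
    case (step y)
    then show ?thesis by (auto simp: adjacent_def)
  qed
qed

lemma vertex_connected:
  assumes "A \<noteq> {}" "A \<subseteq> V" "\<And>e. e \<in> E \<Longrightarrow> ends V e \<inter> A \<noteq> {} \<Longrightarrow> ends V e \<subseteq> A"
  shows "A = V"
proof -
  obtain u where u: "u \<in> A"
    using assms(1) by blast
  have "v \<in> A" if "v \<in> V" for v
  proof -
    have "(adjacent V E)\<^sup>*\<^sup>* u v"
      using conn u assms(2) that unfolding graph_connected_def by blast
    thus ?thesis
    proof (induction rule: rtranclp_induct)
      case (step y z)
      then obtain e where e: "e \<in> E" "ends V e = {y, z}"
        unfolding adjacent_def by blast
      show ?case
        using assms(3)[OF e(1)] step.IH unfolding e(2) by blast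
    qed (rule u)
  qed
  thus ?thesis
    using assms(2) by blast
qed

text \<open>A triangle of the barycentric subdivision of \<open>G\<close>, which has the vertices
  \<open>entities\<close> and the edges \<open>incidences\<close>. The subdivision contains
  \<open>G\<close>, its dual and the vertex-face pairs at the same time.\<close>

definition flag :: "complex \<Rightarrow> complex set \<Rightarrow> complex set \<Rightarrow> entity set" where
  "flag v e f = {Vertex v, Edge e, Face f}"

definition flags :: "entity set set" where
  "flags = {flag v e f | v e f. e \<in> E \<and> v \<in> ends V e \<and> f \<in> sides e}"

definition incidences :: "entity set set" where
  "incidences = {{Vertex v, Edge e} | v e. e \<in> E \<and> v \<in> ends V e} \<union>
     {{Edge e, Face f} | e f. e \<in> E \<and> f \<in> sides e} \<union> {{Vertex v, Face f} | v f. corner v f}"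

definition entities :: "entity set" where
  "entities = Vertex ` V \<union> Edge ` E \<union> Face ` F"

lemma flag_inject: "flag v e f = flag v' e' f' \<longleftrightarrow> v = v' \<and> e = e' \<and> f = f'"
  by (auto simp: flag_def)

lemma flag_mem: "flag v e f \<in> flags \<longleftrightarrow> e \<in> E \<and> v \<in> ends V e \<and> f \<in> sides e"
  by (auto simp: flags_def flag_inject)

lemma finite_ends: "finite (ends V e)"
  using finite_V by (simp add: ends_def)

lemma card_flags_on:
  assumes "E' \<subseteq> E"
  shows "card {flag v e f | v e f. e \<in> E' \<and> v \<in> ends V e \<and> f \<in> sides e} = 4 * card E'"
proof -
  have "{flag v e f | v e f. e \<in> E' \<and> v \<in> ends V e \<and> f \<in> sides e} =
      (\<lambda>(e, v, f). flag v e f) ` (SIGMA e:E'. ends V e \<times> sides e)"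
    by auto
  moreover have "inj_on (\<lambda>(e, v, f). flag v e f) (SIGMA e:E'. ends V e \<times> sides e)"
    by (auto simp: inj_on_def flag_inject)
  ultimately have "card {flag v e f | v e f. e \<in> E' \<and> v \<in> ends V e \<and> f \<in> sides e} =
      card (SIGMA e:E'. ends V e \<times> sides e)"
    by (simp add: card_image)
  also have "\<dots> = (\<Sum>e\<in>E'. card (ends V e \<times> sides e))"
    using finite_subset[OF assms finite_E] finite_ends finite_sides assms
    by (intro card_SigmaI) auto
  also have "\<dots> = (\<Sum>e\<in>E'. 4)"
    using assms by (intro sum.cong refl) (auto simp: card_cartesian_product card_ends card_sides)
  finally show ?thesis by simp
qed

lemma card_flags: "card flags = 4 * card E"
  using card_flags_on[OF order_refl] by (simp add: flags_def)

lemma flags_over_vertex_edge: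
  "e \<in> E \<Longrightarrow> v \<in> ends V e \<Longrightarrow> {t\<in>flags. {Vertex v, Edge e} \<subseteq> t} = flag v e ` sides e"
  by (auto simp: flags_def flag_def)

lemma flags_over_edge_face:
  "e \<in> E \<Longrightarrow> f \<in> sides e \<Longrightarrow> {t\<in>flags. {Edge e, Face f} \<subseteq> t} = (\<lambda>v. flag v e f) ` ends V e"
  by (auto simp: flags_def flag_def)

lemma flags_over_corner:
  "{t\<in>flags. {Vertex v, Face f} \<subseteq> t} =
     (\<lambda>e. flag v e f) ` {e\<in>E. v \<in> ends V e \<and> f \<in> sides e}"
  by (auto simp: flags_def flag_def)

lemma card_flags_over:
  assumes "p \<in> incidences"
  shows "card {t\<in>flags. p \<subseteq> t} = 2"
  using assms unfolding incidences_def
  by (auto simp: flags_over_vertex_edge flags_over_edge_face flags_over_corner card_image inj_on_def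
      flag_inject card_sides card_ends card_corner_edges simp del: insert_subset)

lemma incidences_in_flag:
  assumes "e \<in> E" "v \<in> ends V e" "f \<in> sides e"
  shows "{p\<in>incidences. p \<subseteq> flag v e f} = {{Vertex v, Edge e}, {Edge e, Face f}, {Vertex v, Face f}}"
proof
  show "{p\<in>incidences. p \<subseteq> flag v e f} \<subseteq> {{Vertex v, Edge e}, {Edge e, Face f}, {Vertex v, Face f}}"
  proof
    fix p assume "p \<in> {p\<in>incidences. p \<subseteq> flag v e f}"
    hence p: "p \<in> incidences" "p \<subseteq> flag v e f"
      by blast+
    from p(1) consider v e where "p = {Vertex v, Edge e}" | e f where "p = {Edge e, Face f}"
      | v f where "p = {Vertex v, Face f}"
      unfolding incidences_def by blast
    thus "p \<in> {{Vertex v, Edge e}, {Edge e, Face f}, {Vertex v, Face f}}"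
      using p(2) by cases (simp_all add: flag_def)
  qed
  have "{Vertex v, Edge e} \<in> incidences" "{Edge e, Face f} \<in> incidences"
    using assms unfolding incidences_def by blast+
  moreover have "{Vertex v, Face f} \<in> incidences"
    using assms unfolding incidences_def corner_def by blast
  ultimately show "{{Vertex v, Edge e}, {Edge e, Face f}, {Vertex v, Face f}} \<subseteq>
      {p\<in>incidences. p \<subseteq> flag v e f}"
    by (simp add: flag_def)
qed

lemma finite_flags: "finite flags"
  using card_flags edges_nonempty finite_E by (metis card.infinite card_0_eq mult_is_0 zero_neq_numeral)

lemma finite_entities: "finite entities"
  using finite_V finite_E finite_F by (simp add: entities_def)

lemma incidenceI:
  "e \<in> E \<Longrightarrow> v \<in> ends V e \<Longrightarrow> {Vertex v, Edge e} \<in> incidences"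
  "e \<in> E \<Longrightarrow> f \<in> sides e \<Longrightarrow> {Edge e, Face f} \<in> incidences"
  "corner v f \<Longrightarrow> {Vertex v, Face f} \<in> incidences"
  unfolding incidences_def by blast+

lemma cornerI: "e \<in> E \<Longrightarrow> v \<in> ends V e \<Longrightarrow> f \<in> sides e \<Longrightarrow> corner v f"
  unfolding corner_def by blast

lemma incidence_cases:
  assumes "p \<in> incidences"
  obtains v e where "p = {Vertex v, Edge e}" "e \<in> E" "v \<in> ends V e"
    | e f where "p = {Edge e, Face f}" "e \<in> E" "f \<in> sides e"
    | v f where "p = {Vertex v, Face f}" "corner v f"
  using assms unfolding incidences_def by blast

lemma incidences_subset:
  assumes "p \<in> incidences"
  shows "p \<subseteq> entities \<and> card p = 2"
  using assms
proof (cases rule: incidence_cases)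
  case (1 v e)
  then show ?thesis using ends_subset_V[of e] by (auto simp: entities_def)
next
  case (2 e f)
  then show ?thesis using sides_subset[of e] by (auto simp: entities_def)
next
  case (3 v f)
  then show ?thesis using corner_mem[of v f] by (auto simp: entities_def)
qed

text \<open>Each incidence lies in two flags and each of the 4 * card E flags contains three
  incidences.\<close>

lemma card_incidences: "card incidences = 6 * card E"
proof -
  have fin: "finite incidences"
    using incidences_subset finite_entities by (auto intro: finite_subset[of _ "Pow entities"])
  have "(\<Sum>p\<in>incidences. card {t\<in>flags. p \<subseteq> t}) = (\<Sum>p\<in>incidences. \<Sum>t\<in>flags. if p \<subseteq> t then 1 else 0)"
    using finite_flags by (simp add: sum.If_cases Int_def)
  also have "\<dots> = (\<Sum>t\<in>flags. \<Sum>p\<in>incidences. if p \<subseteq> t then 1 else 0)"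
    by (rule sum.swap)
  also have "\<dots> = (\<Sum>t\<in>flags. card {p\<in>incidences. p \<subseteq> t})"
    using fin by (simp add: sum.If_cases Int_def)
  also have "\<dots> = (\<Sum>t\<in>flags. 3)"
  proof (rule sum.cong[OF refl])
    fix t assume "t \<in> flags"
    then obtain v e f where "t = flag v e f" "e \<in> E" "v \<in> ends V e" "f \<in> sides e"
      by (auto simp: flags_def)
    thus "card {p\<in>incidences. p \<subseteq> t} = 3"
      using incidences_in_flag by (auto simp: doubleton_eq_iff)
  qed
  finally show ?thesis
    using card_flags by (simp add: card_flags_over)
qed

lemma card_entities: "card entities = card V + card E + card F"
proof -
  have "card entities = card (Vertex ` V) + card (Edge ` E) + card (Face ` F)"
    unfolding entities_def using finite_V finite_E finite_F
    by (subst card_Un_disjoint; (subst card_Un_disjoint)?) auto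
  thus ?thesis
    by (simp add: card_image inj_on_def)
qed

lemma entities_connected:
  assumes A: "A \<subseteq> entities" "A \<noteq> {}" "A \<noteq> entities"
  shows "\<exists>p\<in>incidences. p \<inter> A \<noteq> {} \<and> \<not> p \<subseteq> A"
proof (rule ccontr)
  assume "\<not> ?thesis"
  hence closed: "\<And>p. p \<in> incidences \<Longrightarrow> p \<inter> A \<noteq> {} \<Longrightarrow> p \<subseteq> A"
    by blast
  have VE: "Vertex v \<in> A \<longleftrightarrow> Edge e \<in> A" if "e \<in> E" "v \<in> ends V e" for v e
  proof -
    have "{Vertex v, Edge e} \<in> incidences"
      using that unfolding incidences_def by blast
    from closed[OF this] show ?thesis by auto
  qed
  have EF: "Edge e \<in> A \<longleftrightarrow> Face f \<in> A" if "e \<in> E" "f \<in> sides e" for e f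
  proof -
    have "{Edge e, Face f} \<in> incidences"
      using that unfolding incidences_def by blast
    from closed[OF this] show ?thesis by auto
  qed
  have "\<exists>v\<in>V. Vertex v \<in> A"
  proof -
    obtain e where e: "e \<in> E" "Edge e \<in> A"
    proof -
      obtain x where x: "x \<in> A" "x \<in> entities"
        using A by blast
      then consider v where "x = Vertex v" "v \<in> V" | e where "x = Edge e" "e \<in> E"
        | f where "x = Face f" "f \<in> F"
        by (auto simp: entities_def)
      thus thesis
      proof cases
        case 1
        then show thesis
          using vertex_has_edge[of v] VE x that by blast
      next
        case 2
        then show thesis using x that by blast
      next
        case 3
        then obtain e where "e \<in> E" "f \<in> sides e"
          using face_has_edge by (auto simp: sides_def)
        then show thesis
          using EF 3 x that by blast
      qed
    qed
    then obtain v where "v \<in> ends V e"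
      using card_ends[OF e(1)] by fastforce
    thus ?thesis
      using VE e ends_subset_V by blast
  qed
  hence "{v\<in>V. Vertex v \<in> A} = V"
    using VE ends_subset_V by (intro vertex_connected) blast+
  hence V: "Vertex v \<in> A" if "v \<in> V" for v
    using that by blast
  have E: "Edge e \<in> A" if e: "e \<in> E" for e
  proof -
    obtain v where "v \<in> ends V e"
      using card_ends[OF e] by fastforce
    thus ?thesis
      using VE[OF e] V ends_subset_V by blast
  qed
  have "Face f \<in> A" if f: "f \<in> F" for f
  proof -
    obtain e where "e \<in> E" "f \<in> sides e"
      using face_has_edge[OF f] f by (auto simp: sides_def)
    thus ?thesis
      using EF E by blast
  qed
  hence "entities \<subseteq> A"
    using V E by (auto simp: entities_def)
  thus False
    using A by blast
qed

text \<open>If no incidence separates \<open>X\<close> from the other flags, \<open>X\<close> is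
  closed under exchanging one entry of a flag. Exchanging vertices and edges leads around a face
  along its cycle; exchanging faces then reaches all faces by
  \<open>faces_connected\<close>.\<close>

lemma flags_connected:
  assumes X: "X \<subseteq> flags" "X \<noteq> {}" "X \<noteq> flags"
  shows "\<exists>p\<in>incidences. \<exists>t\<in>X. \<exists>t'\<in>flags - X. p \<subseteq> t \<and> p \<subseteq> t'"
proof (rule ccontr)
  assume "\<not> ?thesis"
  hence closed: "\<And>p t t'. p \<in> incidences \<Longrightarrow> t \<in> X \<Longrightarrow> t' \<in> flags \<Longrightarrow> p \<subseteq> t \<Longrightarrow> p \<subseteq> t' \<Longrightarrow> t' \<in> X"
    by blast
  have mem: "e \<in> E \<and> v \<in> ends V e \<and> f \<in> sides e" if "flag v e f \<in> X" for v e f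
    using subsetD[OF X(1) that] by (simp only: flag_mem)
  have vert: "flag v' e f \<in> X" if "flag v e f \<in> X" "v' \<in> ends V e" for v v' e f
  proof (rule closed[OF _ that(1)])
    show "{Edge e, Face f} \<in> incidences"
      using mem[OF that(1)] by (simp add: incidenceI)
    show "flag v' e f \<in> flags"
      using mem[OF that(1)] that(2) by (simp add: flag_mem)
  qed (auto simp: flag_def)
  have face: "flag v e g \<in> X" if "flag v e f \<in> X" "g \<in> sides e" for v e f g
  proof (rule closed[OF _ that(1)])
    show "{Vertex v, Edge e} \<in> incidences"
      using mem[OF that(1)] by (simp add: incidenceI)
    show "flag v e g \<in> flags"
      using mem[OF that(1)] that(2) by (simp add: flag_mem)
  qed (auto simp: flag_def)
  have edge: "flag v e' f \<in> X" if "flag v e f \<in> X" "e' \<in> E" "v \<in> ends V e'" "f \<in> sides e'" for v e e' f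
  proof (rule closed[OF _ that(1)])
    show "{Vertex v, Face f} \<in> incidences"
      using cornerI[OF that(2-4)] by (rule incidenceI)
    show "flag v e' f \<in> flags"
      using that(2-4) by (simp add: flag_mem)
  qed (auto simp: flag_def)
  have around: "flag v' e' f \<in> X"
    if t: "flag v e f \<in> X" and e': "e' \<in> E" "f \<in> sides e'" "v' \<in> ends V e'" for v e f v' e'
  proof -
    have ef: "e \<in> E" "f \<in> sides e"
      using mem[OF t] by simp_all
    obtain vs es where C: "simple_cycle V E vs es" "set es = {e\<in>E. f \<in> sides e}"
      using face_cycle_sides[of f] sides_subset ef by blast
    have n: "length es = length vs"
      using C(1) by (auto simp: simple_cycle_def)
    define Q where "Q i \<longleftrightarrow> (\<forall>u\<in>ends V (es ! i). flag u (es ! i) f \<in> X)" for i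
    have "e \<in> set es" "e' \<in> set es"
      using ef e' C(2) by auto
    then obtain i k where i: "i < length vs" "e = es ! i" and k: "k < length vs" "e' = es ! k"
      by (metis in_set_conv_nth n)
    have "Q k"
    proof (rule cyclic_induct[OF i(1) _ _ k(1)])
      show "Q i"
        unfolding Q_def using vert t i(2) by blast
    next
      fix j assume j: "j < length vs" "Q j"
      define j' where "j' = Suc j mod length vs"
      have j': "j' < length vs"
        unfolding j'_def using j(1) by (metis bot_nat_0.not_eq_extremum less_zeroE mod_less_divisor)
      have "vs ! j' \<in> ends V (es ! j)"
        using cycle_edge(2)[OF C(1) j(1)] by (simp add: j'_def)
      hence 1: "flag (vs ! j') (es ! j) f \<in> X"
        using j(2) by (simp add: Q_def)
      have 2: "vs ! j' \<in> ends V (es ! j')"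
        using cycle_edge(2)[OF C(1) j'] by simp
      have "es ! j' \<in> set es"
        using j' n by simp
      hence "es ! j' \<in> E" "f \<in> sides (es ! j')"
        unfolding C(2) by blast+
      hence "flag (vs ! j') (es ! j') f \<in> X"
        using edge[OF 1 _ 2] by blast
      thus "Q (Suc j mod length vs)"
        using vert unfolding Q_def j'_def by blast
    qed
    thus ?thesis
      using e'(3) unfolding Q_def k(2) by blast
  qed
  define Y where "Y = {f. \<exists>v e. flag v e f \<in> X}"
  have YF: "Y \<subseteq> F"
    unfolding Y_def using mem sides_subset by blast
  have "Y \<noteq> {}"
  proof -
    obtain t where "t \<in> X" "t \<in> flags"
      using X by blast
    thus ?thesis
      unfolding Y_def flags_def by blast
  qed
  moreover have "sides e \<subseteq> Y" if e: "e \<in> E" "sides e \<inter> Y \<noteq> {}" for e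
  proof -
    obtain f v e' where f: "f \<in> sides e" "flag v e' f \<in> X"
      using e(2) unfolding Y_def by blast
    obtain u where u: "u \<in> ends V e"
      using card_ends[OF e(1)] by fastforce
    have "flag u e f \<in> X"
      by (rule around[OF f(2) e(1) f(1) u])
    thus ?thesis
      using face unfolding Y_def by blast
  qed
  ultimately have "Y = F"
    using faces_connected[OF YF] by blast
  have "flags \<subseteq> X"
  proof
    fix t assume "t \<in> flags"
    then obtain v e f where t: "t = flag v e f" "e \<in> E" "v \<in> ends V e" "f \<in> sides e"
      by (auto simp: flags_def)
    then obtain v' e' where "flag v' e' f \<in> X"
      using \<open>Y = F\<close> sides_subset unfolding Y_def by blast
    thus "t \<in> X"
      unfolding t(1) using around t by blast
  qed
  thus False
    using X by blast
qed

sublocale flag_sphere: triangulated_sphere entities incidences flags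
proof
  fix t assume "t \<in> flags"
  then obtain v e f where t: "t = flag v e f" "e \<in> E" "v \<in> ends V e" "f \<in> sides e"
    unfolding flags_def by blast
  have "v \<in> V" "f \<in> F"
    using t(3,4) ends_subset_V sides_subset by blast+
  thus "t \<subseteq> entities \<and> card t = 3"
    unfolding t(1) flag_def entities_def using t(2) by simp
  fix p assume pt: "p \<subseteq> t" "card p = 2"
  then obtain x y where p: "p = {x, y}" "x \<noteq> y"
    unfolding card_2_iff by blast
  have "p \<in> {{Vertex v, Edge e}, {Edge e, Face f}, {Vertex v, Face f}}"
    using pt(1) p(2) unfolding p(1) t(1) flag_def by auto
  thus "p \<in> incidences"
    unfolding incidences_in_flag[OF t(2-4), symmetric] by simp
next
  \<comment> \<open>With 4 flags and 6 incidences per edge, 6 E + 2 <= (V + E + F) + 4 E is Euler's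
    inequality for \<open>G\<close>.\<close>
  show "card incidences + 2 \<le> card entities + card flags"
    using euler_inequality by (simp add: card_incidences card_entities card_flags)
qed (fact finite_entities incidences_subset card_flags_over entities_connected flags_connected)+

end

section \<open>Counting pairs within a set of vertices and faces\<close>

lemma card_2_other:
  assumes "card S = 2" "x \<in> S"
  shows "\<exists>y. S = {x, y} \<and> x \<noteq> y"
  using assms by (auto simp: card_2_iff insert_commute)

lemma even_card_other:
  assumes "even (card {p\<in>K. w \<in> p})" "p \<in> K" "w \<in> p"
  shows "\<exists>q\<in>K. w \<in> q \<and> q \<noteq> p"
proof (rule ccontr)
  assume "\<not> ?thesis"
  hence "{p\<in>K. w \<in> p} = {p}"
    using assms by blast
  thus False
    using assms(1) by simp
qed

context cycle_faced_plane_graph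
begin

definition corners :: "complex set \<Rightarrow> complex set set \<Rightarrow> entity set set" where
  "corners A B = {{Vertex v, Face f} | v f. v \<in> A \<and> f \<in> B \<and> corner v f}"

lemma finite_incidences: "finite incidences"
  using incidences_subset finite_entities by (auto intro: finite_subset[of _ "Pow entities"])

lemma corners_incidences: "corners A B \<subseteq> incidences"
  unfolding corners_def using incidenceI(3) by blast

lemma finite_corners: "finite (corners A B)"
  using corners_incidences finite_incidences by (rule finite_subset)

text \<open>Each edge counted here has four flags. The map \<open>r\<close> forgets the edge of a
  flag and leaves a corner, and a corner comes from at most two flags.\<close>

lemma card_full_le:
  "2 * card {e\<in>E. ends V e \<subseteq> A \<and> sides e \<subseteq> B} \<le> card (corners A B)"
proof -
  define E' where "E' = {e\<in>E. ends V e \<subseteq> A \<and> sides e \<subseteq> B}"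
  define T where "T = {flag v e f | v e f. e \<in> E' \<and> v \<in> ends V e \<and> f \<in> sides e}"
  define r where "r t = t - range Edge" for t
  have TE: "T \<subseteq> flags"
    unfolding T_def flags_def E'_def by blast
  have fin: "finite T"
    using TE finite_flags by (rule finite_subset)
  have r: "r (flag v e f) = {Vertex v, Face f}" for v e f
    by (auto simp: r_def flag_def)
  have "card T \<le> 2 * card (r ` T)"
  proof (rule card_le_two_times_image[OF fin])
    fix t assume "t \<in> T"
    then obtain v e f where t: "t = flag v e f" "e \<in> E" "v \<in> ends V e" "f \<in> sides e"
      unfolding T_def E'_def by blast
    have "{y\<in>T. r y = r t} \<subseteq> {y\<in>flags. {Vertex v, Face f} \<subseteq> y}"
    proof
      fix y assume y: "y \<in> {y\<in>T. r y = r t}"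
      hence "r y = {Vertex v, Face f}"
        by (simp add: t(1) r)
      hence "{Vertex v, Face f} \<subseteq> y"
        by (auto simp: r_def)
      thus "y \<in> {y\<in>flags. {Vertex v, Face f} \<subseteq> y}"
        using y TE by blast
    qed
    hence "card {y\<in>T. r y = r t} \<le> card {y\<in>flags. {Vertex v, Face f} \<subseteq> y}"
      by (rule card_mono[rotated]) (simp add: finite_flags)
    thus "card {y\<in>T. r y = r t} \<le> 2"
      using card_flags_over[OF incidenceI(3)[OF cornerI[OF t(2-4)]]] by simp
  qed
  also have "r ` T \<subseteq> corners A B"
  proof
    fix x assume "x \<in> r ` T"
    then obtain v e f where t: "x = {Vertex v, Face f}" "e \<in> E'" "v \<in> ends V e" "f \<in> sides e"
      unfolding T_def using r by blast
    have "corner v f" "v \<in> A" "f \<in> B"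
      using t(2-4) cornerI unfolding E'_def by blast+
    thus "x \<in> corners A B"
      unfolding t(1) corners_def by blast
  qed
  hence "card (r ` T) \<le> card (corners A B)"
    using finite_corners by (intro card_mono)
  finally have "card T \<le> 2 * card (corners A B)"
    using \<open>card (r ` T) \<le> card (corners A B)\<close> by linarith
  moreover have "card T = 4 * card E'"
    unfolding T_def by (rule card_flags_on) (auto simp: E'_def)
  ultimately show ?thesis
    unfolding E'_def by linarith
qed

text \<open>The corners form a simple bipartite graph, so a nonempty even subgraph has at least 4
  edges. This is the planar bound 2 n - 4, next to the bound n - 1 for a single face.\<close>

lemma card_corners_le:
  assumes "A \<subseteq> V" "B \<subseteq> F" "A \<noteq> {} \<or> B \<noteq> {}"
  defines "S \<equiv> Vertex ` A \<union> Face ` B"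
  shows "card (corners A B) + 1 \<le> card S \<or> 4 * (card (corners A B) + 2) \<le> 2 * card (corners A B) + 4 * card S"
proof -
  have "4 \<le> sum (\<lambda>_. 1::nat) K"
    if K: "K \<subseteq> corners A B" "K \<noteq> {}" "\<And>w. even (card {p\<in>K. w \<in> p})" for K
  proof -
    have form: "\<exists>v f. p = {Vertex v, Face f}" if "p \<in> K" for p
      using that K(1) unfolding corners_def by blast
    have at_v: "\<exists>g. g \<noteq> f \<and> {Vertex v, Face g} \<in> K" if vf: "{Vertex v, Face f} \<in> K" for v f
    proof -
      obtain q where q: "q \<in> K" "Vertex v \<in> q" "q \<noteq> {Vertex v, Face f}"
        using even_card_other[OF K(3) vf, of "Vertex v"] by blast
      obtain u g where "q = {Vertex u, Face g}"
        using form[OF q(1)] by blast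
      thus ?thesis
        using q by auto
    qed
    have at_f: "\<exists>u. u \<noteq> v \<and> {Vertex u, Face f} \<in> K" if vf: "{Vertex v, Face f} \<in> K" for v f
    proof -
      obtain q where q: "q \<in> K" "Face f \<in> q" "q \<noteq> {Vertex v, Face f}"
        using even_card_other[OF K(3) vf, of "Face f"] by blast
      obtain u g where "q = {Vertex u, Face g}"
        using form[OF q(1)] by blast
      thus ?thesis
        using q by auto
    qed
    obtain v f where 0: "{Vertex v, Face f} \<in> K"
      using K(2) form by blast
    obtain g where 1: "g \<noteq> f" "{Vertex v, Face g} \<in> K"
      using at_v[OF 0] by blast
    obtain u where 2: "u \<noteq> v" "{Vertex u, Face f} \<in> K"
      using at_f[OF 0] by blast
    obtain x where 3: "x \<noteq> v" "{Vertex x, Face g} \<in> K"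
      using at_f[OF 1(2)] by blast
    \<comment> \<open>The vertices \<open>u\<close> and \<open>x\<close> may coincide; the four
      pairs are distinct in any case.\<close>
    define L where "L = {{Vertex v, Face f}, {Vertex v, Face g}, {Vertex u, Face f}, {Vertex x, Face g}}"
    have "card L = 4"
      unfolding L_def using 1(1) 2(1) 3(1) by (auto simp: doubleton_eq_iff card_insert_if)
    moreover have "finite K"
      using K(1) finite_corners by (rule finite_subset)
    moreover have "L \<subseteq> K"
      unfolding L_def using 0 1 2 3 by simp
    ultimately show ?thesis
      using card_mono[of K L] by simp
  qed
  moreover have "\<Union>(corners A B) \<subseteq> S" "S \<noteq> {}" "S \<subseteq> entities"
    using assms(1-3) by (auto simp: S_def corners_def entities_def)
  ultimately show ?thesis
    using flag_sphere.edge_bound[OF corners_incidences, of A B S 4 "\<lambda>_. 1"] by simp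
qed

text \<open>The planar graph on \<open>A \<union> B\<close> formed by the corners, the edges in \<open>M\<close>, and the duals of the edges
  in \<open>N\<close>; each of the last two is drawn as a path of two incidences through the edge.\<close>

definition skeleton :: "complex set \<Rightarrow> complex set set \<Rightarrow> complex set set \<Rightarrow> complex set set \<Rightarrow> entity set set" where
  "skeleton A B M N = corners A B \<union> {{Vertex v, Edge e} | v e. e \<in> M \<and> v \<in> ends V e} \<union>
     {{Edge e, Face f} | e f. e \<in> N \<and> f \<in> sides e}"

lemma card_halves:
  assumes "M \<subseteq> E" "\<And>e. e \<in> M \<Longrightarrow> card (X e) = 2" "inj c" "\<And>e x. c x \<noteq> Edge e"
  shows "card {{c x, Edge e} | x e. e \<in> M \<and> x \<in> X e} = 2 * card M"
proof -
  have "{{c x, Edge e} | x e. e \<in> M \<and> x \<in> X e} = (\<lambda>(e, x). {c x, Edge e}) ` (SIGMA e:M. X e)"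
    by auto
  moreover have "inj_on (\<lambda>(e, x). {c x, Edge e}) (SIGMA e:M. X e)"
  proof (rule inj_onI)
    fix p q assume "p \<in> (SIGMA e:M. X e)" "q \<in> (SIGMA e:M. X e)"
      "(case p of (e, x) \<Rightarrow> {c x, Edge e}) = (case q of (e, x) \<Rightarrow> {c x, Edge e})"
    moreover obtain e x d y where "p = (e, x)" "q = (d, y)"
      by (cases p, cases q)
    ultimately show "p = q"
      using assms(4)[of x d] injD[OF assms(3), of x y] by (simp add: doubleton_eq_iff)
  qed
  ultimately have "card {{c x, Edge e} | x e. e \<in> M \<and> x \<in> X e} = card (SIGMA e:M. X e)"
    by (simp add: card_image)
  also have "\<dots> = (\<Sum>e\<in>M. card (X e))"
    using finite_subset[OF assms(1) finite_E] assms(2)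
    by (intro card_SigmaI) (auto intro: card_ge_0_finite)
  finally show ?thesis
    using assms(2) by simp
qed

text \<open>\<open>M \<inter> N = {}\<close> keeps an edge from crossing its own dual, and
  injectivity of \<open>ends\<close> and \<open>sides\<close> excludes parallel edges. So this is
  the bound 3 n - 6 for simple planar graphs, with n - 1 as the alternative for a single
  face.\<close>

lemma skeleton_bound:
  assumes AB: "A \<subseteq> V" "B \<subseteq> F" "A \<noteq> {} \<or> B \<noteq> {}"
    and M: "M \<subseteq> {e\<in>E. ends V e \<subseteq> A}" and N: "N \<subseteq> {e\<in>E. sides e \<subseteq> B}" "M \<inter> N = {}" "inj_on sides N"
  defines "S \<equiv> Vertex ` A \<union> Face ` B"
  shows "card (corners A B) + card M + card N + 1 \<le> card S \<or>
    card (corners A B) + card M + card N + 6 \<le> 3 * card S"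
proof -
  define H where "H = skeleton A B M N"
  \<comment> \<open>A subdivided edge consists of two halves of weight 1, so a corner gets weight 2.
    A triangle then weighs 6.\<close>
  define \<omega> where "\<omega> p = (if p \<in> corners A B then 2 else (1::nat))" for p
  define HM where "HM = {{Vertex v, Edge e} | v e. e \<in> M \<and> v \<in> ends V e}"
  define HN where "HN = {{Face f, Edge e} | f e. e \<in> N \<and> f \<in> sides e}"
  have HN': "HN = {{Edge e, Face f} | e f. e \<in> N \<and> f \<in> sides e}"
    unfolding HN_def by (auto simp: insert_commute)
  have H: "H = corners A B \<union> HM \<union> HN"
    unfolding H_def skeleton_def HM_def HN' by blast
  have ME: "M \<subseteq> E" and NE: "N \<subseteq> E"
    using M N by auto
  have finM: "finite M" and finN: "finite N"
    using ME NE finite_E finite_subset by blast+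
  have cM: "card HM = 2 * card M"
    unfolding HM_def by (rule card_halves) (use ME card_ends in \<open>auto simp: inj_def\<close>)
  have cN: "card HN = 2 * card N"
    unfolding HN_def by (rule card_halves) (use NE card_sides in \<open>auto simp: inj_def\<close>)
  have dis: "corners A B \<inter> HM = {}" "corners A B \<inter> HN = {}" "HM \<inter> HN = {}"
    unfolding corners_def HM_def HN_def by (auto simp: doubleton_eq_iff)
  have HP: "H \<subseteq> incidences"
    unfolding H HM_def HN' using corners_incidences ME NE incidenceI by blast
  have finH: "finite H"
    using HP finite_incidences by (rule finite_subset)
  have cH: "card H = card (corners A B) + 2 * (card M + card N)"
  proof -
    have "card H = card (corners A B) + card HM + card HN"
      unfolding H using finH dis unfolding H by (subst card_Un_disjoint; (subst card_Un_disjoint)?) auto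
    thus ?thesis by (simp add: cM cN)
  qed
  have wt: "sum \<omega> K = card K + card (K \<inter> corners A B)" if "finite K" for K
  proof -
    have "sum \<omega> K = (\<Sum>p\<in>K. 1 + (if p \<in> corners A B then 1 else 0))"
      by (rule sum.cong) (auto simp: \<omega>_def)
    thus ?thesis
      using that by (simp only: sum.distrib) (simp add: sum.If_cases)
  qed
  define U where "U = S \<union> Edge ` (M \<union> N)"
  have cU: "card U = card S + card M + card N"
  proof -
    have "finite S"
      unfolding S_def using AB finite_V finite_F by (auto intro: finite_subset)
    hence "card U = card S + card (Edge ` (M \<union> N))"
      unfolding U_def using finM finN by (intro card_Un_disjoint) (auto simp: S_def)
    also have "card (Edge ` (M \<union> N)) = card M + card N"
      using finM finN N(2) by (simp add: card_image inj_on_def card_Un_disjoint)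
    finally show ?thesis by simp
  qed
  have weight: "6 \<le> sum \<omega> K"
    if K: "K \<subseteq> H" "K \<noteq> {}" "\<And>w. even (card {p\<in>K. w \<in> p})" for K
  proof -
    define C where "C = K \<inter> corners A B"
    define T where "T = {e. \<exists>p\<in>K. Edge e \<in> p}"
    have finK: "finite K"
      using K(1) finH by (rule finite_subset)
    have TMN: "T \<subseteq> M \<union> N"
      unfolding T_def using K(1) unfolding H HM_def HN_def corners_def by auto
    have finT: "finite T"
      using TMN finM finN by (auto intro: finite_subset)
    \<comment> \<open>Parity at the midpoint of a subdivided edge: a \<open>K\<close> that uses one
      half uses at least two.\<close>
    have "2 * card T \<le> card (K - C)"
    proof -
      have two: "2 \<le> card {p\<in>K. Edge e \<in> p}" if "e \<in> T" for e
      proof -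
        have "{p\<in>K. Edge e \<in> p} \<noteq> {}"
          using that unfolding T_def by blast
        hence "card {p\<in>K. Edge e \<in> p} \<noteq> 0"
          using finK by simp
        thus ?thesis
          using K(3)[of "Edge e"] by presburger
      qed
      have "2 * card T = (\<Sum>e\<in>T. 2)"
        by simp
      also have "\<dots> \<le> (\<Sum>e\<in>T. card {p\<in>K. Edge e \<in> p})"
        by (rule sum_mono) (rule two)
      also have "\<dots> = card (\<Union>e\<in>T. {p\<in>K. Edge e \<in> p})"
      proof (rule card_UN_disjoint[symmetric])
        show "\<forall>e\<in>T. \<forall>e'\<in>T. e \<noteq> e' \<longrightarrow> {p\<in>K. Edge e \<in> p} \<inter> {p\<in>K. Edge e' \<in> p} = {}"
          using K(1) unfolding H HM_def HN_def corners_def by auto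
      qed (use finT finK in auto)
      also have "\<dots> \<le> card (K - C)"
        using finK by (intro card_mono) (auto simp: C_def corners_def)
      finally show ?thesis .
    qed
    moreover have "card K = card C + card (K - C)"
    proof -
      have "card (C \<union> (K - C)) = card C + card (K - C)"
        using finK by (intro card_Un_disjoint) (auto simp: C_def)
      moreover have "C \<union> (K - C) = K"
        by (auto simp: C_def)
      ultimately show ?thesis by simp
    qed
    ultimately have low: "2 * card T + 2 * card C \<le> sum \<omega> K"
      using wt[OF finK] by (simp add: C_def)
    have cell: "(\<exists>v f. p = {Vertex v, Face f} \<and> p \<in> C) \<or>
        (\<exists>v e. p = {Vertex v, Edge e} \<and> e \<in> M \<and> v \<in> ends V e \<and> e \<in> T) \<or>
        (\<exists>f e. p = {Face f, Edge e} \<and> e \<in> N \<and> f \<in> sides e \<and> e \<in> T)" if p: "p \<in> K" for p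
    proof -
      have "p \<in> corners A B \<or> p \<in> HM \<or> p \<in> HN"
        using p K(1) H by blast
      thus ?thesis
      proof (elim disjE)
        assume "p \<in> corners A B"
        thus ?thesis using p unfolding C_def corners_def by blast
      next
        assume "p \<in> HM"
        then obtain v e where "p = {Vertex v, Edge e}" "e \<in> M" "v \<in> ends V e"
          unfolding HM_def by blast
        moreover have "e \<in> T"
          using p \<open>p = {Vertex v, Edge e}\<close> unfolding T_def by blast
        ultimately show ?thesis by blast
      next
        assume "p \<in> HN"
        then obtain f e where "p = {Face f, Edge e}" "e \<in> N" "f \<in> sides e"
          unfolding HN_def by blast
        moreover have "e \<in> T"
          using p \<open>p = {Face f, Edge e}\<close> unfolding T_def by blast
        ultimately show ?thesis by blast
      qed
    qed
    have vertex: "(\<exists>f. {Vertex v, Face f} \<in> C \<and> {Vertex v, Face f} \<noteq> p) \<or>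
        (\<exists>e\<in>T \<inter> M. v \<in> ends V e \<and> {Vertex v, Edge e} \<noteq> p)"
      if p: "p \<in> K" "Vertex v \<in> p" for p v
    proof -
      obtain q where q: "q \<in> K" "Vertex v \<in> q" "q \<noteq> p"
        using even_card_other[OF K(3) p] by blast
      show ?thesis
        using cell[OF q(1)] q(2,3) by auto
    qed
    have face: "(\<exists>v. {Vertex v, Face f} \<in> C \<and> {Vertex v, Face f} \<noteq> p) \<or>
        (\<exists>e\<in>T \<inter> N. f \<in> sides e \<and> {Face f, Edge e} \<noteq> p)"
      if p: "p \<in> K" "Face f \<in> p" for p f
    proof -
      obtain q where q: "q \<in> K" "Face f \<in> q" "q \<noteq> p"
        using even_card_other[OF K(3) p] by blast
      show ?thesis
        using cell[OF q(1)] q(2,3) by auto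
    qed
    have finC: "finite C"
      using finK by (simp add: C_def)
    \<comment> \<open>A nonempty even subgraph of a simple graph has at least three edges;
      \<open>T\<close> counts its subdivided edges and \<open>C\<close> its corners.\<close>
    have "3 \<le> card T + card C"
    proof (cases "C = {}")
      case False
      then obtain v f where c: "{Vertex v, Face f} \<in> C"
        using cell unfolding C_def corners_def by blast
      hence cK: "{Vertex v, Face f} \<in> K"
        by (simp add: C_def)
      define X where "X = T \<inter> M"
      define Y where "Y = T \<inter> N"
      have XY: "X \<inter> Y = {}" "X \<subseteq> T" "Y \<subseteq> T" "finite X" "finite Y"
        using N(2) finT by (auto simp: X_def Y_def)
      have cardXY: "card X + card Y \<le> card T"
        using XY finT card_Un_disjoint[of X Y] card_mono[of T "X \<union> Y"] by simp
      \<comment> \<open>At a corner, \<open>K\<close> must continue at the vertex by another corner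
        or an edge of \<open>M\<close>, and at the face by another corner or the dual of an edge of
        \<open>N\<close>. The two continuations are distinct.\<close>
      have 1: "(\<exists>g. g \<noteq> f \<and> {Vertex v, Face g} \<in> C) \<or> 1 \<le> card X"
        using vertex[OF cK, of v] XY(4) unfolding X_def[symmetric]
        by (auto simp: Suc_le_eq card_gt_0_iff)
      have 2: "(\<exists>u. u \<noteq> v \<and> {Vertex u, Face f} \<in> C) \<or> 1 \<le> card Y"
        using face[OF cK, of f] XY(5) unfolding Y_def[symmetric]
        by (auto simp: Suc_le_eq card_gt_0_iff)
      have c1: "1 \<le> card C"
        using c finC by (auto simp: Suc_le_eq card_gt_0_iff)
      have c2: "2 \<le> card C" if "q \<in> C" "q \<noteq> {Vertex v, Face f}" for q
        using card_mono[of C "{q, {Vertex v, Face f}}"] finC c that by simp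
      have c3: "3 \<le> card C" if "{Vertex v, Face g} \<in> C" "g \<noteq> f" "{Vertex u, Face f} \<in> C" "u \<noteq> v" for g u
      proof -
        have "card {{Vertex v, Face f}, {Vertex v, Face g}, {Vertex u, Face f}} = 3"
          using that by (auto simp: doubleton_eq_iff)
        thus ?thesis
          using card_mono[of C "{{Vertex v, Face f}, {Vertex v, Face g}, {Vertex u, Face f}}"]
            finC c that by simp
      qed
      show ?thesis
      proof (cases "1 \<le> card X")
        case True
        show ?thesis
        proof (cases "1 \<le> card Y")
          case False
          then obtain u where "u \<noteq> v" "{Vertex u, Face f} \<in> C"
            using 2 by blast
          then have "2 \<le> card C"
            by (intro c2[of "{Vertex u, Face f}"]) (auto simp: doubleton_eq_iff)
          then show ?thesis using True cardXY by linarith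
        qed (use True cardXY c1 in linarith)
      next
        case False
        then obtain g where g: "g \<noteq> f" "{Vertex v, Face g} \<in> C"
          using 1 by blast
        then have g2: "2 \<le> card C"
          by (intro c2[of "{Vertex v, Face g}"]) (auto simp: doubleton_eq_iff)
        show ?thesis
        proof (cases "1 \<le> card Y")
          case False
          then obtain u where "u \<noteq> v" "{Vertex u, Face f} \<in> C"
            using 2 by blast
          then show ?thesis using c3 g by fastforce
        qed (use g2 cardXY in linarith)
      qed
    next
      case True
      \<comment> \<open>By parity, both halves of an edge in \<open>T\<close> lie in
        \<open>K\<close>, so \<open>K\<close> continues at both of its ends. Since there are no
        parallel edges, the two continuing edges differ.\<close>
      have two: "card X = 2 \<Longrightarrow> {p\<in>K. Edge e \<in> p} \<subseteq> (\<lambda>x. {c x, Edge e}) ` X \<Longrightarrow> e \<in> T \<Longrightarrow>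
          x \<in> X \<Longrightarrow> {c x, Edge e} \<in> K" for X c e and x :: 'x
      proof -
        assume X: "card X = 2" "{p\<in>K. Edge e \<in> p} \<subseteq> (\<lambda>x. {c x, Edge e}) ` X" "e \<in> T" "x \<in> X"
        have "{p\<in>K. Edge e \<in> p} \<noteq> {}"
          using X(3) unfolding T_def by blast
        hence "card {p\<in>K. Edge e \<in> p} \<noteq> 0"
          using finK by simp
        hence "2 \<le> card {p\<in>K. Edge e \<in> p}"
          using K(3)[of "Edge e"] by presburger
        moreover have "card ((\<lambda>x. {c x, Edge e}) ` X) \<le> 2" "finite X"
          using card_image_le[of X "\<lambda>x. {c x, Edge e}"] X(1) card_ge_0_finite[of X] by auto
        ultimately have "{p\<in>K. Edge e \<in> p} = (\<lambda>x. {c x, Edge e}) ` X"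
          using X(2) by (intro card_seteq) auto
        thus "{c x, Edge e} \<in> K"
          using X(4) by blast
      qed
      obtain p where p: "p \<in> K"
        using K(2) by blast
      consider v e where "p = {Vertex v, Edge e}" "e \<in> M" "v \<in> ends V e" "e \<in> T"
        | f e where "p = {Face f, Edge e}" "e \<in> N" "f \<in> sides e" "e \<in> T"
        using cell[OF p] True by blast
      thus ?thesis
      proof cases
        case 1
        have "e \<in> E"
          using 1 ME by blast
        obtain v' where v': "ends V e = {v, v'}" "v \<noteq> v'"
          using card_2_other[OF card_ends[OF \<open>e \<in> E\<close>] 1(3)] by (elim exE conjE)
        have sub: "{p\<in>K. Edge e \<in> p} \<subseteq> (\<lambda>x. {Vertex x, Edge e}) ` ends V e"
        proof
          fix q assume "q \<in> {p\<in>K. Edge e \<in> p}"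
          thus "q \<in> (\<lambda>x. {Vertex x, Edge e}) ` ends V e"
            using cell[of q] True 1(2) N(2) by auto
        qed
        have v'K: "{Vertex v', Edge e} \<in> K"
          using two[OF card_ends[OF \<open>e \<in> E\<close>] sub 1(4)] v' by blast
        have other: "\<exists>e2\<in>T \<inter> M. x \<in> ends V e2 \<and> e2 \<noteq> e" if "{Vertex x, Edge e} \<in> K" for x
          using vertex[OF that, of x] True by auto
        obtain e2 where e2: "e2 \<in> T \<inter> M" "v \<in> ends V e2" "e2 \<noteq> e"
          using other[of v] p 1(1) by blast
        obtain e3 where e3: "e3 \<in> T \<inter> M" "v' \<in> ends V e3" "e3 \<noteq> e"
          using other[OF v'K] by blast
        have "e2 \<noteq> e3"
        proof
          assume "e2 = e3"
          hence "ends V e \<subseteq> ends V e2"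
            unfolding v'(1) using e2(2) e3(2) \<open>e2 = e3\<close> by simp
          moreover have "e2 \<in> E"
            using e2 ME by blast
          ultimately have "ends V e = ends V e2"
            using card_ends \<open>e \<in> E\<close> finite_ends by (intro card_seteq) auto
          thus False
            using ends_inj \<open>e \<in> E\<close> \<open>e2 \<in> E\<close> e2 by blast
        qed
        hence "card {e, e2, e3} = 3"
          using e2 e3 by auto
        thus ?thesis
          using card_mono[OF finT, of "{e, e2, e3}"] 1 e2 e3 by simp
      next
        case 2
        have "e \<in> E"
          using 2 NE by blast
        obtain f' where f': "sides e = {f, f'}" "f \<noteq> f'"
          using card_2_other[OF card_sides[OF \<open>e \<in> E\<close>] 2(3)] by (elim exE conjE)
        have sub: "{p\<in>K. Edge e \<in> p} \<subseteq> (\<lambda>x. {Face x, Edge e}) ` sides e"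
        proof
          fix q assume "q \<in> {p\<in>K. Edge e \<in> p}"
          thus "q \<in> (\<lambda>x. {Face x, Edge e}) ` sides e"
            using cell[of q] True 2(2) N(2) by auto
        qed
        have f'K: "{Face f', Edge e} \<in> K"
          using two[OF card_sides[OF \<open>e \<in> E\<close>] sub 2(4)] f' by blast
        have other: "\<exists>e2\<in>T \<inter> N. x \<in> sides e2 \<and> e2 \<noteq> e" if "{Face x, Edge e} \<in> K" for x
          using face[OF that, of x] True by auto
        obtain e2 where e2: "e2 \<in> T \<inter> N" "f \<in> sides e2" "e2 \<noteq> e"
          using other[of f] p 2(1) by blast
        obtain e3 where e3: "e3 \<in> T \<inter> N" "f' \<in> sides e3" "e3 \<noteq> e"
          using other[OF f'K] by blast
        have "e2 \<noteq> e3"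
        proof
          assume "e2 = e3"
          hence "sides e \<subseteq> sides e2"
            unfolding f'(1) using e2(2) e3(2) \<open>e2 = e3\<close> by simp
          moreover have "e2 \<in> E"
            using e2 NE by blast
          ultimately have "sides e = sides e2"
            using card_sides \<open>e \<in> E\<close> finite_sides by (intro card_seteq) auto
          thus False
            using N(3) e2 2(2) by (auto simp: inj_on_def)
        qed
        hence "card {e, e2, e3} = 3"
          using e2 e3 by auto
        thus ?thesis
          using card_mono[OF finT, of "{e, e2, e3}"] 2 e2 e3 by simp
      qed
    qed
    thus ?thesis
      using low by linarith
  qed
  have "\<Union>H \<subseteq> U"
  proof -
    have "\<Union>(corners A B) \<subseteq> S"
      unfolding corners_def S_def by auto
    moreover have "\<Union>HM \<subseteq> U"
      using M unfolding HM_def U_def S_def by (intro Union_least) blast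
    moreover have "\<Union>HN \<subseteq> U"
      using N(1) unfolding HN_def U_def S_def by (intro Union_least) blast
    ultimately show ?thesis
      unfolding H U_def by blast
  qed
  moreover have "U \<subseteq> entities" "U \<noteq> {}"
    using AB ME NE unfolding U_def S_def entities_def by auto
  ultimately have "card H + 1 \<le> card U \<or> 6 * (card H + 2) \<le> 2 * sum \<omega> H + 6 * card U"
    using flag_sphere.edge_bound[OF HP _ _ _ weight] by blast
  moreover have "H \<inter> corners A B = corners A B"
    unfolding H by blast
  hence "sum \<omega> H = card H + card (corners A B)"
    using wt[OF finH] by simp
  \<comment> \<open>With c corners, m = card M + card N and n = card S, the second alternative reads
    6 (c + 2 m + 2) <= 2 (2 c + 2 m) + 6 (n + m), that is, c + m + 6 <= 3 n.\<close>
  ultimately show ?thesis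
    unfolding cH cU by arith
qed

end

section \<open>The facial entire graph\<close>

lemma exists_degree_lt:
  assumes "finite S" "finite H" "\<And>h. h \<in> H \<Longrightarrow> card h = 2 \<and> h \<subseteq> S" "2 * card H < k * card S"
  shows "\<exists>x\<in>S. card {h\<in>H. x \<in> h} < k"
proof (rule ccontr)
  assume "\<not> ?thesis"
  hence "k * card S \<le> (\<Sum>x\<in>S. card {h\<in>H. x \<in> h})"
    using sum_mono[of S "\<lambda>_. k" "\<lambda>x. card {h\<in>H. x \<in> h}"] by (simp add: not_less mult.commute)
  also have "\<dots> = (\<Sum>x\<in>S. \<Sum>h\<in>H. if x \<in> h then 1 else 0)"
    using assms(2) by (simp add: sum.If_cases Int_def)
  also have "\<dots> = (\<Sum>h\<in>H. \<Sum>x\<in>S. if x \<in> h then 1 else 0)"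
    by (rule sum.swap)
  also have "\<dots> = (\<Sum>h\<in>H. card {x\<in>S. x \<in> h})"
    using assms(1) by (simp add: sum.If_cases Int_def)
  also have "\<dots> = (\<Sum>h\<in>H. 2)"
  proof (rule sum.cong[OF refl])
    fix h assume "h \<in> H"
    hence "{x\<in>S. x \<in> h} = h" "card h = 2"
      using assms(3) by blast+
    thus "card {x\<in>S. x \<in> h} = 2"
      by simp
  qed
  finally show False
    using assms(4) by simp
qed

context cycle_faced_plane_graph
begin

abbreviation EG :: "entity set set" where "EG \<equiv> facial_entire_edges V E"

text \<open>The medial graph of \<open>G\<close> without multiple edges: distinct edges with a
  common vertex and a common face are consecutive on this face.\<close>

definition medial :: "complex set \<Rightarrow> complex set \<Rightarrow> bool" where
  "medial e e' \<longleftrightarrow> e \<in> E \<and> e' \<in> E \<and> facially_adjacent V E e e'"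

lemma medial_iff:
  "medial e e' \<longleftrightarrow> e \<in> E \<and> e' \<in> E \<and> e \<noteq> e' \<and> ends V e \<inter> ends V e' \<noteq> {} \<and> sides e \<inter> sides e' \<noteq> {}"
  unfolding medial_def facially_adjacent_def sides_def by blast

lemma medial_sym: "medial e e' \<Longrightarrow> medial e' e"
  unfolding medial_iff by blast

text \<open>Adjacent vertices and adjacent faces are both recorded by an edge of \<open>G\<close>,
  since an edge has just two ends and two sides.\<close>

lemma EG_cases:
  assumes "h \<in> EG"
  obtains e where "e \<in> E" "h = Vertex ` ends V e"
    | e e' where "medial e e'" "h = {Edge e, Edge e'}"
    | e where "e \<in> E" "h = Face ` sides e"
    | v e where "e \<in> E" "v \<in> ends V e" "h = {Vertex v, Edge e}"
    | v f where "corner v f" "h = {Vertex v, Face f}"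
    | e f where "e \<in> E" "f \<in> sides e" "h = {Edge e, Face f}"
proof -
  from assms have "h \<in> {{Vertex u, Vertex v} | u v. u \<in> V \<and> v \<in> V \<and> u \<noteq> v \<and> adjacent V E u v} \<or>
      h \<in> {{Edge e, Edge e'} | e e'. e \<in> E \<and> e' \<in> E \<and> facially_adjacent V E e e'} \<or>
      h \<in> {{Face f, Face f'} | f f'. f \<in> F \<and> f' \<in> F \<and> f \<noteq> f' \<and>
        (\<exists>e\<in>E. e \<subseteq> frontier f \<and> e \<subseteq> frontier f')} \<or>
      h \<in> {{Vertex v, Edge e} | v e. v \<in> V \<and> e \<in> E \<and> v \<in> ends V e} \<or>
      h \<in> {{Vertex v, Face f} | v f. v \<in> V \<and> f \<in> F \<and> v \<in> frontier f} \<or>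
      h \<in> {{Edge e, Face f} | e f. e \<in> E \<and> f \<in> F \<and> e \<subseteq> frontier f}"
    unfolding facial_entire_edges_def by (simp only: Un_iff disj_assoc)
  thus thesis
  proof (elim disjE)
    assume "h \<in> {{Vertex u, Vertex v} | u v. u \<in> V \<and> v \<in> V \<and> u \<noteq> v \<and> adjacent V E u v}"
    then obtain u v where "h = {Vertex u, Vertex v}" "adjacent V E u v"
      by (elim CollectE exE conjE)
    moreover from this obtain e where "e \<in> E" "ends V e = {u, v}"
      unfolding adjacent_def by (elim bexE)
    ultimately show thesis
      using that(1)[of e] by simp
  next
    assume "h \<in> {{Edge e, Edge e'} | e e'. e \<in> E \<and> e' \<in> E \<and> facially_adjacent V E e e'}"
    then obtain e e' where "h = {Edge e, Edge e'}" "medial e e'"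
      unfolding medial_def by (elim CollectE exE conjE) simp
    thus thesis
      using that(2) by simp
  next
    assume "h \<in> {{Face f, Face f'} | f f'. f \<in> F \<and> f' \<in> F \<and> f \<noteq> f' \<and>
        (\<exists>e\<in>E. e \<subseteq> frontier f \<and> e \<subseteq> frontier f')}"
    then obtain f f' e where c: "h = {Face f, Face f'}" "f \<in> F" "f' \<in> F" "f \<noteq> f'" "e \<in> E"
        "e \<subseteq> frontier f" "e \<subseteq> frontier f'"
      by (elim CollectE exE conjE bexE)
    have "{f, f'} \<subseteq> sides e"
      using c by (simp add: sides_def)
    hence "{f, f'} = sides e"
      using finite_sides[OF c(5)] card_sides[OF c(5)] c(4) by (intro card_seteq) auto
    hence "h = Face ` sides e"
      unfolding c(1) by (metis image_empty image_insert)
    thus thesis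
      using that(3) c(5) by simp
  next
    assume "h \<in> {{Vertex v, Edge e} | v e. v \<in> V \<and> e \<in> E \<and> v \<in> ends V e}"
    thus thesis
      by (elim CollectE exE conjE) (rule that(4))
  next
    assume "h \<in> {{Vertex v, Face f} | v f. v \<in> V \<and> f \<in> F \<and> v \<in> frontier f}"
    thus thesis
      by (elim CollectE exE conjE) (simp add: frontier_vertex_iff that(5))
  next
    assume "h \<in> {{Edge e, Face f} | e f. e \<in> E \<and> f \<in> F \<and> e \<subseteq> frontier f}"
    thus thesis
      by (elim CollectE exE conjE) (rule that(6), simp_all add: sides_def)
  qed
qed

lemma EG_pair:
  assumes "h \<in> EG"
  shows "card h = 2 \<and> h \<subseteq> entities"
  using assms
proof (cases rule: EG_cases)
  case (1 e)
  then show ?thesis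
    using card_ends[of e] ends_subset_V[of e] by (auto simp: entities_def card_image inj_on_def)
next
  case (2 e e')
  then show ?thesis by (simp add: medial_iff entities_def)
next
  case (3 e)
  then show ?thesis
    using card_sides[of e] sides_subset[of e] by (auto simp: entities_def card_image inj_on_def)
next
  case (4 v e)
  then show ?thesis using ends_subset_V[of e] by (auto simp: entities_def)
next
  case (5 v f)
  then show ?thesis using corner_mem[of v f] by (auto simp: entities_def)
next
  case (6 e f)
  then show ?thesis using sides_subset[of e] by (auto simp: entities_def)
qed

lemma finite_EG: "finite EG"
  using EG_pair finite_entities by (auto intro: finite_subset[of _ "Pow entities"])

text \<open>Crossings occur only between an edge and its own dual. Outside the duals of the edges in
  \<open>full\<close> the graph is planar, and \<open>card_full_le\<close> pays for these duals with
  corners.\<close>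

lemma vertex_face_degree:
  assumes S: "S \<subseteq> Vertex ` V \<union> Face ` F" "S \<noteq> {}"
  shows "\<exists>x\<in>S. card {h\<in>EG. x \<in> h \<and> h \<subseteq> S} \<le> 7"
proof -
  define A where "A = {v\<in>V. Vertex v \<in> S}"
  define B where "B = {f\<in>F. Face f \<in> S}"
  have S': "S = Vertex ` A \<union> Face ` B"
    using S by (auto simp: A_def B_def)
  define M where "M = {e\<in>E. ends V e \<subseteq> A}"
  define X where "X = {e\<in>E. sides e \<subseteq> B} - M"
  define full where "full = {e\<in>E. ends V e \<subseteq> A \<and> sides e \<subseteq> B}"
  \<comment> \<open>Two faces may share several edges. \<open>N\<close> represents each adjacent pair of faces by one shared edge
    outside \<open>M\<close>, if there is one; the pairs without such an edge are counted by \<open>full\<close>.\<close>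
  obtain N where N: "N \<subseteq> X" "inj_on sides N" "sides ` X = sides ` N"
    using subset_image_inj[of "sides ` X" sides X] by auto
  have fin: "finite M" "finite N" "finite full" "finite (corners A B)"
    using finite_E N(1) finite_corners unfolding M_def X_def full_def
    by (auto intro: finite_subset)
  define H where "H = {h\<in>EG. h \<subseteq> S}"
  have "H \<subseteq> ((\<lambda>e. Vertex ` ends V e) ` M \<union> (\<lambda>e. Face ` sides e) ` (N \<union> full)) \<union> corners A B"
  proof
    fix h assume h: "h \<in> H"
    hence hE: "h \<in> EG" and hS: "h \<subseteq> S"
      by (auto simp: H_def)
    have VA: "v \<in> A" if "Vertex v \<in> h" for v
      using that hS S' by blast
    have FB: "f \<in> B" if "Face f \<in> h" for f
      using that hS S' by blast
    have nE: "Edge e \<notin> h" for e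
      using hS S' by blast
    from hE show "h \<in> ((\<lambda>e. Vertex ` ends V e) ` M \<union> (\<lambda>e. Face ` sides e) ` (N \<union> full)) \<union> corners A B"
    proof (cases rule: EG_cases)
      case (1 e)
      then have "e \<in> M"
        using VA by (auto simp: M_def)
      then show ?thesis using 1 by blast
    next
      case (3 e)
      then have sB: "sides e \<subseteq> B"
        using FB by auto
      show ?thesis
      proof (cases "e \<in> M")
        case True
        then have "e \<in> full"
          using sB by (simp add: M_def full_def)
        then show ?thesis using 3 by blast
      next
        case False
        then have "sides e \<in> sides ` X"
          using sB 3(1) by (simp add: X_def)
        then obtain e' where "e' \<in> N" "sides e = sides e'"
          unfolding N(3) by blast
        then have "h \<in> (\<lambda>e. Face ` sides e) ` (N \<union> full)"
          using 3(2) by (intro image_eqI[of _ _ e']) simp_all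
        then show ?thesis by blast
      qed
    next
      case (5 v f)
      then show ?thesis
        using VA[of v] FB[of f] unfolding corners_def by blast
    qed (use nE in auto)
  qed
  hence "card H \<le> card ((\<lambda>e. Vertex ` ends V e) ` M \<union> (\<lambda>e. Face ` sides e) ` (N \<union> full) \<union> corners A B)"
    using fin by (intro card_mono) auto
  also have "\<dots> \<le> (card M + (card N + card full)) + card (corners A B)"
    by (intro order_trans[OF card_Un_le] add_mono card_image_le order_trans[OF card_image_le] fin
        finite_UnI order_refl card_Un_le)
  finally have cH: "card H \<le> card M + card N + card full + card (corners A B)"
    by simp
  have AB: "A \<subseteq> V" "B \<subseteq> F" "A \<noteq> {} \<or> B \<noteq> {}"
    subgoal by (auto simp: A_def)
    subgoal by (auto simp: B_def)
    subgoal using S(2) unfolding S' by blast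
    done
  have 1: "2 * card full \<le> card (corners A B)"
    unfolding full_def by (rule card_full_le)
  have "4 * (r + 2) \<le> 2 * r + 4 * s \<Longrightarrow> r + 4 \<le> 2 * s" for r s :: nat
    by presburger
  hence 2: "card (corners A B) + 1 \<le> card S \<or> card (corners A B) + 4 \<le> 2 * card S"
    using card_corners_le[OF AB] unfolding S' by blast
  have "N \<subseteq> {e\<in>E. sides e \<subseteq> B}" "M \<inter> N = {}"
    using N(1) by (auto simp: X_def)
  hence 3: "card (corners A B) + card M + card N + 1 \<le> card S \<or>
    card (corners A B) + card M + card N + 6 \<le> 3 * card S"
    unfolding S' using skeleton_bound[OF AB, of M N] N(2) by (simp add: M_def)
  have finS: "finite S"
    using S(1) finite_V finite_F by (auto intro: finite_subset)
  have "\<exists>x\<in>S. card {h\<in>H. x \<in> h} < 8"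
  proof (rule exists_degree_lt[OF finS])
    show "finite H"
      using finite_EG by (simp add: H_def)
    show "card h = 2 \<and> h \<subseteq> S" if "h \<in> H" for h
      using EG_pair that by (simp add: H_def)
    \<comment> \<open>With n = card S and c corners, the main case has card full <= c / 2 <= n - 2
      and c + card M + card N <= 3 n - 6, hence card H <= 4 n - 8. The alternatives for a single
      face also stay below 4 n.\<close>
    show "2 * card H < 8 * card S"
      using cH 1 2 3 by linarith
  qed
  moreover have "{h\<in>H. x \<in> h} = {h\<in>EG. x \<in> h \<and> h \<subseteq> S}" for x
    by (auto simp: H_def)
  ultimately obtain x where "x \<in> S" "card {h\<in>EG. x \<in> h \<and> h \<subseteq> S} < 8"
    by auto
  thus ?thesis
    by (intro bexI[of _ x]) simp_all
qed

section \<open>Degrees of edges and cycles in the medial graph\<close>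

definition around :: "complex \<Rightarrow> complex set set" where
  "around v = {e\<in>E. v \<in> ends V e}"

lemma finite_around: "finite (around v)"
  using finite_E by (simp add: around_def)

lemma medial_around_eq:
  assumes e: "e \<in> around v"
  shows "{e'\<in>around v. medial e e'} = (\<Union>f\<in>sides e. {e'\<in>E. v \<in> ends V e' \<and> f \<in> sides e'} - {e})"
  using e unfolding around_def medial_iff by blast

lemma card_corner_others:
  assumes "e \<in> around v" "f \<in> sides e"
  shows "card ({e'\<in>E. v \<in> ends V e' \<and> f \<in> sides e'} - {e}) = 1"
proof -
  have "corner v f" "e \<in> {e'\<in>E. v \<in> ends V e' \<and> f \<in> sides e'}"
    using assms cornerI by (auto simp: around_def)
  thus ?thesis
    using card_corner_edges by simp
qed

text \<open>Each side of \<open>e\<close> contributes one further edge at \<open>v\<close>. It is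
  only an upper bound, as both sides may contribute the same edge.\<close>

lemma card_medial_around_le:
  assumes e: "e \<in> around v"
  shows "card {e'\<in>around v. medial e e'} \<le> 2"
proof -
  have eE: "e \<in> E"
    using e by (simp add: around_def)
  have "card {e'\<in>around v. medial e e'} \<le>
      (\<Sum>f\<in>sides e. card ({e'\<in>E. v \<in> ends V e' \<and> f \<in> sides e'} - {e}))"
    unfolding medial_around_eq[OF e] using finite_sides[OF eE] by (rule card_UN_le)
  also have "\<dots> = (\<Sum>f\<in>sides e. 1)"
    using card_corner_others[OF e] by (intro sum.cong) auto
  also have "\<dots> = 2"
    using card_sides[OF eE] by simp
  finally show ?thesis .
qed

lemma medial_subset_around:
  assumes "ends V e = {x, y}"
  shows "{e'. medial e e'} \<subseteq> {e'\<in>around x. medial e e'} \<union> {e'\<in>around y. medial e e'}"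
  using assms unfolding medial_iff around_def by auto

lemma edge_degree_le:
  assumes e: "e \<in> E" and xy: "ends V e = {x, y}"
  shows "card {h\<in>EG. Edge e \<in> h} \<le> card {e'\<in>around x. medial e e'} + card {e'\<in>around y. medial e e'} + 4"
proof -
  define M where "M = {e'\<in>around x. medial e e'} \<union> {e'\<in>around y. medial e e'}"
  have finM: "finite M"
    using finite_around by (simp add: M_def)
  have "{h\<in>EG. Edge e \<in> h} \<subseteq> (\<lambda>e'. {Edge e, Edge e'}) ` M \<union>
      (\<lambda>v. {Vertex v, Edge e}) ` ends V e \<union> (\<lambda>f. {Edge e, Face f}) ` sides e"
  proof
    fix h assume "h \<in> {h\<in>EG. Edge e \<in> h}"
    hence h: "h \<in> EG" "Edge e \<in> h"
      by simp_all
    from h(1) show "h \<in> (\<lambda>e'. {Edge e, Edge e'}) ` M \<union>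
      (\<lambda>v. {Vertex v, Edge e}) ` ends V e \<union> (\<lambda>f. {Edge e, Face f}) ` sides e"
    proof (cases rule: EG_cases)
      case (2 e1 e2)
      then consider "e1 = e" | "e2 = e"
        using h(2) by auto
      then obtain e' where "medial e e'" "h = {Edge e, Edge e'}"
        using 2 medial_sym by cases (auto simp: insert_commute)
      moreover have "e' \<in> M"
        using medial_subset_around[OF xy] \<open>medial e e'\<close> by (auto simp: M_def)
      ultimately show ?thesis by blast
    next
      case (4 v e1)
      then show ?thesis using h(2) by auto
    next
      case (6 e1 f)
      then show ?thesis using h(2) by auto
    qed (use h(2) in auto)
  qed
  hence "card {h\<in>EG. Edge e \<in> h} \<le> card ((\<lambda>e'. {Edge e, Edge e'}) ` M \<union>
      (\<lambda>v. {Vertex v, Edge e}) ` ends V e \<union> (\<lambda>f. {Edge e, Face f}) ` sides e)"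
    using finM finite_ends finite_sides[OF e] by (intro card_mono) auto
  also have "\<dots> \<le> card M + card (ends V e) + card (sides e)"
    by (intro order_trans[OF card_Un_le] add_mono card_image_le finM finite_ends finite_sides e)
  also have "\<dots> \<le> card {e'\<in>around x. medial e e'} + card {e'\<in>around y. medial e e'} + 4"
    using card_Un_le[of "{e'\<in>around x. medial e e'}" "{e'\<in>around y. medial e e'}"]
      card_ends[OF e] card_sides[OF e] by (simp add: M_def)
  finally show ?thesis .
qed

text \<open>The 6 consists of two ends, two sides and at most two neighbours at the other end.
  Conversely, degree 8 forces two medial neighbours around \<open>x\<close>.\<close>

lemma edge_degree:
  assumes e: "e \<in> around x"
  shows "card {h\<in>EG. Edge e \<in> h} \<le> card {e'\<in>around x. medial e e'} + 6"
proof -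
  have eE: "e \<in> E" and x: "x \<in> ends V e"
    using e by (simp_all add: around_def)
  obtain y where y: "ends V e = {x, y}"
    using card_2_other[OF card_ends[OF eE] x] by (elim exE conjE)
  have "e \<in> around y"
    using eE y by (simp add: around_def)
  thus ?thesis
    using edge_degree_le[OF eE y] card_medial_around_le[of e y] by linarith
qed

lemma edge_degree_le_8: "e \<in> E \<Longrightarrow> card {h\<in>EG. Edge e \<in> h} \<le> 8"
proof -
  assume e: "e \<in> E"
  then obtain x where "x \<in> ends V e"
    using card_ends[OF e] by fastforce
  hence "e \<in> around x"
    using e by (simp add: around_def)
  thus ?thesis
    using edge_degree card_medial_around_le by fastforce
qed

text \<open>The edges already have the face \<open>f\<close> in common, so only a common vertex
  matters, and on a simple cycle this means being consecutive.\<close>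

lemma cycle_medial:
  assumes C: "simple_cycle V E vs es" "set es = {e\<in>E. f \<in> sides e}" and uv: "u \<in> set es" "v \<in> set es"
  shows "medial u v \<longleftrightarrow> {u, v} \<in> cycle_edges es"
proof -
  let ?n = "length vs"
  have n: "3 \<le> ?n" "distinct vs" "length es = ?n"
    using C(1) by (auto simp: simple_cycle_def)
  have lt: "Suc i mod ?n < ?n" for i
    using n(1) by (auto intro: mod_less_divisor)
  have de: "distinct es"
    by (rule cycle_distinct[OF C(1)])
  obtain i j where i: "i < ?n" "u = es ! i" and j: "j < ?n" "v = es ! j"
    using uv n(3) by (metis in_set_conv_nth)
  have common: "u \<in> E" "v \<in> E" "f \<in> sides u" "f \<in> sides v"
    using uv C(2) by auto
  have nth: "vs ! k = vs ! l \<longleftrightarrow> k = l" if "k < ?n" "l < ?n" for k l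
    using nth_eq_iff_index_eq[OF n(2) that] .
  have nthe: "es ! k = es ! l \<longleftrightarrow> k = l" if "k < ?n" "l < ?n" for k l
    using nth_eq_iff_index_eq[OF de] that n(3) by simp
  have suc: "Suc i mod ?n = Suc j mod ?n \<longleftrightarrow> i = j"
    using i(1) j(1) by (auto simp: mod_Suc)
  have self: "Suc k mod ?n \<noteq> k" if "k < ?n" for k
    using that n(1) by (auto simp: mod_Suc)
  have "ends V u \<inter> ends V v \<noteq> {} \<longleftrightarrow> i = j \<or> i = Suc j mod ?n \<or> Suc i mod ?n = j \<or> Suc i mod ?n = Suc j mod ?n"
    unfolding i(2) j(2) cycle_edge(2)[OF C(1) i(1)] cycle_edge(2)[OF C(1) j(1)]
    using nth[OF i(1) j(1)] nth[OF i(1) lt[of j]] nth[OF lt[of i] j(1)] nth[OF lt[of i] lt[of j]]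
    by auto
  hence "medial u v \<longleftrightarrow> i \<noteq> j \<and> (i = Suc j mod ?n \<or> Suc i mod ?n = j)"
    unfolding medial_iff using common nthe[OF i(1) j(1)] suc i(2) j(2) by blast
  also have "\<dots> \<longleftrightarrow> (i = Suc j mod ?n \<or> Suc i mod ?n = j)"
    using self[OF i(1)] self[OF j(1)] by metis
  also have "\<dots> \<longleftrightarrow> {u, v} \<in> cycle_edges es"
  proof -
    have "es \<noteq> []"
      using n by auto
    have eqk: "{es ! i, es ! j} = {es ! k, es ! (Suc k mod ?n)} \<longleftrightarrow>
        (i = k \<and> j = Suc k mod ?n) \<or> (i = Suc k mod ?n \<and> j = k)" if k: "k < ?n" for k
      unfolding doubleton_eq_iff nthe[OF i(1) k] nthe[OF j(1) k] nthe[OF i(1) lt[of k]]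
        nthe[OF j(1) lt[of k]] ..
    have "{u, v} \<in> cycle_edges es \<longleftrightarrow> (\<exists>k. k < ?n \<and> {es ! i, es ! j} = {es ! k, es ! (Suc k mod ?n)})"
      unfolding i(2) j(2) cycle_edges_nth[OF \<open>es \<noteq> []\<close>] n(3) mem_Collect_eq
      by (rule ex_cong1) (rule conj_commute)
    also have "\<dots> \<longleftrightarrow> (\<exists>k. k < ?n \<and> ((i = k \<and> j = Suc k mod ?n) \<or> (i = Suc k mod ?n \<and> j = k)))"
      by (rule ex_cong1, rule conj_cong[OF refl], rule eqk)
    also have "\<dots> \<longleftrightarrow> (i = Suc j mod ?n \<or> Suc i mod ?n = j)"
      using i(1) j(1) by blast
    finally show ?thesis by simp
  qed
  finally show ?thesis .
qed

text \<open>A set closed under facial adjacency contains all edges of any face that it meets,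
  because consecutive edges are adjacent. By \<open>faces_connected\<close> it meets every
  face.\<close>

lemma medial_connected:
  assumes D: "D \<subseteq> E" "D \<noteq> {}" "D \<noteq> E"
  shows "\<exists>e\<in>D. \<exists>e'\<in>E - D. medial e e'"
proof (rule ccontr)
  assume "\<not> ?thesis"
  hence closed: "\<And>e e'. e \<in> D \<Longrightarrow> e' \<in> E \<Longrightarrow> medial e e' \<Longrightarrow> e' \<in> D"
    by blast
  have face: "e' \<in> D" if e: "e \<in> D" "f \<in> sides e" and e': "e' \<in> E" "f \<in> sides e'" for e e' f
  proof -
    have fF: "f \<in> F"
      using sides_subset e by blast
    obtain vs es where C: "simple_cycle V E vs es" "set es = {e\<in>E. f \<in> sides e}"
      using face_cycle_sides[OF fF] by (elim exE conjE)
    have n: "length es = length vs" "3 \<le> length vs"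
      using C(1) by (auto simp: simple_cycle_def)
    have "e \<in> set es" "e' \<in> set es"
      using e e' C(2) D(1) by auto
    then obtain i k where i: "i < length vs" "e = es ! i" and k: "k < length vs" "e' = es ! k"
      by (metis in_set_conv_nth n(1))
    have "es ! k \<in> D"
    proof (rule cyclic_induct[OF i(1) _ _ k(1)])
      show "es ! i \<in> D"
        using e i by simp
      fix j assume j: "j < length vs" "es ! j \<in> D"
      have lt: "Suc j mod length vs < length vs"
        using n(2) by (auto intro: mod_less_divisor)
      have "es \<noteq> []"
        using n by auto
      hence "{es ! j, es ! (Suc j mod length vs)} \<in> cycle_edges es"
        unfolding cycle_edges_nth[OF \<open>es \<noteq> []\<close>] n(1) using j(1) by blast
      hence "medial (es ! j) (es ! (Suc j mod length vs))"
        using cycle_medial[OF C] lt j(1) n(1) by simp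
      thus "es ! (Suc j mod length vs) \<in> D"
        using closed[OF j(2)] medial_iff by blast
    qed
    thus ?thesis
      using k(2) by simp
  qed
  define Y where "Y = {f. \<exists>e\<in>D. f \<in> sides e}"
  have YF: "Y \<subseteq> F"
    unfolding Y_def using sides_subset by blast
  obtain e0 where "e0 \<in> D"
    using D(2) by blast
  hence "sides e0 \<noteq> {}"
    using card_sides[of e0] D(1) by auto
  hence "Y \<noteq> {}"
    using \<open>e0 \<in> D\<close> unfolding Y_def by blast
  moreover have inY: "e \<in> D" if e: "e \<in> E" "sides e \<inter> Y \<noteq> {}" for e
  proof -
    obtain f e1 where f: "f \<in> sides e" "e1 \<in> D" "f \<in> sides e1"
      using e(2) unfolding Y_def by blast
    thus ?thesis
      using face[OF f(2,3) e(1) f(1)] by blast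
  qed
  moreover have "sides e \<subseteq> Y" if "e \<in> D" for e
    using that unfolding Y_def by blast
  ultimately have "Y = F"
    using faces_connected[OF YF] by blast
  have "E \<subseteq> D"
  proof
    fix e assume e: "e \<in> E"
    hence "sides e \<noteq> {}"
      using card_sides[OF e] by auto
    thus "e \<in> D"
      using inY[OF e] \<open>Y = F\<close> sides_subset[of e] by blast
  qed
  thus False
    using D by blast
qed

text \<open>Since all degrees are 8, the edges around \<open>x\<close> form a 2-regular graph, which
  yields the chordless cycle \<open>c\<close>. A face \<open>f\<close> at \<open>x\<close> has two
  edges \<open>e1\<close> and \<open>e2\<close> there, both on \<open>c\<close>. The rest of its
  boundary avoids \<open>x\<close> and joins neighbours of \<open>e2\<close> and \<open>e1\<close>
  off the cycle.\<close>

lemma medial_theta: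
  assumes deg: "\<forall>e\<in>E. 8 \<le> card {h\<in>EG. Edge e \<in> h}"
  shows "\<exists>a b p1 p2 p3 K. distinct (a # b # p1 @ p2 @ p3) \<and> (p1 \<noteq> [] \<or> p2 \<noteq> []) \<and> p3 \<noteq> [] \<and>
    K = {a, b} \<union> set p1 \<union> set p2 \<union> set p3 \<and> K \<subseteq> E \<and>
    (\<forall>u\<in>K. \<forall>v\<in>K. medial u v \<longleftrightarrow>
      {u, v} \<in> path_edges (a # p1 @ [b]) \<union> path_edges (a # p2 @ [b]) \<union> path_edges (a # p3 @ [b]))"
proof -
  obtain e0 where e0: "e0 \<in> E"
    using edges_nonempty by blast
  then obtain x where x: "x \<in> ends V e0"
    using card_ends[OF e0] by fastforce
  have two: "card {e'\<in>around x. medial e e'} = 2" if e: "e \<in> around x" for e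
  proof -
    have "e \<in> E"
      using e by (simp add: around_def)
    thus ?thesis
      using bspec[OF deg, of e] edge_degree[OF e] card_medial_around_le[OF e] by linarith
  qed
  have ne: "around x \<noteq> {}"
    using e0 x by (auto simp: around_def)
  have irr: "\<not> medial e e" for e
    by (simp add: medial_iff)
  have "\<exists>c. distinct c \<and> set c \<subseteq> around x \<and> 3 \<le> length c \<and>
      (\<forall>u\<in>set c. \<forall>v\<in>around x. medial u v \<longleftrightarrow> {u, v} \<in> cycle_edges c)"
    by (rule two_regular_cycle[OF finite_around ne]) (fact medial_sym irr two)+
  then obtain c where c: "distinct c" "set c \<subseteq> around x" "3 \<le> length c"
      "\<forall>u\<in>set c. \<forall>v\<in>around x. medial u v \<longleftrightarrow> {u, v} \<in> cycle_edges c"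
    by (elim exE conjE)
  have cyc_sub: "v \<in> set c" if "{u, v} \<in> cycle_edges c" for u v
  proof -
    have "{u, v} \<subseteq> set (c @ [hd c])"
      using that unfolding cycle_edges_def by (rule path_edges_subset)
    thus ?thesis
      using c(3) by (cases c) auto
  qed
  define e1 where "e1 = hd c"
  have e1: "e1 \<in> set c" "e1 \<in> around x" "e1 \<in> E" "x \<in> ends V e1"
    using c(2,3) unfolding e1_def around_def by (cases c; auto)+
  have "sides e1 \<noteq> {}"
    using card_sides[OF e1(3)] by auto
  then obtain f where f: "f \<in> sides e1" "f \<in> F"
    using sides_subset[of e1] by blast
  obtain vs es where C: "simple_cycle V E vs es" "set es = {e\<in>E. f \<in> sides e}"
    using face_cycle_sides[OF f(2)] by (elim exE conjE)
  have n: "distinct es" "3 \<le> length es"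
    using cycle_distinct[OF C(1)] C(1) by (auto simp: simple_cycle_def)
  have corner_xf: "corner x f"
    using cornerI e1 f by blast
  have e1_mem: "e1 \<in> {e\<in>E. x \<in> ends V e \<and> f \<in> sides e}"
    using e1 f by blast
  obtain e2 where e2: "{e\<in>E. x \<in> ends V e \<and> f \<in> sides e} = {e1, e2}" "e1 \<noteq> e2"
    using card_2_other[OF card_corner_edges[OF corner_xf] e1_mem] by (elim exE conjE)
  have "e2 \<in> {e\<in>E. x \<in> ends V e \<and> f \<in> sides e}"
    unfolding e2(1) by simp
  hence e2m: "e2 \<in> E" "x \<in> ends V e2" "f \<in> sides e2"
    by simp_all
  have e12: "e1 \<in> set es" "e2 \<in> set es"
    using e1 f e2m by (simp_all add: C(2))
  have med12: "medial e1 e2"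
    unfolding medial_iff using e1 e2m f e2(2) by blast
  have "e2 \<in> around x"
    using e2m by (simp add: around_def)
  hence e2c: "e2 \<in> set c"
    using c(4) e1(1) med12 cyc_sub by blast
  obtain r where r: "set (e1 # r) = set es" "distinct (e1 # r)" "length (e1 # r) = length es"
      "cycle_edges (e1 # r) = cycle_edges es"
    using rotate_to_front[OF e12(1)] n(1) by (elim exE conjE) simp
  have rne: "r \<noteq> []"
    using r(3) n(2) by auto
  have "{e1, e2} \<in> cycle_edges (e1 # r)"
    unfolding r(4) using cycle_medial[OF C e12] med12 by blast
  moreover have "{e1, e2} \<notin> path_edges r"
    using path_edges_subset[of "{e1, e2}" r] r(2) by auto
  ultimately have "e2 = hd r \<or> e2 = last r"
    unfolding cycle_edges_Cons[OF rne] using e2(2) by (auto simp: doubleton_eq_iff)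
  \<comment> \<open>The cycle is read in the direction in which \<open>e2\<close> follows
    \<open>e1\<close>; the remainder \<open>q\<close> consists of the boundary edges of
    \<open>f\<close> that avoid \<open>x\<close>.\<close>
  hence "\<exists>q. set (e1 # e2 # q) = set es \<and> distinct (e1 # e2 # q) \<and> length (e1 # e2 # q) = length es \<and>
      cycle_edges (e1 # e2 # q) = cycle_edges es"
  proof
    assume "e2 = hd r"
    then obtain q where q: "r = e2 # q"
      using rne by (cases r) auto
    show ?thesis
      using r unfolding q by blast
  next
    assume "e2 = last r"
    then obtain q where q: "rev r = e2 # q"
      using rne by (metis hd_rev hd_Cons_tl rev_is_Nil_conv)
    have "set (e1 # rev r) = set es" "distinct (e1 # rev r)" "length (e1 # rev r) = length es"
      "cycle_edges (e1 # rev r) = cycle_edges es"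
      using r by (simp_all add: cycle_edges_reverse_tail)
    thus ?thesis
      unfolding q by blast
  qed
  then obtain q where q: "set (e1 # e2 # q) = set es" "distinct (e1 # e2 # q)"
      "length (e1 # e2 # q) = length es" "cycle_edges (e1 # e2 # q) = cycle_edges es"
    by (elim exE conjE)
  have qne: "q \<noteq> []"
    using q(3) n(2) by auto
  have q_es: "z \<in> set es" "z \<noteq> e1" "z \<noteq> e2" if "z \<in> set q" for z
    using that q(1,2) by auto
  have q_off: "z \<in> E" "x \<notin> ends V z" if z: "z \<in> set q" for z
  proof -
    have zz: "z \<in> E" "f \<in> sides z"
      using q_es(1)[OF z] unfolding C(2) by simp_all
    show "z \<in> E" by fact
    show "x \<notin> ends V z"
    proof
      assume "x \<in> ends V z"
      hence "z \<in> {e1, e2}"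
        unfolding e2(1)[symmetric] using zz by simp
      thus False
        using q_es(2,3)[OF z] by simp
    qed
  qed
  have path: "cycle_edges (e1 # e2 # q) = path_edges ([e1, e2] @ q @ [e1])"
    by (simp add: cycle_edges_def)
  have med_q: "medial u v \<longleftrightarrow> {u, v} \<in> path_edges q" if uv: "u \<in> set q" "v \<in> set q" for u v
  proof -
    have "{u, v} \<inter> (set [e1, e2] \<union> set [e1]) = {}"
      using q_es uv by auto
    hence "{u, v} \<in> cycle_edges es \<longleftrightarrow> {u, v} \<in> path_edges q"
      using path_edges_infix[of u v "[e1, e2]" q "[e1]"] path_edges_mono_infix[of q "[e1, e2]" "[e1]"]
      unfolding q(4)[symmetric] path by blast
    thus ?thesis
      using cycle_medial[OF C] uv q_es by blast
  qed
  have "{e2, hd q} \<in> cycle_edges es" "{last q, e1} \<in> cycle_edges es"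
    unfolding q(4)[symmetric] path using qne
    by (simp_all add: path_edges_Cons[of e2] path_edges_snoc)
  hence "medial e2 (hd q)" "medial (last q) e1"
    using cycle_medial[OF C e12(2) q_es(1)[OF hd_in_set[OF qne]]]
      cycle_medial[OF C q_es(1)[OF last_in_set[OF qne]] e12(1)] by simp_all
  hence ends_q: "medial (hd q) e2" "medial (last q) e1"
    using medial_sym by blast+
  \<comment> \<open>An edge of \<open>c\<close> contains \<open>x\<close>, so it can meet
    \<open>z\<close> only in the other end. As \<open>G\<close> has no parallel edges, there is at
    most one such edge for each of the two ends of \<open>z\<close>.\<close>
  have nb: "card {y\<in>set c. medial z y} \<le> 2" if z: "z \<in> set q" for z
  proof -
    obtain s t where st: "ends V z = {s, t}"
      using card_ends[OF q_off(1)[OF z]] unfolding card_2_iff by (elim exE conjE)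
    have "ends V ` {y\<in>set c. medial z y} \<subseteq> {{x, s}, {x, t}}"
    proof
      fix d assume "d \<in> ends V ` {y\<in>set c. medial z y}"
      then obtain y where y: "d = ends V y" "y \<in> set c" "medial z y"
        by blast
      have yE: "y \<in> E" "x \<in> ends V y"
        using y(2) c(2) by (auto simp: around_def)
      obtain x' where x': "ends V y = {x, x'}"
        using card_2_other[OF card_ends[OF yE(1)] yE(2)] by (elim exE conjE)
      have "{s, t} \<inter> {x, x'} \<noteq> {}" "x \<notin> {s, t}"
        using y(3) q_off(2)[OF z] unfolding medial_iff st x' by simp_all
      hence "x' = s \<or> x' = t"
        by auto
      thus "d \<in> {{x, s}, {x, t}}"
        unfolding y(1) x' by auto
    qed
    moreover have "inj_on (ends V) {y\<in>set c. medial z y}"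
      using ends_inj by (auto simp: inj_on_def medial_iff)
    ultimately have "card {y\<in>set c. medial z y} \<le> card {{x, s}, {x, t}}"
      by (intro card_inj_on_le) auto
    also have "\<dots> \<le> 2"
      by (simp add: card_insert_if)
    finally show ?thesis .
  qed
  have cE: "set c \<subseteq> E"
    using c(2) by (auto simp: around_def)
  have qc: "set q \<inter> set c = {}"
    using q_off c(2) by (auto simp: around_def)
  have c4: "medial u v \<longleftrightarrow> {u, v} \<in> cycle_edges c" if "u \<in> set c" "v \<in> set c" for u v
    using c(2,4) that by blast
  have dq: "distinct q"
    using q(2) by simp
  have nb': "\<forall>z\<in>set q. card {y\<in>set c. medial z y} \<le> 2"
    using nb by blast
  have "\<exists>a b p1 p2 p3 K. distinct (a # b # p1 @ p2 @ p3) \<and> (p1 \<noteq> [] \<or> p2 \<noteq> []) \<and> p3 \<noteq> [] \<and>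
    K = {a, b} \<union> set p1 \<union> set p2 \<union> set p3 \<and> K \<subseteq> set c \<union> set q \<and>
    (\<forall>u\<in>K. \<forall>v\<in>K. medial u v \<longleftrightarrow>
      {u, v} \<in> path_edges (a # p1 @ [b]) \<union> path_edges (a # p2 @ [b]) \<union> path_edges (a # p3 @ [b]))"
    by (rule induced_theta[OF _ c(1,3) _ dq qne qc _ nb' e2c e1(1) e2(2)[symmetric] ends_q])
      (fact medial_sym c4 med_q)+
  moreover have "K \<subseteq> E" if "K \<subseteq> set c \<union> set q" for K
    using that cE q_off(1) by blast
  ultimately show ?thesis
    by meson
qed

section \<open>Assembling the monomial of the facial entire graph\<close>

lemma medial_EG: "medial e e' \<Longrightarrow> {Edge e, Edge e'} \<in> EG"
  unfolding medial_def facial_entire_edges_def Un_iff mem_Collect_eq by blast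

lemma initial_set:
  "\<exists>K. K \<subseteq> E \<and> K \<noteq> {} \<and> orientable_within EG 7 (Edge ` K)"
proof (cases "\<exists>e\<in>E. card {h\<in>EG. Edge e \<in> h} \<le> 7")
  case True
  then obtain e where "e \<in> E" "card {h\<in>EG. Edge e \<in> h} \<le> 7"
    by blast
  then show ?thesis
    using orientable_within_singleton[of EG "Edge e" 7] EG_pair finite_EG
    by (intro exI[of _ "{e}"]) auto
next
  case False
  have deg: "8 \<le> card {h\<in>EG. Edge e \<in> h}" if "e \<in> E" for e
  proof -
    have "\<not> card {h\<in>EG. Edge e \<in> h} \<le> 7"
      using False that by blast
    thus ?thesis by linarith
  qed
  hence "\<forall>e\<in>E. 8 \<le> card {h\<in>EG. Edge e \<in> h}"
    by blast
  note theta = medial_theta[OF this]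
  obtain a b p q r K where th: "distinct (a # b # p @ q @ r)" "p \<noteq> [] \<or> q \<noteq> []" "r \<noteq> []"
    "K = {a, b} \<union> set p \<union> set q \<union> set r" "K \<subseteq> E"
    "\<forall>u\<in>K. \<forall>v\<in>K. medial u v \<longleftrightarrow>
      {u, v} \<in> path_edges (a # p @ [b]) \<union> path_edges (a # q @ [b]) \<union> path_edges (a # r @ [b])"
    using theta by (elim exE conjE)
  define T where "T = path_edges (a # p @ [b]) \<union> path_edges (a # q @ [b]) \<union> path_edges (a # r @ [b])"
  have TK: "h \<subseteq> K" if "h \<in> T" for h
    using that path_edges_subset[of h "a # p @ [b]"] path_edges_subset[of h "a # q @ [b]"]
      path_edges_subset[of h "a # r @ [b]"] unfolding T_def th(4) by auto
  have Tpair: "\<exists>u v. h = {u, v}" if "h \<in> T" for h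
    using that unfolding T_def path_edges_nth by blast
  have img: "path_edges (Edge a # map Edge p @ [Edge b]) = (`) Edge ` path_edges (a # p @ [b])" for p
    using path_edges_map[of Edge "a # p @ [b]"] by simp
  \<comment> \<open>On edges of \<open>G\<close> the facial entire graph induces the medial graph,
    so the theta graph remains induced.\<close>
  have HK: "{h\<in>EG. h \<subseteq> Edge ` K} = (`) Edge ` T"
  proof
    show "{h\<in>EG. h \<subseteq> Edge ` K} \<subseteq> (`) Edge ` T"
    proof
      fix h assume "h \<in> {h\<in>EG. h \<subseteq> Edge ` K}"
      hence h: "h \<in> EG" "h \<subseteq> Edge ` K"
        by simp_all
      have "\<exists>u v. medial u v \<and> h = {Edge u, Edge v}"
        using h(1)
      proof (cases rule: EG_cases)
        case (1 e)
        have "ends V e \<noteq> {}"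
          using card_ends[OF 1(1)] by auto
        hence False
          using h(2) unfolding 1(2) by auto
        then show ?thesis ..
      next
        case (2 e e')
        then show ?thesis by (intro exI conjI)
      next
        case (3 e)
        have "sides e \<noteq> {}"
          using card_sides[OF 3(1)] by auto
        hence False
          using h(2) unfolding 3(2) by auto
        then show ?thesis ..
      next
        case (4 v e)
        then have False
          using h(2) by auto
        then show ?thesis ..
      next
        case (5 v f)
        then have False
          using h(2) by auto
        then show ?thesis ..
      next
        case (6 e f)
        then have False
          using h(2) by auto
        then show ?thesis ..
      qed
      then obtain u v where uv: "medial u v" "h = {Edge u, Edge v}"
        by (elim exE conjE)
      have "u \<in> K" "v \<in> K"
        using h(2) uv(2) by auto
      hence "{u, v} \<in> T"
        using th(6) uv(1) unfolding T_def by blast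
      moreover have "h = Edge ` {u, v}"
        by (simp add: uv(2))
      ultimately show "h \<in> (`) Edge ` T"
        by blast
    qed
    show "(`) Edge ` T \<subseteq> {h\<in>EG. h \<subseteq> Edge ` K}"
    proof
      fix h assume "h \<in> (`) Edge ` T"
      then obtain t where t: "t \<in> T" "h = Edge ` t"
        by blast
      obtain u v where uv: "t = {u, v}"
        using Tpair[OF t(1)] by (elim exE)
      have "u \<in> K" "v \<in> K"
        using TK[OF t(1)] uv by auto
      hence "medial u v"
        using th(6) t(1) unfolding T_def uv by blast
      hence "h \<in> EG"
        using medial_EG unfolding t(2) uv by simp
      thus "h \<in> {h\<in>EG. h \<subseteq> Edge ` K}"
        using TK[OF t(1)] t(2) by auto
    qed
  qed
  have "orientable_within EG 7 (Edge ` K)"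
  proof (rule orientable_within_theta[OF finite_EG])
    have "distinct (map Edge (a # b # p @ q @ r))"
      using th(1) by (subst distinct_map) (auto simp: inj_on_def)
    thus "distinct (Edge a # Edge b # map Edge p @ map Edge q @ map Edge r)"
      by simp
    show "Edge ` K = {Edge a, Edge b} \<union> set (map Edge p) \<union> set (map Edge q) \<union> set (map Edge r)"
      unfolding th(4) by auto
    show "{h \<in> EG. h \<subseteq> Edge ` K} = path_edges (Edge a # map Edge p @ [Edge b]) \<union>
      path_edges (Edge a # map Edge q @ [Edge b]) \<union> path_edges (Edge a # map Edge r @ [Edge b])"
      unfolding HK T_def img by (simp only: image_Un)
    show "card {h \<in> EG. y \<in> h} \<le> Suc 7" if "y \<in> Edge ` K" for y
      using that th(5) edge_degree_le_8 by auto
  qed (use th(2,3) in auto)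
  then show ?thesis
    using th(4,5) by (intro exI[of _ K]) auto
qed

text \<open>By \<open>medial_connected\<close> the next edge can be chosen adjacent to one in
  \<open>K\<close>, and of its at most 8 neighbours at most 7 are then still to come.\<close>

lemma orientable_edges:
  assumes "K \<subseteq> E" "K \<noteq> {}" "orientable_within EG 7 (Edge ` K)"
  shows "orientable_within EG 7 (Edge ` E)"
  using assms
proof (induction "card (E - K)" arbitrary: K)
  case 0
  hence "K = E"
    using finite_E by auto
  then show ?case using 0 by simp
next
  case (Suc n)
  have "K \<noteq> E"
    using Suc.hyps(2) by auto
  then obtain e' e where e: "e' \<in> K" "e \<in> E - K" "medial e' e"
    using medial_connected Suc.prems(1,2) by blast
  have "card {h\<in>EG. Edge e \<in> h \<and> \<not> h \<subseteq> insert (Edge e) (Edge ` K)} \<le>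
      card ({h\<in>EG. Edge e \<in> h} - {{Edge e', Edge e}})"
    using finite_EG e(1) by (intro card_mono) auto
  also have "\<dots> = card {h\<in>EG. Edge e \<in> h} - 1"
    using medial_EG[OF e(3)] by (intro card_Diff_singleton) simp
  also have "\<dots> \<le> 7"
    using edge_degree_le_8[of e] e(2) by simp
  finally have "orientable_within EG 7 (insert (Edge e) (Edge ` K))"
    using Suc.prems(3) e(2) EG_pair finite_EG
    by (intro orientable_within_insert) auto
  hence "orientable_within EG 7 (Edge ` insert e K)"
    by simp
  moreover have "n = card (E - insert e K)"
  proof -
    have "E - insert e K = (E - K) - {e}"
      by blast
    thus ?thesis
      using Suc.hyps(2) e(2) by simp
  qed
  ultimately show ?case
    using Suc.hyps(1)[of "insert e K"] Suc.prems(1) e(2) by blast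
qed

text \<open>\<open>S\<close> consists of the elements still to be added. The neighbours that come
  after \<open>x\<close> are those in \<open>S\<close>, and \<open>vertex_face_degree\<close>
  provides an \<open>x\<close> with at most 7 of them.\<close>

lemma orientable_entities:
  assumes "S \<subseteq> Vertex ` V \<union> Face ` F" "orientable_within EG 7 (entities - S)"
  shows "orientable_within EG 7 entities"
  using assms
proof (induction "card S" arbitrary: S)
  case 0
  have "finite S"
    using 0(2) finite_V finite_F by (auto intro: finite_subset)
  hence "S = {}"
    using 0(1) by simp
  then show ?case using 0 by simp
next
  case (Suc n)
  have "S \<noteq> {}"
    using Suc.hyps(2) by auto
  then obtain x where x: "x \<in> S" "card {h\<in>EG. x \<in> h \<and> h \<subseteq> S} \<le> 7"
    using vertex_face_degree[OF Suc.prems(1)] by blast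
  have Sent: "S \<subseteq> entities"
    using Suc.prems(1) by (auto simp: entities_def)
  have eq: "insert x (entities - S) = entities - (S - {x})"
    using x(1) Sent by blast
  have "h \<subseteq> S" if h: "h \<in> EG" "x \<in> h" "\<not> h \<subseteq> insert x (entities - S)" for h
  proof -
    have hc: "card h = 2" "h \<subseteq> entities"
      using EG_pair[OF h(1)] by simp_all
    obtain y where y: "h = {x, y}"
      using card_2_other[OF hc(1) h(2)] by (elim exE conjE)
    show ?thesis
      using h(3) hc(2) x(1) unfolding y by blast
  qed
  hence "{h\<in>EG. x \<in> h \<and> \<not> h \<subseteq> insert x (entities - S)} \<subseteq> {h\<in>EG. x \<in> h \<and> h \<subseteq> S}"
    by blast
  hence "card {h\<in>EG. x \<in> h \<and> \<not> h \<subseteq> insert x (entities - S)} \<le>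
      card {h\<in>EG. x \<in> h \<and> h \<subseteq> S}"
    using finite_EG by (intro card_mono) simp_all
  hence "card {h\<in>EG. x \<in> h \<and> \<not> h \<subseteq> insert x (entities - S)} \<le> 7"
    using x(2) by (rule order_trans)
  hence "orientable_within EG 7 (insert x (entities - S))"
    using Suc.prems(2) x(1) EG_pair finite_EG by (intro orientable_within_insert) auto
  moreover have "n = card (S - {x})"
    using Suc.hyps(2) x(1) by simp
  moreover have "S - {x} \<subseteq> Vertex ` V \<union> Face ` F"
    using Suc.prems(1) by blast
  ultimately show ?case
    unfolding eq using Suc.hyps(1)[of "S - {x}"] by blast
qed

lemma alon_tarsi_le_8: "alon_tarsi_number (facial_entire_verts V E) EG \<le> 8"
proof -
  obtain K where K: "K \<subseteq> E" "K \<noteq> {}" "orientable_within EG 7 (Edge ` K)"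
    using initial_set by (elim exE conjE)
  have "entities - (Vertex ` V \<union> Face ` F) = Edge ` E"
    by (auto simp: entities_def)
  hence "orientable_within EG 7 entities"
    using orientable_entities[OF order_refl] orientable_edges[OF K] by simp
  hence "alon_tarsi_number entities EG \<le> Suc 7"
    by (intro alon_tarsi_number_le finite_EG) (use EG_pair in auto)
  thus ?thesis
    by (simp add: facial_entire_verts_def entities_def)
qed

end

theorem theorem3p8:
  fixes V :: "complex set" and E :: "complex set set"
  assumes "simple_plane_graph V E"
    and "graph_connected V E"
    and "\<And>f. f \<in> faces V E \<Longrightarrow> bounded_by_simple_cycle V E f"
  shows "alon_tarsi_number (facial_entire_verts V E) (facial_entire_edges V E) \<le> 8"
proof -
  interpret cycle_faced_plane_graph V E
    using assms by unfold_locales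
  show ?thesis
    by (rule alon_tarsi_le_8)
qed

end
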